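(* Let $K(z,w)=\sum_{n=0}^\infty b_n(z\bar w)^n$, $b_n>0$, be a positive definite kernel on $\mathbb D\times\mathbb D$ such that for each $\gamma\in\mathbb R$, $\lim_{|z|\to 1}(1-|z|^2)^{\gamma}K(z,z)$ is either $0$ or $\infty$. Assume that the adjoint $M_z^*$ of the operator of multiplication by the coordinate function $z$ on $(\mathcal H,K)$ is in $B_1(\mathbb D)$ and is weakly homogeneous. Then, for every $\lambda>0$, the multiplication operator $M_z$ on $(\mathcal H,KK^{(\lambda)})$ is a Möbius bounded weakly homogeneous operator which is not similar to any homogeneous operator.
   Context: $\mathbb D$ is the open unit disc in $\mathbb C$. Möb is the group of all biholomorphic automorphisms $\varphi_{\theta,a}(z)=e^{i\theta}\frac{z-a}{1-\bar a z}$ of $\mathbb D$ ($\theta\in[0,2\pi)$, $a\in\mathbb D$). For a bounded operator $T$ on a complex separable Hilbert space with $\sigma(T)\subseteq\overline{\mathbb D}$, $\varphi(T)$ is defined by the holomorphic functional calculus. Such a $T$ is homogeneous if $\varphi(T)$ is unitarily equivalent to $T$ for all $\varphi\in$ Möb; weakly homogeneous if $\varphi(T)$ is similar to $T$ (i.e. $\varphi(T)=LTL^{-1}$ for some bounded invertible $L$, depending on $\varphi$) for all $\varphi\in$ Möb; Möbius bounded if $\sup_{\varphi\in \text{Möb}}\|\varphi(T)\|<\infty$ (all three notions include the requirement $\sigma(T)\subseteq\overline{\mathbb D}$). A scalar kernel $K:\mathbb D\times\mathbb D\to\mathbb C$ (always holomorphic in the first and anti-holomorphic in the second variable) is non-negative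 (resp. positive) definite if for all finite sets of distinct points $w_1,\dots,w_l$ the matrix $(K(w_i,w_j))_{i,j}$ is non-negative definite (resp. non-negative definite and invertible). $(\mathcal H,K)$ denotes the reproducing kernel Hilbert space of holomorphic functions determined by $K$. $K^{(\lambda)}(z,w)=(1-z\bar w)^{-\lambda}$, and $KK^{(\lambda)}$ is the pointwise product. Cowen–Douglas class: a bounded operator $T$ on a Hilbert space $H$ is in $B_1(\mathbb D)$ if for all $w\in\mathbb D$, $\dim\ker(T-w)=1$ and $\operatorname{ran}(T-w)$ is closed, and the closed linear span of $\{\ker(T-w):w\in\mathbb D\}$ is $H$. *)

theory Defs
  imports "HOL-Complex_Analysis.Complex_Analysis" "HOL-Library.Function_Algebras"
begin

section \<open>Complex separable Hilbert spaces\<close>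

text \<open>
  A reproducing kernel Hilbert space depends on a kernel, so it cannot be a type.  A Hilbert space
  is therefore a linear subspace \<open>hcarrier H\<close> of an ambient complex vector space, with an inner
  product on that subspace which is linear in the first argument.  The scalar multiplication is a
  parameter because there is no type class of complex vector spaces.
\<close>

record 'v hilb =
  hcarrier :: "'v set"
  hscale :: "complex \<Rightarrow> 'v \<Rightarrow> 'v"
  hinner :: "'v \<Rightarrow> 'v \<Rightarrow> complex"

definition hnorm :: "('v, 'm) hilb_scheme \<Rightarrow> 'v \<Rightarrow> real" where
  "hnorm H x = sqrt (Re (hinner H x x))"

text \<open>
  The value \<open>0\<close> outside the carrier is needed because the locale \<open>Metric_space\<close> requires distances to be
  non-negative and symmetric on the whole type.
\<close>

definition hdist :: "('v::ab_group_add, 'm) hilb_scheme \<Rightarrow> 'v \<Rightarrow> 'v \<Rightarrow> real" where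
  "hdist H x y = (if x \<in> hcarrier H \<and> y \<in> hcarrier H then hnorm H (x - y) else 0)"

definition htopology :: "('v::ab_group_add, 'm) hilb_scheme \<Rightarrow> 'v topology" where
  "htopology H = Metric_space.mtopology (hcarrier H) (hdist H)"

definition inner_product_space :: "('v::ab_group_add, 'm) hilb_scheme \<Rightarrow> bool" where
  "inner_product_space H \<longleftrightarrow>
     vector_space (hscale H) \<and>
     module.subspace (hscale H) (hcarrier H) \<and>
     (\<forall>x\<in>hcarrier H. \<forall>y\<in>hcarrier H. \<forall>z\<in>hcarrier H.
        hinner H (x + y) z = hinner H x z + hinner H y z) \<and>
     (\<forall>c. \<forall>x\<in>hcarrier H. \<forall>y\<in>hcarrier H. hinner H (hscale H c x) y = c * hinner H x y) \<and>
     (\<forall>x\<in>hcarrier H. \<forall>y\<in>hcarrier H. hinner H y x = cnj (hinner H x y)) \<and>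
     (\<forall>x\<in>hcarrier H. x \<noteq> 0 \<longrightarrow> 0 < Re (hinner H x x))"

lemma Metric_space_hdist:
  fixes H :: "('v::ab_group_add, 'm) hilb_scheme"
  assumes "inner_product_space H"
  shows "Metric_space (hcarrier H) (hdist H)"
proof -
  interpret vector_space "hscale H"
    using assms by (simp add: inner_product_space_def)
  let ?C = "hcarrier H" and ?s = "hscale H" and ?i = "hinner H"
  note ip = assms[unfolded inner_product_space_def, THEN conjunct2]
  note sub = ip[THEN conjunct1]
  note add = ip[THEN conjunct2, THEN conjunct1, rule_format]
  note scl = ip[THEN conjunct2, THEN conjunct2, THEN conjunct1, rule_format]
  note cj = ip[THEN conjunct2, THEN conjunct2, THEN conjunct2, THEN conjunct1, rule_format]
  note pos = ip[THEN conjunct2, THEN conjunct2, THEN conjunct2, THEN conjunct2, rule_format]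
  note mem = subspace_0[OF sub] subspace_add[OF sub] subspace_diff[OF sub] subspace_scale[OF sub]
  have z0: "?i 0 x = 0" if "x \<in> ?C" for x
    using scl[OF mem(1) that, of 0] by simp
  have nn: "0 \<le> Re (?i x x)" if "x \<in> ?C" for x
    using pos[OF that] z0[of 0] mem(1) by (cases "x = 0") auto
  have addr: "?i x (y + z) = ?i x y + ?i x z" if "x \<in> ?C" "y \<in> ?C" "z \<in> ?C" for x y z
    using add[of y z x] cj[of "y + z" x] cj[of y x] cj[of z x] that mem(2) by simp
  have sclr: "?i x (?s c y) = cnj c * ?i x y" if "x \<in> ?C" "y \<in> ?C" for c x y
    using scl[of y x c] cj[of "?s c y" x] cj[of y x] that mem(4) by simp
  have exp2: "Re (?i (x + ?s (of_real t) y) (x + ?s (of_real t) y))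
      = Re (?i x x) + 2 * t * Re (?i x y) + t\<^sup>2 * Re (?i y y)"
    if "x \<in> ?C" "y \<in> ?C" for x y t
  proof -
    have m: "?s (of_real t) y \<in> ?C" "x + ?s (of_real t) y \<in> ?C"
      using that mem(2,4) by blast+
    have "?i (x + ?s (of_real t) y) (x + ?s (of_real t) y)
        = ?i x x + of_real t * ?i x y + of_real t * (?i y x + of_real t * ?i y y)"
      using that m by (simp only: add addr scl sclr complex_cnj_complex_of_real) (simp add: algebra_simps)
    then show ?thesis
      using cj[OF that] by (simp add: algebra_simps power2_eq_square)
  qed
  have CS: "(Re (?i x y))\<^sup>2 \<le> Re (?i x x) * Re (?i y y)" if "x \<in> ?C" "y \<in> ?C" for x y
  proof (cases "y = 0")
    case True
    then show ?thesis using that z0[of x] cj[of 0 x] z0[of 0] mem(1) by simp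
  next
    case False
    define p where "p = Re (?i y y)"
    define q where "q = Re (?i x y)"
    have p: "p > 0" using pos[OF that(2) False] by (simp add: p_def)
    have "0 \<le> Re (?i x x) + 2 * (- q / p) * q + (- q / p)\<^sup>2 * p"
      using nn[of "x + ?s (of_real (- q / p)) y"] exp2[OF that, of "- q / p"] that mem
      by (simp add: p_def q_def)
    also have "\<dots> = Re (?i x x) - q\<^sup>2 / p"
      using p by (simp add: power2_eq_square field_simps)
    finally have "q\<^sup>2 \<le> Re (?i x x) * p"
      using p by (simp add: field_simps)
    then show ?thesis by (simp add: p_def q_def)
  qed
  have tri: "hnorm H (x + y) \<le> hnorm H x + hnorm H y" if "x \<in> ?C" "y \<in> ?C" for x y
  proof -
    have "Re (?i x y) \<le> hnorm H x * hnorm H y"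
      using real_sqrt_le_mono[OF CS[OF that]] by (simp add: hnorm_def real_sqrt_mult)
    then have "Re (?i (x + y) (x + y)) \<le> (hnorm H x + hnorm H y)\<^sup>2"
      using exp2[OF that, of 1] nn that by (simp add: hnorm_def power2_sum)
    then show ?thesis
      unfolding hnorm_def[of H "x + y"]
      by (rule real_le_lsqrt[rotated]) (use nn that in \<open>auto simp: hnorm_def\<close>)
  qed
  have minus: "hnorm H (y - x) = hnorm H (x - y)" if "x \<in> ?C" "y \<in> ?C" for x y
  proof -
    have "?s (- 1) (x - y) = y - x" by simp
    then show ?thesis
      using scl[of "x - y" "y - x" "- 1"] sclr[of "x - y" "x - y" "- 1"] that mem(3)
      by (simp add: hnorm_def)
  qed
  show ?thesis
  proof
    show "0 \<le> hdist H x y" for x y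
      using nn mem(3) by (simp add: hdist_def hnorm_def)
    show "hdist H x y = hdist H y x" for x y
      using minus by (simp add: hdist_def)
    show "hdist H x y = 0 \<longleftrightarrow> x = y" if "x \<in> ?C" "y \<in> ?C" for x y
      using that pos[of "x - y"] z0[of 0] mem(1,3) by (force simp: hdist_def hnorm_def)
    show "hdist H x z \<le> hdist H x y + hdist H y z" if "x \<in> ?C" "y \<in> ?C" "z \<in> ?C" for x y z
      using that tri[of "x - y" "y - z"] mem(3) by (simp add: hdist_def)
  qed
qed

definition hilbert_space :: "('v::ab_group_add, 'm) hilb_scheme \<Rightarrow> bool" where
  "hilbert_space H \<longleftrightarrow>
     inner_product_space H \<and>
     Metric_space.mcomplete (hcarrier H) (hdist H) \<and>
     separable_space (htopology H)"


section \<open>Bounded operators\<close>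

text \<open>Only the values of an operator on the carrier are relevant.\<close>

definition bounded_map ::
  "('v::ab_group_add, 'm) hilb_scheme \<Rightarrow> ('u::ab_group_add, 'n) hilb_scheme \<Rightarrow> ('v \<Rightarrow> 'u) \<Rightarrow> bool" where
  "bounded_map H G L \<longleftrightarrow>
     (\<forall>x\<in>hcarrier H. L x \<in> hcarrier G) \<and>
     (\<forall>x\<in>hcarrier H. \<forall>y\<in>hcarrier H. L (x + y) = L x + L y) \<and>
     (\<forall>c. \<forall>x\<in>hcarrier H. L (hscale H c x) = hscale G c (L x)) \<and>
     (\<exists>C. \<forall>x\<in>hcarrier H. hnorm G (L x) \<le> C * hnorm H x)"

definition inverse_maps ::
  "('v, 'm) hilb_scheme \<Rightarrow> ('u, 'n) hilb_scheme \<Rightarrow> ('v \<Rightarrow> 'u) \<Rightarrow> ('u \<Rightarrow> 'v) \<Rightarrow> bool" where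
  "inverse_maps H G L L' \<longleftrightarrow>
     (\<forall>x\<in>hcarrier H. L' (L x) = x) \<and> (\<forall>y\<in>hcarrier G. L (L' y) = y)"

definition similar_ops ::
  "('v::ab_group_add, 'm) hilb_scheme \<Rightarrow> ('v \<Rightarrow> 'v) \<Rightarrow>
   ('u::ab_group_add, 'n) hilb_scheme \<Rightarrow> ('u \<Rightarrow> 'u) \<Rightarrow> bool" where
  "similar_ops H T G S \<longleftrightarrow>
     (\<exists>L L'. bounded_map H G L \<and> bounded_map G H L' \<and> inverse_maps H G L L' \<and>
        (\<forall>y\<in>hcarrier G. S y = L (T (L' y))))"

definition unitarily_equivalent ::
  "('v::ab_group_add, 'm) hilb_scheme \<Rightarrow> ('v \<Rightarrow> 'v) \<Rightarrow>
   ('u::ab_group_add, 'n) hilb_scheme \<Rightarrow> ('u \<Rightarrow> 'u) \<Rightarrow> bool" where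
  "unitarily_equivalent H T G S \<longleftrightarrow>
     (\<exists>U U'. bounded_map H G U \<and> bounded_map G H U' \<and> inverse_maps H G U U' \<and>
        (\<forall>x\<in>hcarrier H. \<forall>y\<in>hcarrier H. hinner G (U x) (U y) = hinner H x y) \<and>
        (\<forall>y\<in>hcarrier G. S y = U (T (U' y))))"

definition op_norm :: "('v, 'm) hilb_scheme \<Rightarrow> ('v \<Rightarrow> 'v) \<Rightarrow> ennreal" where
  "op_norm H T = (SUP x\<in>{x \<in> hcarrier H. hnorm H x \<le> 1}. ennreal (hnorm H (T x)))"

definition adjoint_op :: "('v, 'm) hilb_scheme \<Rightarrow> ('v \<Rightarrow> 'v) \<Rightarrow> 'v \<Rightarrow> 'v" where
  "adjoint_op H T y =
     (THE v. v \<in> hcarrier H \<and> (\<forall>x\<in>hcarrier H. hinner H (T x) y = hinner H x v))"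


section \<open>Spectrum and holomorphic functional calculus\<close>

definition spectrum :: "('v::ab_group_add, 'm) hilb_scheme \<Rightarrow> ('v \<Rightarrow> 'v) \<Rightarrow> complex set" where
  "spectrum H T =
     {\<zeta>. \<not> (\<exists>R. bounded_map H H R \<and> inverse_maps H H (\<lambda>x. hscale H \<zeta> x - T x) R)}"

definition resolvent ::
  "('v::ab_group_add, 'm) hilb_scheme \<Rightarrow> ('v \<Rightarrow> 'v) \<Rightarrow> complex \<Rightarrow> 'v \<Rightarrow> 'v" where
  "resolvent H T \<zeta> = inv_into (hcarrier H) (\<lambda>x. hscale H \<zeta> x - T x)"

text \<open>
  The Riesz-Dunford integral
    \<open>f(T) = 1 / (2 \<pi> \<i>) \<integral> f(\<zeta>) (\<zeta> - T)\<^sup>-\<^sup>1 d\<zeta>\<close>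
  over the circle \<open>|\<zeta>| = r\<close>, taken weakly, for \<open>T\<close> with spectrum in the closed unit disc and \<open>f\<close>
  holomorphic on a neighbourhood of the closed unit disc.  The circle has to lie inside the domain
  of \<open>f\<close>, so \<open>r > 1\<close> is taken close to \<open>1\<close>; for all such \<open>r\<close> the integral is the same.
\<close>

definition hol_calculus ::
  "('v::ab_group_add, 'm) hilb_scheme \<Rightarrow> (complex \<Rightarrow> complex) \<Rightarrow> ('v \<Rightarrow> 'v) \<Rightarrow> 'v \<Rightarrow> 'v" where
  "hol_calculus H f T x =
     (THE v. v \<in> hcarrier H \<and>
        (\<forall>y\<in>hcarrier H. \<forall>\<^sub>F r in at_right 1.
           ((\<lambda>\<zeta>. f \<zeta> * hinner H (resolvent H T \<zeta> x) y)
              has_contour_integral (2 * of_real pi * \<i> * hinner H v y)) (circlepath 0 r)))"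


section \<open>Classes of operators\<close>

definition Moeb :: "(complex \<Rightarrow> complex) set" where
  "Moeb = {Moebius_function \<theta> a | \<theta> a. 0 \<le> \<theta> \<and> \<theta> < 2 * pi \<and> a \<in> ball 0 1}"

definition disc_operator :: "('v::ab_group_add, 'm) hilb_scheme \<Rightarrow> ('v \<Rightarrow> 'v) \<Rightarrow> bool" where
  "disc_operator H T \<longleftrightarrow> hilbert_space H \<and> bounded_map H H T \<and> spectrum H T \<subseteq> cball 0 1"

definition homogeneous :: "('v::ab_group_add, 'm) hilb_scheme \<Rightarrow> ('v \<Rightarrow> 'v) \<Rightarrow> bool" where
  "homogeneous H T \<longleftrightarrow>
     disc_operator H T \<and> (\<forall>\<phi>\<in>Moeb. unitarily_equivalent H T H (hol_calculus H \<phi> T))"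

definition weakly_homogeneous :: "('v::ab_group_add, 'm) hilb_scheme \<Rightarrow> ('v \<Rightarrow> 'v) \<Rightarrow> bool" where
  "weakly_homogeneous H T \<longleftrightarrow>
     disc_operator H T \<and> (\<forall>\<phi>\<in>Moeb. similar_ops H T H (hol_calculus H \<phi> T))"

definition Moebius_bounded :: "('v::ab_group_add, 'm) hilb_scheme \<Rightarrow> ('v \<Rightarrow> 'v) \<Rightarrow> bool" where
  "Moebius_bounded H T \<longleftrightarrow>
     disc_operator H T \<and> (SUP \<phi>\<in>Moeb. op_norm H (hol_calculus H \<phi> T)) < \<infinity>"

definition eigenspace ::
  "('v, 'm) hilb_scheme \<Rightarrow> ('v \<Rightarrow> 'v) \<Rightarrow> complex \<Rightarrow> 'v set" where
  "eigenspace H T w = {x \<in> hcarrier H. T x = hscale H w x}"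

definition cowen_douglas_B1 :: "('v::ab_group_add, 'm) hilb_scheme \<Rightarrow> ('v \<Rightarrow> 'v) \<Rightarrow> bool" where
  "cowen_douglas_B1 H T \<longleftrightarrow>
     hilbert_space H \<and> bounded_map H H T \<and>
     (\<forall>w\<in>ball 0 1.
        vector_space.dim (hscale H) (eigenspace H T w) = 1 \<and>
        closedin (htopology H) ((\<lambda>x. T x - hscale H w x) ` hcarrier H)) \<and>
     htopology H closure_of (module.span (hscale H) (\<Union>w\<in>ball 0 1. eigenspace H T w)) = hcarrier H"


section \<open>Kernels and reproducing kernel Hilbert spaces\<close>

definition sesqui_holomorphic :: "(complex \<Rightarrow> complex \<Rightarrow> complex) \<Rightarrow> bool" where
  "sesqui_holomorphic K \<longleftrightarrow>
     (\<forall>w\<in>ball 0 1. (\<lambda>z. K z w) holomorphic_on ball 0 1) \<and>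
     (\<forall>z\<in>ball 0 1. (\<lambda>w. cnj (K z w)) holomorphic_on ball 0 1)"

definition nonneg_definite_kernel :: "(complex \<Rightarrow> complex \<Rightarrow> complex) \<Rightarrow> bool" where
  "nonneg_definite_kernel K \<longleftrightarrow>
     sesqui_holomorphic K \<and>
     (\<forall>W c. finite W \<and> W \<subseteq> ball 0 1 \<longrightarrow>
        (\<Sum>v\<in>W. \<Sum>w\<in>W. cnj (c v) * K v w * c w) \<in> \<real>\<^sub>\<ge>\<^sub>0)"

text \<open>The second condition states that the matrix \<open>(K v w)\<close> indexed by \<open>W\<close> has the inverse \<open>B\<close>.\<close>

definition positive_definite_kernel :: "(complex \<Rightarrow> complex \<Rightarrow> complex) \<Rightarrow> bool" where
  "positive_definite_kernel K \<longleftrightarrow>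
     nonneg_definite_kernel K \<and>
     (\<forall>W. finite W \<and> W \<subseteq> ball 0 1 \<longrightarrow>
        (\<exists>B. \<forall>v\<in>W. \<forall>w\<in>W.
           (\<Sum>u\<in>W. K v u * B u w) = (if v = w then 1 else 0) \<and>
           (\<Sum>u\<in>W. B v u * K u w) = (if v = w then 1 else 0)))"

definition power_kernel :: "real \<Rightarrow> complex \<Rightarrow> complex \<Rightarrow> complex" where
  "power_kernel \<mu> z w = (1 - z * cnj w) powr (of_real (- \<mu>))"

definition disc_restrict :: "(complex \<Rightarrow> complex) \<Rightarrow> complex \<Rightarrow> complex" where
  "disc_restrict f z = (if z \<in> ball 0 1 then f z else 0)"

text \<open>
  \<open>is_rkhs K H\<close> says that \<open>H\<close> is the reproducing kernel Hilbert space of \<open>K\<close>, which is determined by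
  \<open>K\<close>.  Functions on the disc are represented by functions on the plane vanishing off the disc.
\<close>

definition is_rkhs ::
  "(complex \<Rightarrow> complex \<Rightarrow> complex) \<Rightarrow> (complex \<Rightarrow> complex) hilb \<Rightarrow> bool" where
  "is_rkhs K H \<longleftrightarrow>
     hilbert_space H \<and>
     hscale H = (\<lambda>c f z. c * f z) \<and>
     (\<forall>f\<in>hcarrier H. f holomorphic_on ball 0 1 \<and> (\<forall>z. z \<notin> ball 0 1 \<longrightarrow> f z = 0)) \<and>
     (\<forall>w\<in>ball 0 1. disc_restrict (\<lambda>z. K z w) \<in> hcarrier H \<and>
        (\<forall>f\<in>hcarrier H. hinner H f (disc_restrict (\<lambda>z. K z w)) = f w))"

definition mult_z :: "(complex \<Rightarrow> complex) \<Rightarrow> complex \<Rightarrow> complex" where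
  "mult_z f = (\<lambda>z. z * f z)"

definition to_circle :: "complex filter" where
  "to_circle = filtercomap norm (at_left 1)"

end

theory Submission
  imports Defs
begin

text \<open>
  Multiplying the kernel \<open>K\<close> by \<open>K\<^sup>\<mu> = (1 - z cnj w)\<^sup>-\<^sup>\<mu>\<close> inherits one property from each factor.  Everything is read off
  from kernels: on a reproducing kernel space a weighted composition operator \<open>f \<mapsto> g (f \<circ> \<psi>)\<close> has norm
  at most \<open>C\<close> if \<open>C\<^sup>2 K(z, w) - g(z) K(\<psi>(z), \<psi>(w)) cnj (g(w))\<close> is non-negative definite
  (\<open>wcomp_bounded\<close>), and such inequalities survive multiplication by a non-negative definite kernel
  (\<open>psd_mult_power_series\<close>).

  Moebius boundedness comes from \<open>K\<^sup>\<mu>\<close>.  It satisfies \<open>K\<^sup>\<mu>(z, w) = \<eta>(z) K\<^sup>\<mu>(\<phi>(z), \<phi>(w)) cnj (\<eta>(w))\<close> for every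
  Moebius map \<open>\<phi>\<close>, so that \<open>\<phi>\<close> is a multiplier of its space with the same norm as the coordinate function, at most
  \<open>sqrt (1 + 1 / \<mu>)\<close> whatever \<open>\<phi>\<close> is; the product with \<open>K\<close> keeps this bound (\<open>product_multiplier\<close>).

  Weak homogeneity comes from \<open>K\<close>.  An operator that intertwines the adjoint of the multiplication with its
  image under a Moebius map permutes the eigenspaces, which are spanned by the kernel functions.  Its adjoint is
  therefore a bounded invertible weighted composition operator \<open>f \<mapsto> g (f \<circ> \<phi>)\<close>
  (\<open>weakly_homogeneous_kernel\<close>).  On the product space the weight \<open>g \<eta>\<close> does the same
  (\<open>product_inequality\<close>, \<open>mult_z_similar\<close>).

  If the multiplication were similar to a homogeneous operator, then the evaluations, transported to
  the space of that operator, would have a Gram matrix \<open>Q\<close> which every Moebius map preserves up to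
  weights and which is comparable to \<open>K K\<^sup>\<mu>\<close> on the diagonal.  An invariant kernel behaves like a power:
  normalised at the origin it depends on \<open>z cnj w\<close> alone and satisfies a Cauchy functional equation
  (\<open>F_functional_equation\<close>).  Since \<open>K K\<^sup>\<mu>\<close> is radial, it follows that \<open>(1 - |z|\<^sup>2)\<^sup>p K(z, z)\<close> stays between two
  positive constants for some real \<open>p\<close> (\<open>radial_growth\<close>), against the hypothesis on its limits.

  The connection between operators and kernels needs the functional calculus for Moebius maps only.
  It is identified with the algebraic expression \<open>exp(\<i> \<theta>) (T - a) (1 - cnj a T)\<^sup>-\<^sup>1\<close>
  (\<open>hol_calculus_Moebius\<close>).
\<close>

section \<open>Inner product spaces and the Riesz representation\<close>

locale inner_space =
  fixes H :: "('v::ab_group_add) hilb"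
  assumes inner_product: "inner_product_space H"
begin

sublocale vector_space "hscale H"
  using inner_product by (simp add: inner_product_space_def)

abbreviation "X \<equiv> hcarrier H"
abbreviation "ip \<equiv> hinner H"
abbreviation "sc \<equiv> hscale H"
abbreviation "nrm \<equiv> hnorm H"

lemma subspace_carrier: "subspace X"
  using inner_product by (simp add: inner_product_space_def)

lemmas carrier_closed [simp] =
  subspace_0[OF subspace_carrier] subspace_add[OF subspace_carrier] subspace_diff[OF subspace_carrier]
  subspace_scale[OF subspace_carrier] subspace_neg[OF subspace_carrier]

lemma carrier_sum: "(\<And>i. i \<in> W \<Longrightarrow> f i \<in> X) \<Longrightarrow> (\<Sum>i\<in>W. f i) \<in> X"
  by (rule subspace_sum[OF subspace_carrier])

lemmas inner_product_axioms = inner_product[unfolded inner_product_space_def, THEN conjunct2, THEN conjunct2]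

lemma ip_add_left: "\<lbrakk>x \<in> X; y \<in> X; z \<in> X\<rbrakk> \<Longrightarrow> ip (x + y) z = ip x z + ip y z"
  by (rule inner_product_axioms[THEN conjunct1, rule_format])

lemma ip_scale_left: "\<lbrakk>x \<in> X; y \<in> X\<rbrakk> \<Longrightarrow> ip (sc c x) y = c * ip x y"
  by (rule inner_product_axioms[THEN conjunct2, THEN conjunct1, rule_format])

lemma ip_cnj: "\<lbrakk>x \<in> X; y \<in> X\<rbrakk> \<Longrightarrow> ip y x = cnj (ip x y)"
  by (rule inner_product_axioms[THEN conjunct2, THEN conjunct2, THEN conjunct1, rule_format])

lemma ip_pos: "\<lbrakk>x \<in> X; x \<noteq> 0\<rbrakk> \<Longrightarrow> 0 < Re (ip x x)"
  by (rule inner_product_axioms[THEN conjunct2, THEN conjunct2, THEN conjunct2, rule_format])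

lemma ip_add_right: "\<lbrakk>x \<in> X; y \<in> X; z \<in> X\<rbrakk> \<Longrightarrow> ip x (y + z) = ip x y + ip x z"
  using ip_add_left[of y z x] ip_cnj[of "y + z" x] ip_cnj[of y x] ip_cnj[of z x] by simp

lemma ip_scale_right: "\<lbrakk>x \<in> X; y \<in> X\<rbrakk> \<Longrightarrow> ip x (sc c y) = cnj c * ip x y"
  using ip_scale_left[of y x c] ip_cnj[of "sc c y" x] ip_cnj[of y x] by simp

lemma ip_zero [simp]: "x \<in> X \<Longrightarrow> ip 0 x = 0" "x \<in> X \<Longrightarrow> ip x 0 = 0"
  using ip_scale_left[of 0 x 0] ip_scale_right[of x 0 0] by auto

lemma ip_minus_left: "\<lbrakk>x \<in> X; y \<in> X\<rbrakk> \<Longrightarrow> ip (- x) y = - ip x y"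
  using ip_scale_left[of x y "-1"] by simp

lemma ip_minus_right: "\<lbrakk>x \<in> X; y \<in> X\<rbrakk> \<Longrightarrow> ip x (- y) = - ip x y"
  using ip_scale_right[of x y "-1"] by simp

lemma ip_diff_left: "\<lbrakk>x \<in> X; y \<in> X; z \<in> X\<rbrakk> \<Longrightarrow> ip (x - y) z = ip x z - ip y z"
  using ip_add_left[of x "-y" z] ip_minus_left[of y z] by simp

lemma ip_diff_right: "\<lbrakk>x \<in> X; y \<in> X; z \<in> X\<rbrakk> \<Longrightarrow> ip x (y - z) = ip x y - ip x z"
  using ip_add_right[of x y "-z"] ip_minus_right[of x z] by simp

lemma ip_sum_left:
  "\<lbrakk>\<And>i. i \<in> W \<Longrightarrow> f i \<in> X; y \<in> X\<rbrakk> \<Longrightarrow> ip (\<Sum>i\<in>W. f i) y = (\<Sum>i\<in>W. ip (f i) y)"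
proof (induction W rule: infinite_finite_induct)
  case (insert i W)
  then show ?case by (simp add: ip_add_left carrier_sum)
qed auto

lemma ip_sum_right:
  "\<lbrakk>\<And>i. i \<in> W \<Longrightarrow> f i \<in> X; y \<in> X\<rbrakk> \<Longrightarrow> ip y (\<Sum>i\<in>W. f i) = (\<Sum>i\<in>W. ip y (f i))"
proof (induction W rule: infinite_finite_induct)
  case (insert i W)
  then show ?case by (simp add: ip_add_right carrier_sum)
qed auto

lemma ip_self_nonneg: "x \<in> X \<Longrightarrow> 0 \<le> Re (ip x x)"
  using ip_pos[of x] by (cases "x = 0") auto

lemma nrm_nonneg [simp]: "x \<in> X \<Longrightarrow> 0 \<le> nrm x"
  using ip_self_nonneg by (simp add: hnorm_def)

lemma nrm_square: "x \<in> X \<Longrightarrow> (nrm x)\<^sup>2 = Re (ip x x)"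
  using ip_self_nonneg by (simp add: hnorm_def)

lemma ip_self: "x \<in> X \<Longrightarrow> ip x x = of_real ((nrm x)\<^sup>2)"
  using ip_cnj[of x x] by (simp add: nrm_square complex_eq_iff)

lemma nrm_zero [simp]: "nrm 0 = 0"
  by (simp add: hnorm_def)

lemma nrm_eq_0: "x \<in> X \<Longrightarrow> nrm x = 0 \<longleftrightarrow> x = 0"
  using ip_pos[of x] by (cases "x = 0") (auto simp: hnorm_def)

lemma nrm_scale: "x \<in> X \<Longrightarrow> nrm (sc c x) = cmod c * nrm x"
proof -
  assume x: "x \<in> X"
  have "ip (sc c x) (sc c x) = (c * cnj c) * of_real ((nrm x)\<^sup>2)"
    using x by (simp add: ip_scale_left ip_scale_right ip_self[OF x] del: of_real_power)
  also have "c * cnj c = of_real ((cmod c)\<^sup>2)"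
    by (simp only: complex_norm_square)
  finally have "ip (sc c x) (sc c x) = of_real ((cmod c * nrm x)\<^sup>2)"
    by (simp add: power_mult_distrib)
  then have "(nrm (sc c x))\<^sup>2 = (cmod c * nrm x)\<^sup>2"
    using x by (simp add: nrm_square)
  then show ?thesis using x by (simp add: power2_eq_iff_nonneg)
qed

lemma nrm_add_square:
  "\<lbrakk>x \<in> X; y \<in> X\<rbrakk> \<Longrightarrow> (nrm (x + y))\<^sup>2 = (nrm x)\<^sup>2 + 2 * Re (ip x y) + (nrm y)\<^sup>2"
  using ip_cnj[of x y] by (simp add: nrm_square ip_add_left ip_add_right)

lemma nrm_diff_square:
  "\<lbrakk>x \<in> X; y \<in> X\<rbrakk> \<Longrightarrow> (nrm (x - y))\<^sup>2 = (nrm x)\<^sup>2 - 2 * Re (ip x y) + (nrm y)\<^sup>2"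
  using ip_cnj[of x y] by (simp add: nrm_square ip_diff_left ip_diff_right)

lemma Cauchy_Schwarz:
  assumes "x \<in> X" "y \<in> X"
  shows "cmod (ip x y) \<le> nrm x * nrm y"
proof (cases "y = 0")
  case False
  define p where "p = (nrm y)\<^sup>2"
  define q where "q = ip x y"
  have p: "p > 0" using False assms nrm_eq_0[of y] by (simp add: p_def)
  have "0 \<le> (nrm (x - sc (q / of_real p) y))\<^sup>2" by simp
  also have "\<dots> = (nrm x)\<^sup>2 - 2 * Re (cnj (q / of_real p) * q) + (cmod (q / of_real p))\<^sup>2 * p"
    using assms by (simp add: nrm_diff_square ip_scale_right nrm_scale p_def q_def power_mult_distrib)
  also have "cnj (q / of_real p) * q = of_real ((cmod q)\<^sup>2 / p)"
    by (simp only: of_real_divide complex_norm_square) (simp add: mult.commute)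
  also have "(cmod (q / of_real p))\<^sup>2 * p = (cmod q)\<^sup>2 / p"
    using p by (simp add: norm_divide power_divide power2_eq_square)
  finally have "(cmod q)\<^sup>2 \<le> (nrm x)\<^sup>2 * p" using p by (simp add: field_simps)
  then have "(cmod q)\<^sup>2 \<le> (nrm x * nrm y)\<^sup>2" by (simp add: p_def power_mult_distrib)
  then show ?thesis unfolding q_def by (rule power2_le_imp_le) (use assms in simp)
qed (use assms in simp)

lemma nrm_triangle: "\<lbrakk>x \<in> X; y \<in> X\<rbrakk> \<Longrightarrow> nrm (x + y) \<le> nrm x + nrm y"
proof (rule power2_le_imp_le)
  assume xy: "x \<in> X" "y \<in> X"
  have "Re (ip x y) \<le> nrm x * nrm y"
    using Cauchy_Schwarz[OF xy] complex_Re_le_cmod[of "ip x y"] by linarith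
  then show "(nrm (x + y))\<^sup>2 \<le> (nrm x + nrm y)\<^sup>2"
    using xy by (simp add: nrm_add_square power2_sum)
qed simp

lemma nrm_sum_square:
  assumes "\<And>i. i \<in> W \<Longrightarrow> e i \<in> X"
  shows "(\<Sum>v\<in>W. \<Sum>w\<in>W. cnj (c v) * ip (e w) (e v) * c w)
           = of_real ((nrm (\<Sum>w\<in>W. sc (c w) (e w)))\<^sup>2)"
proof -
  let ?x = "\<Sum>w\<in>W. sc (c w) (e w)"
  have x: "?x \<in> X" using assms by (intro carrier_sum) auto
  have "ip ?x ?x = (\<Sum>v\<in>W. cnj (c v) * ip ?x (e v))"
    using assms x by (subst ip_sum_right) (auto simp: ip_scale_right)
  also have "\<dots> = (\<Sum>v\<in>W. \<Sum>w\<in>W. cnj (c v) * ip (e w) (e v) * c w)"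
    using assms by (intro sum.cong refl) (simp add: ip_sum_left ip_scale_left sum_distrib_left ac_simps)
  finally show ?thesis using x by (simp add: ip_self)
qed

lemma tendsto_ip:
  assumes "\<And>n. f n \<in> X" "v \<in> X" "y \<in> X" "(\<lambda>n. nrm (f n - v)) \<longlonglongrightarrow> 0"
  shows "(\<lambda>n. ip (f n) y) \<longlonglongrightarrow> ip v y"
proof -
  have "(\<lambda>n. ip (f n) y - ip v y) \<longlonglongrightarrow> 0"
  proof (rule Lim_null_comparison)
    show "\<forall>\<^sub>F n in sequentially. norm (ip (f n) y - ip v y) \<le> nrm (f n - v) * nrm y"
      using assms Cauchy_Schwarz[of "f _ - v" y] by (simp add: ip_diff_left)
    show "(\<lambda>n. nrm (f n - v) * nrm y) \<longlonglongrightarrow> 0"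
      using tendsto_mult_right[OF assms(4), of "nrm y"] by simp
  qed
  then show ?thesis by (simp add: LIM_zero_iff)
qed

lemma ip_ext:
  assumes "u \<in> X" "v \<in> X" "\<And>y. y \<in> X \<Longrightarrow> ip y u = ip y v"
  shows "u = v"
  using assms ip_diff_right[of "u - v" u v] nrm_square[of "u - v"] nrm_eq_0[of "u - v"] by simp

end

locale hilbert = inner_space +
  assumes hilbert: "hilbert_space H"
begin

lemma Cauchy_convergent:
  assumes "\<And>n. f n \<in> X"
    and "\<And>\<epsilon>. \<epsilon> > 0 \<Longrightarrow> \<exists>N. \<forall>n\<ge>N. \<forall>k\<ge>N. nrm (f n - f k) < \<epsilon>"
  obtains v where "v \<in> X" "(\<lambda>n. nrm (f n - v)) \<longlonglongrightarrow> 0"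
proof -
  interpret M: Metric_space X "hdist H" by (rule Metric_space_hdist[OF inner_product])
  have "M.MCauchy f"
    unfolding M.MCauchy_def using assms by (fastforce simp: hdist_def)
  then obtain v where "limitin M.mtopology f v sequentially"
    using hilbert by (auto simp: hilbert_space_def M.mcomplete_def)
  then have "v \<in> X" "\<And>\<epsilon>. \<epsilon> > 0 \<Longrightarrow> \<exists>N. \<forall>n\<ge>N. nrm (f n - v) < \<epsilon>"
    using assms(1) by (auto simp: M.limit_metric_sequentially hdist_def)
  moreover from this have "(\<lambda>n. nrm (f n - v)) \<longlonglongrightarrow> 0"
    using assms(1) by (intro LIMSEQ_I) auto
  ultimately show thesis using that by blast
qed

text \<open>
  A bounded functional is represented by the vector that minimises \<open>\<parallel>x\<parallel>\<^sup>2 - 2 Re l(x)\<close>; the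
  parallelogram law makes every minimising sequence a Cauchy sequence.  The functional is given
  by its graph \<open>V\<close>, so that it may be defined on a subspace only and need not be shown to be well
  defined beforehand.
\<close>

lemma Riesz_graph:
  assumes V: "(0, 0) \<in> V"
    "\<And>x l y m c. (x, l) \<in> V \<Longrightarrow> (y, m) \<in> V \<Longrightarrow> (x + sc c y, l + c * m) \<in> V"
    and VX: "\<And>x l. (x, l) \<in> V \<Longrightarrow> x \<in> X"
    and C: "C \<ge> 0" "\<And>x l. (x, l) \<in> V \<Longrightarrow> cmod l \<le> C * nrm x"
  shows "\<exists>v\<in>X. nrm v \<le> C \<and> (\<forall>(x, l)\<in>V. ip x v = l)"
proof -
  define J where "J = (\<lambda>(x, l). (nrm x)\<^sup>2 - 2 * Re l)"
  have J_lower: "- (C\<^sup>2) \<le> J p" if "p \<in> V" for p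
  proof -
    obtain x l where p: "p = (x, l)" by (cases p)
    have "Re l \<le> C * nrm x" using C(2)[of x l] that p complex_Re_le_cmod[of l] by simp
    moreover have "0 \<le> (nrm x - C)\<^sup>2" by simp
    ultimately show ?thesis by (simp add: J_def p power2_diff algebra_simps)
  qed
  define m where "m = Inf (J ` V)"
  have bdd: "bdd_below (J ` V)" using J_lower by (intro bdd_belowI[of _ "-(C\<^sup>2)"]) auto
  have m_le: "m \<le> J p" if "p \<in> V" for p
    unfolding m_def using bdd that by (intro cInf_lower) auto
  have "\<exists>p\<in>V. J p < m + inverse (Suc n)" for n
    using cInf_lessD[of "J ` V" "m + inverse (Suc n)"] V(1) by (auto simp: m_def)
  then obtain P where P: "\<And>n. P n \<in> V" "\<And>n. J (P n) < m + inverse (Suc n)" by metis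
  define f where "f n = fst (P n)" for n
  define g where "g n = snd (P n)" for n
  have fg: "(f n, g n) \<in> V" "(nrm (f n))\<^sup>2 - 2 * Re (g n) < m + inverse (Suc n)" for n
    using P[of n] by (simp_all add: f_def g_def J_def case_prod_unfold)
  have fX: "f n \<in> X" for n using fg VX by blast
  have par: "(nrm (f n - f k))\<^sup>2 \<le> 2 * (inverse (Suc n) + inverse (Suc k))" for n k
  proof -
    have h: "(sc (1/2) x, l / 2) \<in> V" if "(x, l) \<in> V" for x l
      using V(2)[OF V(1) that, of "1/2"] by simp
    have "(f n + f k, g n + g k) \<in> V" using V(2)[OF fg(1)[of n] fg(1)[of k], of 1] by simp
    from m_le[OF h[OF this]]
    have "m \<le> (nrm (sc (1/2) (f n + f k)))\<^sup>2 - 2 * Re ((g n + g k) / 2)"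
      by (simp only: J_def case_prod_conv)
    also have "nrm (sc (1/2) (f n + f k)) = nrm (f n + f k) / 2"
      using fX by (subst nrm_scale) auto
    also have "2 * Re ((g n + g k) / 2) = Re (g n + g k)"
      by (simp only: Re_divide_numeral)
    finally have "m \<le> (nrm (f n + f k))\<^sup>2 / 4 - Re (g n + g k)"
      by (simp add: power_divide)
    moreover have "(nrm (f n + f k))\<^sup>2 + (nrm (f n - f k))\<^sup>2 = 2 * (nrm (f n))\<^sup>2 + 2 * (nrm (f k))\<^sup>2"
      using fX by (simp add: nrm_add_square nrm_diff_square)
    ultimately show ?thesis using fg(2)[of n] fg(2)[of k] by simp
  qed
  obtain v where v: "v \<in> X" "(\<lambda>n. nrm (f n - v)) \<longlonglongrightarrow> 0"
  proof (rule Cauchy_convergent[OF fX])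
    fix \<epsilon> :: real assume \<epsilon>: "\<epsilon> > 0"
    obtain N where N: "inverse (real (Suc N)) < \<epsilon>\<^sup>2 / 4"
      using reals_Archimedean[of "\<epsilon>\<^sup>2 / 4"] \<epsilon> by auto
    have "nrm (f n - f k) < \<epsilon>" if "n \<ge> N" "k \<ge> N" for n k
    proof (rule power2_less_imp_less)
      define i where "i j = inverse (real (Suc j))" for j
      have "i n \<le> i N" "i k \<le> i N"
        using that by (auto simp: i_def intro!: le_imp_inverse_le)
      then show "(nrm (f n - f k))\<^sup>2 < \<epsilon>\<^sup>2"
        using par[of n k, folded i_def] N[folded i_def] by argo
    qed (use \<epsilon> in simp)
    then show "\<exists>N. \<forall>n\<ge>N. \<forall>k\<ge>N. nrm (f n - f k) < \<epsilon>" by blast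
  qed blast
  have re: "Re (ip v y) = Re l" if y: "(y, l) \<in> V" for y l
  proof -
    have yX: "y \<in> X" using y VX by blast
    \<comment> \<open>The first variation of \<open>J\<close> at the minimiser, in the direction \<open>y\<close>.\<close>
    have var: "0 \<le> 2 * t * (Re (ip v y) - Re l) + t\<^sup>2 * (nrm y)\<^sup>2" for t :: real
    proof (rule LIMSEQ_le)
      have "m \<le> (nrm (f n + sc (of_real t) y))\<^sup>2 - 2 * Re (g n + of_real t * l)" for n
        using m_le[OF V(2)[OF fg(1) y, of n "of_real t"]] by (simp add: J_def)
      also have "\<And>n. (nrm (f n + sc (of_real t) y))\<^sup>2 - 2 * Re (g n + of_real t * l)
          = ((nrm (f n))\<^sup>2 - 2 * Re (g n)) + 2 * t * (Re (ip (f n) y) - Re l) + t\<^sup>2 * (nrm y)\<^sup>2"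
        using fX yX by (simp add: nrm_add_square ip_scale_right nrm_scale power_mult_distrib algebra_simps)
      finally have "- inverse (Suc n) \<le> 2 * t * (Re (ip (f n) y) - Re l) + t\<^sup>2 * (nrm y)\<^sup>2" for n
        using fg(2)[of n] by (smt (verit))
      then show "\<exists>N. \<forall>n\<ge>N. - inverse (Suc n) \<le> 2 * t * (Re (ip (f n) y) - Re l) + t\<^sup>2 * (nrm y)\<^sup>2"
        by blast
      show "(\<lambda>n. - inverse (real (Suc n))) \<longlonglongrightarrow> 0"
        using tendsto_minus[OF LIMSEQ_inverse_real_of_nat] by simp
      show "(\<lambda>n. 2 * t * (Re (ip (f n) y) - Re l) + t\<^sup>2 * (nrm y)\<^sup>2)
          \<longlonglongrightarrow> 2 * t * (Re (ip v y) - Re l) + t\<^sup>2 * (nrm y)\<^sup>2"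
        by (intro tendsto_intros tendsto_ip fX v yX)
    qed
    \<comment> \<open>The polynomial \<open>2 t d + t\<^sup>2 \<parallel>y\<parallel>\<^sup>2\<close> is negative at \<open>t = - d / s\<close> unless \<open>d = 0\<close>;
      the summand \<open>1\<close> in \<open>s\<close> covers \<open>y = 0\<close>.\<close>
    define d where "d = Re (ip v y) - Re l"
    define s where "s = (nrm y)\<^sup>2 + 1"
    have s: "s \<ge> 1" by (simp add: s_def)
    have "0 \<le> 2 * (- d / s) * d + (- d / s)\<^sup>2 * (nrm y)\<^sup>2" using var[of "- d / s"] by (simp add: d_def)
    also have "\<dots> \<le> 2 * (- d / s) * d + (- d / s)\<^sup>2 * s"
      by (intro add_left_mono mult_left_mono) (auto simp: s_def)
    also have "\<dots> = - (d\<^sup>2 / s)" using s by (simp add: power2_eq_square field_simps)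
    finally have "d\<^sup>2 \<le> 0" using s by (simp add: field_simps)
    then show ?thesis by (simp add: d_def)
  qed
  have rep: "ip y v = l" if y: "(y, l) \<in> V" for y l
  proof -
    have yX: "y \<in> X" using y VX by blast
    have "(sc \<i> y, \<i> * l) \<in> V" using V(2)[OF V(1) y, of \<i>] by simp
    from re[OF this] have "Im (ip v y) = - Im l" using v yX by (simp add: ip_scale_right)
    then show ?thesis using re[OF y] ip_cnj[OF v(1) yX] by (simp add: complex_eq_iff)
  qed
  have "nrm v \<le> C"
  proof (rule ccontr)
    assume "\<not> nrm v \<le> C"
    then have less: "C < nrm v" by simp
    have "(nrm v)\<^sup>2 \<le> C * nrm v"
    proof (rule LIMSEQ_le)
      show "(\<lambda>n. Re (ip (f n) v)) \<longlonglongrightarrow> (nrm v)\<^sup>2"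
        using tendsto_Re[OF tendsto_ip[OF fX v(1) v(1) v(2)]] v by (simp add: nrm_square)
      show "(\<lambda>n. C * (nrm (f n - v) + nrm v)) \<longlonglongrightarrow> C * nrm v"
        using v(2) by (auto intro!: tendsto_eq_intros)
      have "Re (ip (f n) v) \<le> C * (nrm (f n - v) + nrm v)" for n
      proof -
        have "Re (ip (f n) v) \<le> C * nrm (f n)"
          using rep[OF fg(1)[of n]] C(2)[OF fg(1)[of n]] complex_Re_le_cmod[of "g n"] by simp
        also have "\<dots> \<le> C * (nrm (f n - v) + nrm v)"
          using nrm_triangle[of "f n - v" v] fX v C by (intro mult_left_mono) auto
        finally show ?thesis .
      qed
      then show "\<exists>N. \<forall>n\<ge>N. Re (ip (f n) v) \<le> C * (nrm (f n - v) + nrm v)" by blast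
    qed
    then show False using less C v by (simp add: power2_eq_square)
  qed
  then show ?thesis using v rep by blast
qed

lemma Riesz_representation:
  assumes add: "\<And>x y. x \<in> X \<Longrightarrow> y \<in> X \<Longrightarrow> l (x + y) = l x + l y"
    and scale: "\<And>c x. x \<in> X \<Longrightarrow> l (sc c x) = c * l x"
    and C: "C \<ge> 0" "\<And>x. x \<in> X \<Longrightarrow> cmod (l x) \<le> C * nrm x"
  obtains v where "v \<in> X" "nrm v \<le> C" "\<And>x. x \<in> X \<Longrightarrow> ip x v = l x"
proof -
  have "\<exists>v\<in>X. nrm v \<le> C \<and> (\<forall>(x, m)\<in>{(x, l x) | x. x \<in> X}. ip x v = m)"
  proof (rule Riesz_graph)
    show "(0, 0) \<in> {(x, l x) | x. x \<in> X}" using scale[of 0 0] by auto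
  qed (use C in \<open>auto simp: add scale\<close>)
  then show thesis using that by auto
qed

text \<open>
  The bound makes \<open>F\<close> consistent with the linear relations between the vectors \<open>e i\<close>, so that it defines a
  functional on their span, represented by a vector.
\<close>

lemma moment_problem:
  assumes e: "\<And>i. i \<in> I \<Longrightarrow> e i \<in> X" and C: "C \<ge> 0"
    and bd: "\<And>W c. finite W \<Longrightarrow> W \<subseteq> I \<Longrightarrow>
      cmod (\<Sum>i\<in>W. c i * F i) \<le> C * nrm (\<Sum>i\<in>W. sc (c i) (e i))"
  shows "\<exists>v\<in>X. nrm v \<le> C \<and> (\<forall>i\<in>I. ip (e i) v = F i)"
proof -
  define V where "V = {(\<Sum>i\<in>W. sc (c i) (e i), \<Sum>i\<in>W. c i * F i) | W c. finite W \<and> W \<subseteq> I}"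
  have "\<exists>v\<in>X. nrm v \<le> C \<and> (\<forall>(x, l)\<in>V. ip x v = l)"
  proof (rule Riesz_graph)
    show "(0, 0) \<in> V" by (force simp: V_def)
    fix x l y m d
    assume "(x, l) \<in> V" "(y, m) \<in> V"
    then obtain W c W' c' where W: "finite W" "W \<subseteq> I" "finite W'" "W' \<subseteq> I"
      and x: "x = (\<Sum>i\<in>W. sc (c i) (e i))" "l = (\<Sum>i\<in>W. c i * F i)"
      and y: "y = (\<Sum>i\<in>W'. sc (c' i) (e i))" "m = (\<Sum>i\<in>W'. c' i * F i)"
      unfolding V_def by blast
    define a where "a i = (if i \<in> W then c i else 0)" for i
    define a' where "a' i = (if i \<in> W' then c' i else 0)" for i
    have x': "x = (\<Sum>i\<in>W \<union> W'. sc (a i) (e i))" "l = (\<Sum>i\<in>W \<union> W'. a i * F i)"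
      unfolding x using W by (auto intro!: sum.mono_neutral_cong_left simp: a_def)
    have y': "y = (\<Sum>i\<in>W \<union> W'. sc (a' i) (e i))" "m = (\<Sum>i\<in>W \<union> W'. a' i * F i)"
      unfolding y using W by (auto intro!: sum.mono_neutral_cong_left simp: a'_def)
    have "x + sc d y = (\<Sum>i\<in>W \<union> W'. sc (a i + d * a' i) (e i))"
      "l + d * m = (\<Sum>i\<in>W \<union> W'. (a i + d * a' i) * F i)"
      unfolding x' y'
      by (simp_all add: scale_sum_right scale_left_distrib sum.distrib distrib_right sum_distrib_left mult.assoc)
    then show "(x + sc d y, l + d * m) \<in> V"
      unfolding V_def using W by (auto intro!: exI[of _ "W \<union> W'"] exI[of _ "\<lambda>i. a i + d * a' i"])
  next
    fix x l assume "(x, l) \<in> V"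
    then obtain W c where W: "finite W" "W \<subseteq> I"
      and x: "x = (\<Sum>i\<in>W. sc (c i) (e i))" "l = (\<Sum>i\<in>W. c i * F i)"
      unfolding V_def by blast
    show "x \<in> X" unfolding x using e W by (intro carrier_sum carrier_closed) auto
    show "cmod l \<le> C * nrm x" unfolding x using bd W by blast
  qed (use C in auto)
  then obtain v where v: "v \<in> X" "nrm v \<le> C" "\<And>x l. (x, l) \<in> V \<Longrightarrow> ip x v = l" by fast
  have "ip (e i) v = F i" if "i \<in> I" for i
  proof (rule v(3))
    have "finite {i}" "{i} \<subseteq> I" "e i = (\<Sum>j\<in>{i}. sc 1 (e j))" "F i = (\<Sum>j\<in>{i}. 1 * F j)"
      using that by auto
    then show "(e i, F i) \<in> V" unfolding V_def
      by (intro CollectI exI[of _ "{i}"] exI[of _ "\<lambda>_. 1"]) simp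
  qed
  then show ?thesis using v by blast
qed

end

lemma hilbertI: "hilbert_space H \<Longrightarrow> hilbert H"
  by unfold_locales (auto simp: hilbert_space_def)

section \<open>The functional calculus of a Moebius map\<close>

text \<open>
  The substitution \<open>\<zeta> = 1/s\<close> turns the integral around infinity into Cauchy's formula at \<open>s = 0\<close>.
\<close>

lemma has_contour_integral_around_infinity:
  assumes hol: "h holomorphic_on {\<zeta>. cmod \<zeta> > 1}"
    and lim: "((\<lambda>s. h (1 / s) / s) \<longlongrightarrow> L) (at 0)" and r: "r > 1"
  shows "(h has_contour_integral (2 * of_real pi * \<i> * L)) (circlepath 0 r)"
proof -
  define k where "k s = (if s = 0 then L else h (1 / s) / s)" for s
  have k0: "k 0 = L" by (simp add: k_def)
  have "k holomorphic_on ball 0 1"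
  proof (rule no_isolated_singularity')
    show "k holomorphic_on ball 0 1 - {0}"
    proof (rule holomorphic_transform)
      have "(h \<circ> (\<lambda>s. 1 / s)) holomorphic_on ball 0 1 - {0}"
        by (rule holomorphic_on_compose_gen[OF _ hol])
           (auto intro!: holomorphic_intros simp: norm_divide divide_simps)
      then show "(\<lambda>s. (h \<circ> (\<lambda>s. 1 / s)) s / s) holomorphic_on ball 0 1 - {0}"
        by (rule holomorphic_on_divide) (auto intro!: holomorphic_intros)
    qed (auto simp: k_def)
    have "(k \<longlongrightarrow> k 0) (at 0)"
      by (rule Lim_transform_eventually[OF lim[THEN tendsto_eq_rhs]])
         (auto simp: k_def eventually_at_filter)
    then show "(k \<longlongrightarrow> k z) (at z within ball 0 1)" if "z \<in> {0}" for z
      using that tendsto_within_subset[of k "nhds (k 0)" 0 UNIV "ball 0 1"] by auto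
  qed auto
  then have "k holomorphic_on cball 0 (1 / r)"
    by (rule holomorphic_on_subset) (use r in \<open>simp add: cball_subset_ball_iff\<close>)
  then have "((\<lambda>u. k u / (u - 0)) has_contour_integral (2 * of_real pi * \<i> * k 0)) (circlepath 0 (1/r))"
    by (rule Cauchy_integral_circlepath_simple) (use r in auto)
  then have 1: "((\<lambda>t. k (of_real (1/r) * exp (2 * of_real pi * \<i> * of_real t)) * (2 * of_real pi * \<i>))
      has_integral (2 * of_real pi * \<i> * L)) (cbox 0 1)"
    unfolding has_contour_integral_def cbox_interval k0
    by (rule has_integral_eq[rotated])
       (use r in \<open>auto simp: vector_derivative_circlepath01, simp add: circlepath\<close>)
  have "((\<lambda>t. k (of_real (1/r) * exp (2 * of_real pi * \<i> * of_real (-1 *\<^sub>R t + 1))) * (2 * of_real pi * \<i>))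
      has_integral (1 / \<bar>-1\<bar> ^ DIM(real)) *\<^sub>R (2 * of_real pi * \<i> * L))
        ((\<lambda>x. (1 / -1) *\<^sub>R x + - ((1 / -1) *\<^sub>R 1)) ` cbox 0 1)"
    by (rule has_integral_affinity[OF 1]) simp
  also have "(\<lambda>x. (1 / -1) *\<^sub>R x + - ((1 / -1) *\<^sub>R 1)) ` cbox 0 1 = {0..1::real}"
    by (force simp: image_iff intro!: bexI[of _ "1 - _"])
  finally have 2: "((\<lambda>t. k (of_real (1/r) * exp (2 * of_real pi * \<i> * of_real (1 - t))) * (2 * of_real pi * \<i>))
      has_integral (2 * of_real pi * \<i> * L)) {0..1}" by simp
  show ?thesis unfolding has_contour_integral_def
  proof (rule has_integral_eq[OF _ 2])
    fix t :: real assume t: "t \<in> {0..1}"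
    define \<zeta> where "\<zeta> = of_real r * exp (2 * of_real pi * \<i> * t)"
    have "of_real (1/r) * exp (2 * of_real pi * \<i> * of_real (1 - t)) = 1 / \<zeta>"
      by (simp add: \<zeta>_def right_diff_distrib exp_diff)
    moreover have "\<zeta> \<noteq> 0" using r by (simp add: \<zeta>_def)
    ultimately show "k (of_real (1/r) * exp (2 * of_real pi * \<i> * of_real (1 - t))) * (2 * of_real pi * \<i>)
       = h (circlepath 0 r t) * vector_derivative (circlepath 0 r) (at t within {0..1})"
      using t by (subst vector_derivative_circlepath01)
        (auto simp: k_def circlepath \<zeta>_def)
  qed
qed

lemma bounded_mapD:
  assumes "bounded_map H G L"
  shows "x \<in> hcarrier H \<Longrightarrow> L x \<in> hcarrier G"
    and "x \<in> hcarrier H \<Longrightarrow> y \<in> hcarrier H \<Longrightarrow> L (x + y) = L x + L y"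
    and "x \<in> hcarrier H \<Longrightarrow> L (hscale H c x) = hscale G c (L x)"
  using assms by (auto simp: bounded_map_def)

context inner_space
begin

lemma bounded_map_bound:
  assumes "bounded_map H G L"
  obtains C where "C \<ge> 0" "\<And>x. x \<in> X \<Longrightarrow> hnorm G (L x) \<le> C * nrm x"
proof -
  obtain C where C: "\<And>x. x \<in> X \<Longrightarrow> hnorm G (L x) \<le> C * nrm x"
    using assms unfolding bounded_map_def by blast
  have "hnorm G (L x) \<le> max C 0 * nrm x" if "x \<in> X" for x
    using C[OF that] mult_right_mono[of C "max C 0" "nrm x"] that by simp
  then show thesis using that[of "max C 0"] by simp
qed

lemma bounded_map_0:
  assumes "bounded_map H G L"
  shows "L 0 = 0"
  using bounded_mapD(2)[OF assms, of 0 0] by simp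

lemma bounded_map_diff:
  assumes "bounded_map H G L" "x \<in> X" "y \<in> X"
  shows "L (x - y) = L x - L y"
  using bounded_mapD(2)[OF assms(1), of "x - y" y] assms by simp

lemma bounded_map_sum:
  assumes L: "bounded_map H G L" and "\<And>i. i \<in> W \<Longrightarrow> f i \<in> X"
  shows "L (\<Sum>i\<in>W. f i) = (\<Sum>i\<in>W. L (f i))"
  using assms(2)
proof (induction W rule: infinite_finite_induct)
  case (insert i W)
  then show ?case by (simp add: bounded_mapD(2)[OF L] carrier_sum)
qed (auto simp: bounded_map_0[OF L])

end

locale disc_op = hilbert +
  fixes T
  assumes disc: "disc_operator H T"
begin

lemma T_bounded: "bounded_map H H T"
  using disc by (simp add: disc_operator_def)

lemmas T_mem [simp] = bounded_mapD(1)[OF T_bounded]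
lemmas T_scale = bounded_mapD(3)[OF T_bounded]
lemmas T_diff = bounded_map_diff[OF T_bounded]

abbreviation "R \<equiv> resolvent H T"

lemma resolvent_props:
  assumes "cmod \<zeta> > 1"
  shows R_mem: "x \<in> X \<Longrightarrow> R \<zeta> x \<in> X"
    and R_right: "x \<in> X \<Longrightarrow> sc \<zeta> (R \<zeta> x) - T (R \<zeta> x) = x"
    and R_left: "x \<in> X \<Longrightarrow> R \<zeta> (sc \<zeta> x - T x) = x"
    and R_bound: "\<exists>C\<ge>0. \<forall>x\<in>X. nrm (R \<zeta> x) \<le> C * nrm x"
proof -
  have "\<zeta> \<notin> spectrum H T" using disc assms by (auto simp: disc_operator_def)
  then obtain S where S: "bounded_map H H S" "inverse_maps H H (\<lambda>x. hscale H \<zeta> x - T x) S"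
    by (auto simp: spectrum_def)
  have inj: "inj_on (\<lambda>x. sc \<zeta> x - T x) X"
    by (rule inj_on_inverseI[of _ S]) (use S(2) in \<open>simp add: inverse_maps_def\<close>)
  have eq: "R \<zeta> x = S x" if "x \<in> X" for x
    unfolding resolvent_def
    by (rule inv_into_f_eq[OF inj]) (use S that bounded_mapD[OF S(1)] in \<open>auto simp: inverse_maps_def\<close>)
  show "x \<in> X \<Longrightarrow> R \<zeta> x \<in> X" using eq bounded_mapD(1)[OF S(1)] by simp
  show "x \<in> X \<Longrightarrow> sc \<zeta> (R \<zeta> x) - T (R \<zeta> x) = x" using eq S(2) by (simp add: inverse_maps_def)
  show "x \<in> X \<Longrightarrow> R \<zeta> (sc \<zeta> x - T x) = x" using eq S(2) by (simp add: inverse_maps_def)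
  show "\<exists>C\<ge>0. \<forall>x\<in>X. nrm (R \<zeta> x) \<le> C * nrm x"
  proof -
    obtain C where "C \<ge> 0" "\<And>x. x \<in> X \<Longrightarrow> nrm (S x) \<le> C * nrm x"
      using bounded_map_bound[OF S(1)] by blast
    then show ?thesis using eq by auto
  qed
qed

lemma R_unique:
  assumes "cmod \<zeta> > 1" "y \<in> X" "sc \<zeta> y - T y = x"
  shows "R \<zeta> x = y"
  using R_left[OF assms(1,2)] assms(3) by simp

lemma resolvent_identity:
  assumes "cmod \<zeta> > 1" "cmod \<eta> > 1" "x \<in> X"
  shows "R \<zeta> x - R \<eta> x = sc (\<eta> - \<zeta>) (R \<eta> (R \<zeta> x))"
proof -
  have m: "R \<zeta> x \<in> X" "R \<eta> (R \<zeta> x) \<in> X" using assms by (simp_all add: R_mem)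
  have "sc \<eta> (R \<zeta> x - sc (\<eta> - \<zeta>) (R \<eta> (R \<zeta> x))) - T (R \<zeta> x - sc (\<eta> - \<zeta>) (R \<eta> (R \<zeta> x)))
     = sc \<eta> (R \<zeta> x) - T (R \<zeta> x) - sc (\<eta> - \<zeta>) (sc \<eta> (R \<eta> (R \<zeta> x)) - T (R \<eta> (R \<zeta> x)))"
    using m by (simp add: T_diff T_scale scale_right_diff_distrib mult.commute)
  also have "\<dots> = sc \<zeta> (R \<zeta> x) - T (R \<zeta> x)"
    using assms m by (simp add: R_right scale_left_diff_distrib)
  also have "\<dots> = x" using assms by (simp add: R_right)
  finally have "R \<eta> x = R \<zeta> x - sc (\<eta> - \<zeta>) (R \<eta> (R \<zeta> x))"
    by (intro R_unique assms) (use m in auto)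
  then show ?thesis by simp
qed

text \<open>
  By the resolvent identity the difference quotient is an inner product with \<open>R \<eta> (R \<zeta> x)\<close>; what
  remains is the continuity of \<open>\<zeta> \<mapsto> R \<zeta> x\<close>, which follows from a local bound.
\<close>

lemma resolvent_has_derivative:
  assumes \<eta>: "cmod \<eta> > 1" and x: "x \<in> X" and y: "y \<in> X"
  shows "((\<lambda>\<zeta>. ip (R \<zeta> x) y) has_field_derivative - ip (R \<eta> (R \<eta> x)) y) (at \<eta>)"
proof -
  obtain C where C: "C \<ge> 0" "\<And>x. x \<in> X \<Longrightarrow> nrm (R \<eta> x) \<le> C * nrm x"
    using R_bound[OF \<eta>] by auto
  \<comment> \<open>The second bound makes \<open>|\<zeta> - \<eta>| C \<le> 1/2\<close>, so that the resolvent identity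
    can be solved for the norm of \<open>R \<zeta> x\<close>.\<close>
  define d where "d = min (cmod \<eta> - 1) (1 / (2 * (C + 1)))"
  have d: "d > 0" using C \<eta> by (simp add: d_def)
  have near: "cmod \<zeta> > 1" "nrm (R \<zeta> x) \<le> 2 * C * nrm x"
    "nrm (R \<zeta> x - R \<eta> x) \<le> cmod (\<zeta> - \<eta>) * (C * (2 * C * nrm x))" if "cmod (\<zeta> - \<eta>) < d" for \<zeta>
  proof -
    show \<zeta>: "cmod \<zeta> > 1"
      using that norm_triangle_sub[of \<eta> \<zeta>] by (simp add: d_def norm_minus_commute)
    have n: "nrm (R \<zeta> x - R \<eta> x) \<le> cmod (\<zeta> - \<eta>) * (C * nrm (R \<zeta> x))"
      using C(2)[of "R \<zeta> x"] \<zeta> \<eta> x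
      by (simp add: resolvent_identity nrm_scale R_mem norm_minus_commute mult_left_mono)
    have "cmod (\<zeta> - \<eta>) * C \<le> (1 / (2 * (C + 1))) * (C + 1)"
      using that C(1) by (intro mult_mono) (auto simp: d_def)
    also have "\<dots> = 1 / 2" using C(1) by (simp add: field_simps)
    finally have "cmod (\<zeta> - \<eta>) * C * nrm (R \<zeta> x) \<le> 1/2 * nrm (R \<zeta> x)"
      using C \<zeta> x by (intro mult_right_mono) (auto simp: R_mem)
    moreover have "nrm (R \<zeta> x) \<le> nrm (R \<zeta> x - R \<eta> x) + nrm (R \<eta> x)"
      using nrm_triangle[of "R \<zeta> x - R \<eta> x" "R \<eta> x"] \<zeta> \<eta> x by (simp add: R_mem)
    ultimately show b: "nrm (R \<zeta> x) \<le> 2 * C * nrm x"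
      using n C(2)[OF x] by (simp add: mult.assoc)
    show "nrm (R \<zeta> x - R \<eta> x) \<le> cmod (\<zeta> - \<eta>) * (C * (2 * C * nrm x))"
      by (rule order_trans[OF n]) (intro mult_left_mono b C norm_ge_zero)
  qed
  define M where "M = C * (C * (2 * C * nrm x)) * nrm y"
  define q where "q \<zeta> = (ip (R \<zeta> x) y - ip (R \<eta> x) y) / (\<zeta> - \<eta>)" for \<zeta>
  have est: "norm (q \<zeta> - - ip (R \<eta> (R \<eta> x)) y) \<le> M * cmod (\<zeta> - \<eta>)"
    if "cmod (\<zeta> - \<eta>) < d" "\<zeta> \<noteq> \<eta>" for \<zeta>
  proof -
    note n = near[OF that(1)]
    have "ip (R \<zeta> x) y - ip (R \<eta> x) y = (\<eta> - \<zeta>) * ip (R \<eta> (R \<zeta> x)) y"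
      using n \<eta> x y resolvent_identity[OF n(1) \<eta> x]
      by (simp add: R_mem ip_scale_left flip: ip_diff_left)
    then have q: "q \<zeta> = - ip (R \<eta> (R \<zeta> x)) y"
      using that by (simp add: q_def divide_simps) (simp add: algebra_simps)
    have id: "R \<eta> (R \<zeta> x) - R \<eta> (R \<eta> x) = R \<eta> (R \<zeta> x - R \<eta> x)"
    proof (rule R_unique[OF \<eta>, symmetric])
      show "R \<eta> (R \<zeta> x) - R \<eta> (R \<eta> x) \<in> X" using n \<eta> x by (simp add: R_mem)
      have "sc \<eta> (R \<eta> (R \<zeta> x) - R \<eta> (R \<eta> x)) - T (R \<eta> (R \<zeta> x) - R \<eta> (R \<eta> x))
         = (sc \<eta> (R \<eta> (R \<zeta> x)) - T (R \<eta> (R \<zeta> x))) - (sc \<eta> (R \<eta> (R \<eta> x)) - T (R \<eta> (R \<eta> x)))"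
        using n \<eta> x by (simp add: R_mem T_diff scale_right_diff_distrib)
      also have "\<dots> = R \<zeta> x - R \<eta> x" using n \<eta> x by (simp add: R_right R_mem)
      finally show "sc \<eta> (R \<eta> (R \<zeta> x) - R \<eta> (R \<eta> x)) - T (R \<eta> (R \<zeta> x) - R \<eta> (R \<eta> x))
        = R \<zeta> x - R \<eta> x" .
    qed
    have "norm (q \<zeta> - - ip (R \<eta> (R \<eta> x)) y) = cmod (ip (R \<eta> (R \<zeta> x - R \<eta> x)) y)"
      using n \<eta> x y by (simp add: q R_mem ip_diff_left norm_minus_commute flip: id)
    also have "\<dots> \<le> nrm (R \<eta> (R \<zeta> x - R \<eta> x)) * nrm y"
      using n \<eta> x y by (intro Cauchy_Schwarz) (auto simp: R_mem)
    also have "\<dots> \<le> (C * (cmod (\<zeta> - \<eta>) * (C * (2 * C * nrm x)))) * nrm y"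
    proof (intro mult_right_mono order_trans[OF C(2)] mult_left_mono)
      show "nrm (R \<zeta> x - R \<eta> x) \<le> cmod (\<zeta> - \<eta>) * (C * (2 * C * nrm x))" by (rule n(3))
    qed (use n \<eta> x y C in \<open>auto simp: R_mem\<close>)
    finally show ?thesis by (simp add: M_def algebra_simps)
  qed
  have "(q \<longlongrightarrow> - ip (R \<eta> (R \<eta> x)) y) (at \<eta>)"
  proof (rule LIM_zero_cancel, rule Lim_null_comparison)
    show "\<forall>\<^sub>F \<zeta> in at \<eta>. norm (q \<zeta> - - ip (R \<eta> (R \<eta> x)) y) \<le> M * cmod (\<zeta> - \<eta>)"
      unfolding eventually_at using d est by (intro exI[of _ d]) (auto simp: dist_norm)
    show "((\<lambda>\<zeta>. M * cmod (\<zeta> - \<eta>)) \<longlongrightarrow> 0) (at \<eta>)"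
      by (auto intro!: tendsto_eq_intros)
  qed
  then show ?thesis by (simp add: has_field_derivative_iff q_def[abs_def])
qed

text \<open>For small \<open>s\<close> the vector \<open>u = R (1 / s) x\<close> satisfies \<open>u = s x + s T u\<close>, so it is close to \<open>s x\<close>.\<close>

lemma resolvent_at_infinity:
  assumes x: "x \<in> X" and y: "y \<in> X"
  shows "((\<lambda>s. ip (R (1 / s) x) y / s) \<longlongrightarrow> ip x y) (at 0)"
proof -
  obtain B where B: "B \<ge> 0" "\<And>x. x \<in> X \<Longrightarrow> nrm (T x) \<le> B * nrm x"
    using bounded_map_bound[OF T_bounded] by blast
  define M where "M = B * (2 * nrm x) * nrm y"
  have est: "norm (ip (R (1 / s) x) y / s - ip x y) \<le> M * cmod s"
    if s: "s \<noteq> 0" "cmod s < 1 / (2 * (B + 1))" for s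
  proof -
    have s1: "cmod s * (2 * (B + 1)) < 1" using s B by (simp add: field_simps)
    have "cmod s * 1 \<le> cmod s * (2 * (B + 1))" using B by (intro mult_left_mono) auto
    with s1 have "cmod s < 1" by linarith
    then have z: "cmod (1 / s) > 1" using s by (simp add: norm_divide)
    define u where "u = R (1 / s) x"
    have u: "u \<in> X" "sc (1 / s) u - T u = x" using z x by (simp_all add: u_def R_mem R_right)
    have "sc s (sc (1 / s) u - T u) = u - sc s (T u)" using s by (simp add: scale_right_diff_distrib)
    then have u': "u = sc s x + sc s (T u)" by (simp only: u(2)) simp
    have "nrm u \<le> cmod s * nrm x + cmod s * nrm (T u)"
      using nrm_triangle[of "sc s x" "sc s (T u)"] u x by (simp add: nrm_scale flip: u')
    also have "cmod s * nrm (T u) \<le> cmod s * (B * nrm u)" using B u by (intro mult_left_mono) auto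
    also have "cmod s * (B * nrm u) \<le> 1 / 2 * nrm u"
    proof -
      have "cmod s * B \<le> 1 / 2" using s1 by (simp add: algebra_simps) (smt (verit) norm_ge_zero)
      from mult_right_mono[OF this, of "nrm u"] show ?thesis using u by (simp add: mult.assoc)
    qed
    finally have nu: "nrm u \<le> 2 * (cmod s * nrm x)" by simp
    have "ip u y / s - ip x y = ip (T u) y"
      using s u x y by (subst u') (simp add: ip_add_left ip_scale_left field_simps)
    also have "cmod \<dots> \<le> nrm (T u) * nrm y" using u y by (intro Cauchy_Schwarz) auto
    also have "\<dots> \<le> B * (2 * (cmod s * nrm x)) * nrm y"
      using B u y nu by (intro mult_right_mono order_trans[OF B(2)] mult_left_mono) auto
    finally show ?thesis by (simp add: u_def M_def algebra_simps)
  qed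
  show ?thesis
  proof (rule LIM_zero_cancel, rule Lim_null_comparison)
    show "\<forall>\<^sub>F s in at 0. norm (ip (R (1 / s) x) y / s - ip x y) \<le> M * cmod s"
      unfolding eventually_at using B est by (intro exI[of _ "1 / (2 * (B + 1))"]) auto
    show "((\<lambda>s. M * cmod s) \<longlongrightarrow> 0) (at 0)"
      by (auto intro!: tendsto_eq_intros)
  qed
qed

lemma resolvent_integral:
  assumes "x \<in> X" "y \<in> X" "r > 1"
  shows "((\<lambda>\<zeta>. ip (R \<zeta> x) y) has_contour_integral (2 * of_real pi * \<i> * ip x y)) (circlepath 0 r)"
proof (rule has_contour_integral_around_infinity)
  have "open {\<zeta>::complex. cmod \<zeta> > 1}"
    by (intro open_Collect_less continuous_intros)
  then show "(\<lambda>\<zeta>. ip (R \<zeta> x) y) holomorphic_on {\<zeta>. cmod \<zeta> > 1}"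
    using resolvent_has_derivative assms by (auto simp: holomorphic_on_open)
qed (use resolvent_at_infinity assms in auto)

text \<open>
  The calculus is determined by the identity
  \<open>\<phi>(\<zeta>) (\<zeta> - T)\<^sup>-\<^sup>1 = (\<zeta> - T)\<^sup>-\<^sup>1 \<phi>(T) + \<kappa>(\<zeta>) (1 - cnj a T)\<^sup>-\<^sup>1\<close> in which \<open>\<phi>(T)\<close> is given algebraically and the
  scalar function \<open>\<kappa>\<close> is holomorphic near the closed disc, so that its integral vanishes.  The vector
  \<open>u\<close> is \<open>(1 - cnj a T)\<^sup>-\<^sup>1 x\<close>.
\<close>

lemma hol_calculus_Moebius:
  assumes a: "cmod a < 1" and u: "u \<in> X" and x: "u - sc (cnj a) (T u) = x"
  shows "hol_calculus H (Moebius_function \<theta> a) T x = sc (exp (\<i> * of_real \<theta>)) (T u - sc a u)"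
proof -
  define \<epsilon> where "\<epsilon> = exp (\<i> * of_real \<theta>)"
  define v where "v = sc \<epsilon> (T u - sc a u)"
  define \<kappa> where "\<kappa> \<zeta> = \<epsilon> * (1 - cnj a * a) / (1 - cnj a * \<zeta>)" for \<zeta>
  have xX: "x \<in> X" and v: "v \<in> X" using u x by (auto simp: v_def)
  \<comment> \<open>A radius between \<open>1\<close> and the modulus \<open>1 / |a|\<close> of the pole, also for \<open>a = 0\<close>.\<close>
  define r0 where "r0 = 2 / (1 + cmod a)"
  have r0: "r0 > 1" using a by (simp add: r0_def divide_simps add_pos_nonneg)
  have a1: "1 - cnj a * \<zeta> \<noteq> 0" if "cmod \<zeta> < r0" for \<zeta>
  proof
    assume "1 - cnj a * \<zeta> = 0"
    then have "cnj a * \<zeta> = 1" by simp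
    then have "cmod a * cmod \<zeta> = 1" by (metis complex_mod_cnj norm_mult norm_one)
    moreover have "cmod a * cmod \<zeta> \<le> cmod a * r0" using that by (intro mult_left_mono) auto
    moreover have "cmod a * r0 < 1" using a by (simp add: r0_def divide_simps add_pos_nonneg)
    ultimately show False by simp
  qed
  have main: "((\<lambda>\<zeta>. Moebius_function \<theta> a \<zeta> * ip (R \<zeta> x) y)
      has_contour_integral (2 * of_real pi * \<i> * ip v y)) (circlepath 0 r)"
    if r: "1 < r" "r < r0" and y: "y \<in> X" for r y
  proof (rule has_contour_integral_eq)
    have "((\<lambda>\<zeta>. \<kappa> \<zeta> * ip u y) has_contour_integral 0) (circlepath 0 r)"
    proof (rule Cauchy_theorem_convex_simple[of _ "ball 0 r0"])
      show "(\<lambda>\<zeta>. \<kappa> \<zeta> * ip u y) holomorphic_on ball 0 r0"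
        unfolding \<kappa>_def by (intro holomorphic_intros) (use a1 in auto)
    qed (use r in auto)
    then show "((\<lambda>\<zeta>. ip (R \<zeta> v) y + \<kappa> \<zeta> * ip u y) has_contour_integral
        (2 * of_real pi * \<i> * ip v y)) (circlepath 0 r)"
      using has_contour_integral_add[OF resolvent_integral[OF v y r(1)]] by fastforce
  next
    fix \<zeta> assume "\<zeta> \<in> path_image (circlepath 0 r)"
    then have \<zeta>: "cmod \<zeta> = r" using r by auto
    then have z1: "cmod \<zeta> > 1" and nz: "1 - cnj a * \<zeta> \<noteq> 0" using r a1 by auto
    have "R \<zeta> (sc (Moebius_function \<theta> a \<zeta>) x - sc (\<kappa> \<zeta>) (sc \<zeta> u - T u)) = R \<zeta> v"
    proof -
      define \<delta> where "\<delta> = inverse (1 - cnj a * \<zeta>)"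
      have \<delta>: "\<delta> * (1 - cnj a * \<zeta>) = 1" using nz by (simp add: \<delta>_def)
      have M: "Moebius_function \<theta> a \<zeta> = \<epsilon> * (\<zeta> - a) * \<delta>" and \<kappa>: "\<kappa> \<zeta> = \<epsilon> * (1 - cnj a * a) * \<delta>"
        by (simp_all add: Moebius_function_def \<epsilon>_def \<delta>_def \<kappa>_def divide_inverse)
      have "sc (Moebius_function \<theta> a \<zeta>) x - sc (\<kappa> \<zeta>) (sc \<zeta> u - T u)
         = sc (\<epsilon> * (\<zeta> - a) * \<delta> - \<epsilon> * (1 - cnj a * a) * \<delta> * \<zeta>) u
           + sc (\<epsilon> * (1 - cnj a * a) * \<delta> - \<epsilon> * (\<zeta> - a) * \<delta> * cnj a) (T u)"
        by (simp add: M \<kappa> flip: x) (simp add: scale_right_diff_distrib scale_left_diff_distrib)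
      also have "\<epsilon> * (\<zeta> - a) * \<delta> - \<epsilon> * (1 - cnj a * a) * \<delta> * \<zeta> = - (\<epsilon> * a) * (\<delta> * (1 - cnj a * \<zeta>))"
        by (simp add: algebra_simps)
      also have "\<epsilon> * (1 - cnj a * a) * \<delta> - \<epsilon> * (\<zeta> - a) * \<delta> * cnj a = \<epsilon> * (\<delta> * (1 - cnj a * \<zeta>))"
        by (simp add: algebra_simps)
      finally show ?thesis by (simp add: \<delta> v_def scale_right_diff_distrib)
    qed
    moreover have "R \<zeta> (sc (Moebius_function \<theta> a \<zeta>) x - sc (\<kappa> \<zeta>) (sc \<zeta> u - T u))
       = sc (Moebius_function \<theta> a \<zeta>) (R \<zeta> x) - sc (\<kappa> \<zeta>) u"
    proof (rule R_unique[OF z1])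
      show "sc (Moebius_function \<theta> a \<zeta>) (R \<zeta> x) - sc (\<kappa> \<zeta>) u \<in> X"
        using z1 xX u by (simp add: R_mem)
      have "sc \<zeta> (sc (Moebius_function \<theta> a \<zeta>) (R \<zeta> x) - sc (\<kappa> \<zeta>) u) -
         T (sc (Moebius_function \<theta> a \<zeta>) (R \<zeta> x) - sc (\<kappa> \<zeta>) u)
        = sc (Moebius_function \<theta> a \<zeta>) (sc \<zeta> (R \<zeta> x) - T (R \<zeta> x)) - sc (\<kappa> \<zeta>) (sc \<zeta> u - T u)"
        using z1 xX u by (simp add: R_mem T_diff T_scale scale_right_diff_distrib mult.commute)
      then show "sc \<zeta> (sc (Moebius_function \<theta> a \<zeta>) (R \<zeta> x) - sc (\<kappa> \<zeta>) u) -
         T (sc (Moebius_function \<theta> a \<zeta>) (R \<zeta> x) - sc (\<kappa> \<zeta>) u)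
        = sc (Moebius_function \<theta> a \<zeta>) x - sc (\<kappa> \<zeta>) (sc \<zeta> u - T u)"
        using z1 xX by (simp add: R_right)
    qed
    ultimately have "R \<zeta> v = sc (Moebius_function \<theta> a \<zeta>) (R \<zeta> x) - sc (\<kappa> \<zeta>) u" by simp
    then show "ip (R \<zeta> v) y + \<kappa> \<zeta> * ip u y = Moebius_function \<theta> a \<zeta> * ip (R \<zeta> x) y"
      using z1 xX u y by (simp add: R_mem ip_diff_left ip_scale_left)
  qed
  have ev: "\<forall>\<^sub>F r in at_right 1. r \<in> {1<..<r0}" by (rule eventually_at_right_real[OF r0])
  have "hol_calculus H (Moebius_function \<theta> a) T x = v"
    unfolding hol_calculus_def
  proof (rule the_equality)
    have "\<forall>\<^sub>F r in at_right 1. ((\<lambda>\<zeta>. Moebius_function \<theta> a \<zeta> * ip (R \<zeta> x) y)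
      has_contour_integral (2 * of_real pi * \<i> * ip v y)) (circlepath 0 r)" if "y \<in> X" for y
      using ev by eventually_elim (use main that in auto)
    then show "v \<in> X \<and> (\<forall>y\<in>X. \<forall>\<^sub>F r in at_right 1. ((\<lambda>\<zeta>. Moebius_function \<theta> a \<zeta> * ip (R \<zeta> x) y)
      has_contour_integral (2 * of_real pi * \<i> * ip v y)) (circlepath 0 r))"
      using v by blast
  next
    fix w assume w: "w \<in> X \<and> (\<forall>y\<in>X. \<forall>\<^sub>F r in at_right 1. ((\<lambda>\<zeta>. Moebius_function \<theta> a \<zeta> * ip (R \<zeta> x) y)
      has_contour_integral (2 * of_real pi * \<i> * ip w y)) (circlepath 0 r))"
    show "w = v"
    proof (rule ip_ext)
      fix y assume y: "y \<in> X"
      have "\<forall>\<^sub>F r in at_right 1. ((\<lambda>\<zeta>. Moebius_function \<theta> a \<zeta> * ip (R \<zeta> x) y)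
        has_contour_integral (2 * of_real pi * \<i> * ip w y)) (circlepath 0 r)" using w y by blast
      with ev have "\<forall>\<^sub>F r::real in at_right 1. ip w y = ip v y"
        by eventually_elim (use main[OF _ _ y] has_contour_integral_unique in fastforce)
      then have "ip w y = ip v y" by simp
      then show "ip y w = ip y v" using w v y ip_cnj[of w y] ip_cnj[of v y] by simp
    qed (use w v in auto)
  qed
  then show ?thesis by (simp add: v_def \<epsilon>_def)
qed

end

section \<open>Reproducing kernel Hilbert spaces on the disc\<close>

text \<open>
  Positivity without holomorphy: it is applied to differences of kernels whose weights are only known
  pointwise.
\<close>

definition psd :: "(complex \<Rightarrow> complex \<Rightarrow> complex) \<Rightarrow> bool" where
  "psd k \<longleftrightarrow> (\<forall>W c. finite W \<and> W \<subseteq> ball 0 1 \<longrightarrow>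
     (\<Sum>v\<in>W. \<Sum>w\<in>W. cnj (c v) * k v w * c w) \<in> \<real>\<^sub>\<ge>\<^sub>0)"

lemma psd_cong:
  assumes "\<And>z w. z \<in> ball 0 1 \<Longrightarrow> w \<in> ball 0 1 \<Longrightarrow> k z w = k' z w"
  shows "psd k \<longleftrightarrow> psd k'"
proof -
  have "(\<Sum>v\<in>W. \<Sum>w\<in>W. cnj (c v) * k v w * c w) = (\<Sum>v\<in>W. \<Sum>w\<in>W. cnj (c v) * k' v w * c w)"
    if "W \<subseteq> ball 0 1" for W c
    using assms that by (intro sum.cong refl) (simp add: subset_iff)
  then show ?thesis by (simp add: psd_def cong: conj_cong)
qed

lemma psdD:
  "psd k \<Longrightarrow> finite W \<Longrightarrow> W \<subseteq> ball 0 1 \<Longrightarrow>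
    (\<Sum>v\<in>W. \<Sum>w\<in>W. cnj (c v) * k v w * c w) \<in> \<real>\<^sub>\<ge>\<^sub>0"
  by (simp add: psd_def)

text \<open>
  The only case of the Schur product theorem that is needed: one of the factors is a power series
  \<open>\<Sum>n. d n (s(z) cnj (s(w)))\<^sup>n\<close> with non-negative coefficients, hence a sum of kernels of rank one.
\<close>

lemma psd_mult_power_series:
  assumes k: "psd k" and d: "\<And>n. d n \<ge> 0"
    and P: "\<And>z w. z \<in> ball 0 1 \<Longrightarrow> w \<in> ball 0 1 \<Longrightarrow>
      (\<lambda>n. of_real (d n) * (s z * cnj (s w)) ^ n) sums P z w"
  shows "psd (\<lambda>z w. k z w * P z w)"
  unfolding psd_def
proof (intro allI impI)
  fix W :: "complex set" and c assume W: "finite W \<and> W \<subseteq> ball 0 1"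
  define S where "S n = (\<Sum>v\<in>W. \<Sum>w\<in>W. cnj (c v) * (k v w * (of_real (d n) * (s v * cnj (s w)) ^ n)) * c w)" for n
  have S_nonneg: "S n \<in> \<real>\<^sub>\<ge>\<^sub>0" for n
  proof -
    have "S n = of_real (d n) *
        (\<Sum>v\<in>W. \<Sum>w\<in>W. cnj (c v * cnj (s v) ^ n) * k v w * (c w * cnj (s w) ^ n))"
      by (simp add: S_def sum_distrib_left power_mult_distrib ac_simps)
    moreover have "(\<Sum>v\<in>W. \<Sum>w\<in>W. cnj (c v * cnj (s v) ^ n) * k v w * (c w * cnj (s w) ^ n)) \<in> \<real>\<^sub>\<ge>\<^sub>0"
      by (rule psdD) (use k W in auto)
    ultimately show ?thesis using d by (simp only:) (rule nonneg_Reals_mult_I, simp)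
  qed
  have "S sums (\<Sum>v\<in>W. \<Sum>w\<in>W. cnj (c v) * (k v w * P v w) * c w)"
    unfolding S_def
    by (intro sums_sum sums_mult sums_mult2 P) (use W in auto)
  then have "(\<lambda>n. sum S {..<n}) \<longlonglongrightarrow> (\<Sum>v\<in>W. \<Sum>w\<in>W. cnj (c v) * (k v w * P v w) * c w)"
    by (simp add: sums_def)
  moreover have "sum S {..<n} \<in> \<real>\<^sub>\<ge>\<^sub>0" for n
    by (induction n) (auto intro: nonneg_Reals_add_I S_nonneg)
  ultimately show "(\<Sum>v\<in>W. \<Sum>w\<in>W. cnj (c v) * (k v w * P v w) * c w) \<in> \<real>\<^sub>\<ge>\<^sub>0"
    by (rule closed_sequentially[OF closed_nonneg_Reals_complex, rotated])
qed

lemma psd_weight: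
  assumes "psd k"
  shows "psd (\<lambda>z w. g z * k z w * cnj (g w))"
  unfolding psd_def
proof (intro allI impI)
  fix W :: "complex set" and c assume W: "finite W \<and> W \<subseteq> ball 0 1"
  have "(\<Sum>v\<in>W. \<Sum>w\<in>W. cnj (c v * cnj (g v)) * k v w * (c w * cnj (g w))) \<in> \<real>\<^sub>\<ge>\<^sub>0"
    by (rule psdD) (use assms W in auto)
  then show "(\<Sum>v\<in>W. \<Sum>w\<in>W. cnj (c v) * (g v * k v w * cnj (g w)) * c w) \<in> \<real>\<^sub>\<ge>\<^sub>0"
    by (simp add: mult_ac)
qed

definition wcomp :: "(complex \<Rightarrow> complex) \<Rightarrow> (complex \<Rightarrow> complex) \<Rightarrow> (complex \<Rightarrow> complex) \<Rightarrow> complex \<Rightarrow> complex" where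
  "wcomp g \<psi> f = disc_restrict (\<lambda>z. g z * f (\<psi> z))"

locale rkhs = hilbert H for H :: "(complex \<Rightarrow> complex) hilb" +
  fixes K :: "complex \<Rightarrow> complex \<Rightarrow> complex"
  assumes rkhs: "is_rkhs K H"
begin

definition kernel_at :: "complex \<Rightarrow> complex \<Rightarrow> complex" where
  "kernel_at w = disc_restrict (\<lambda>z. K z w)"

lemma sc_apply: "sc c f z = c * f z"
  using rkhs by (simp add: is_rkhs_def)

lemma off_disc: "f \<in> X \<Longrightarrow> z \<notin> ball 0 1 \<Longrightarrow> f z = 0"
  using rkhs by (auto simp: is_rkhs_def)

lemma kernel_at_mem [simp]: "w \<in> ball 0 1 \<Longrightarrow> kernel_at w \<in> X"
  using rkhs unfolding is_rkhs_def kernel_at_def by blast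

lemma reproducing: "f \<in> X \<Longrightarrow> w \<in> ball 0 1 \<Longrightarrow> ip f (kernel_at w) = f w"
  using rkhs unfolding is_rkhs_def kernel_at_def by blast

lemma reproducing': "f \<in> X \<Longrightarrow> w \<in> ball 0 1 \<Longrightarrow> ip (kernel_at w) f = cnj (f w)"
  using reproducing[of f w] ip_cnj[of f "kernel_at w"] by simp

lemma kernel_at_apply: "z \<in> ball 0 1 \<Longrightarrow> kernel_at w z = K z w"
  by (simp add: kernel_at_def disc_restrict_def)

lemma ip_kernel_at: "v \<in> ball 0 1 \<Longrightarrow> w \<in> ball 0 1 \<Longrightarrow> ip (kernel_at w) (kernel_at v) = K v w"
  by (simp add: reproducing kernel_at_apply)

lemma K_cnj: "v \<in> ball 0 1 \<Longrightarrow> w \<in> ball 0 1 \<Longrightarrow> K w v = cnj (K v w)"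
  using ip_cnj[of "kernel_at w" "kernel_at v"] by (simp add: ip_kernel_at)

lemma fun_ext_disc: "f \<in> X \<Longrightarrow> g \<in> X \<Longrightarrow> (\<And>z. z \<in> ball 0 1 \<Longrightarrow> f z = g z) \<Longrightarrow> f = g"
  using off_disc by (metis ext)

lemma kernel_quadratic_form:
  assumes "W \<subseteq> ball 0 1" "\<And>w. w \<in> W \<Longrightarrow> \<psi> w \<in> ball 0 1"
  shows "(\<Sum>v\<in>W. \<Sum>w\<in>W. cnj (c v) * K (\<psi> v) (\<psi> w) * c w)
           = of_real ((nrm (\<Sum>w\<in>W. sc (c w) (kernel_at (\<psi> w))))\<^sup>2)"
  using nrm_sum_square[of W "\<lambda>w. kernel_at (\<psi> w)" c] assms
  by (simp add: ip_kernel_at subset_iff cong: sum.cong)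

lemma kernel_quadratic_form_id:
  assumes "W \<subseteq> ball 0 1"
  shows "(\<Sum>v\<in>W. \<Sum>w\<in>W. cnj (c v) * K v w * c w) = of_real ((nrm (\<Sum>w\<in>W. sc (c w) (kernel_at w)))\<^sup>2)"
  by (rule kernel_quadratic_form) (use assms in auto)

lemma psd_kernel: "psd K"
  unfolding psd_def by (auto simp only: kernel_quadratic_form_id nonneg_Reals_of_real_iff zero_le_power2)

text \<open>
  A function belongs to the space as soon as evaluating it is a bounded functional of the
  combinations of kernel functions.  All memberships below are shown in this way.
\<close>

lemma rkhs_memI:
  assumes "\<And>z. z \<notin> ball 0 1 \<Longrightarrow> F z = 0" and "C \<ge> 0"
    and "\<And>W c. finite W \<Longrightarrow> W \<subseteq> ball 0 1 \<Longrightarrow>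
      cmod (\<Sum>w\<in>W. c w * cnj (F w)) \<le> C * nrm (\<Sum>w\<in>W. sc (c w) (kernel_at w))"
  shows "F \<in> X \<and> nrm F \<le> C"
proof -
  obtain v where v: "v \<in> X" "nrm v \<le> C" "\<And>w. w \<in> ball 0 1 \<Longrightarrow> ip (kernel_at w) v = cnj (F w)"
    using moment_problem[of "ball 0 1" kernel_at C "\<lambda>w. cnj (F w)"] assms by auto
  have "v z = F z" for z
    using v(3)[of z] reproducing'[OF v(1), of z] off_disc[OF v(1), of z] assms(1)[of z]
    by (cases "z \<in> ball 0 1") auto
  then have "v = F" by auto
  then show ?thesis using v by simp
qed

text \<open>
  The adjoint of a weighted composition operator permutes the kernel functions up to scalars, so
  its boundedness is an inequality between kernels.
\<close>

lemma wcomp_bounded: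
  assumes C: "C \<ge> 0" and \<psi>: "\<And>z. z \<in> ball 0 1 \<Longrightarrow> \<psi> z \<in> ball 0 1"
    and psd: "psd (\<lambda>z w. of_real (C\<^sup>2) * K z w - g z * K (\<psi> z) (\<psi> w) * cnj (g w))"
  shows "f \<in> X \<Longrightarrow> wcomp g \<psi> f \<in> X" "f \<in> X \<Longrightarrow> nrm (wcomp g \<psi> f) \<le> C * nrm f"
    and "bounded_map H H (wcomp g \<psi>)"
proof -
  have *: "wcomp g \<psi> f \<in> X \<and> nrm (wcomp g \<psi> f) \<le> C * nrm f" if f: "f \<in> X" for f
  proof (rule rkhs_memI)
    show "wcomp g \<psi> f z = 0" if "z \<notin> ball 0 1" for z
      using that by (simp add: wcomp_def disc_restrict_def)
    show "0 \<le> C * nrm f" using C f by simp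
    fix W :: "complex set" and c assume W: "finite W" "W \<subseteq> ball 0 1"
    define y where "y = (\<Sum>w\<in>W. sc (c w) (kernel_at w))"
    define x where "x = (\<Sum>w\<in>W. sc (c w * cnj (g w)) (kernel_at (\<psi> w)))"
    have x: "x \<in> X" and y: "y \<in> X"
      unfolding x_def y_def using W \<psi> by (intro carrier_sum carrier_closed kernel_at_mem; auto)+
    have "(\<Sum>v\<in>W. \<Sum>w\<in>W. cnj (c v) * (of_real (C\<^sup>2) * K v w - g v * K (\<psi> v) (\<psi> w) * cnj (g w)) * c w)
        = of_real (C\<^sup>2) * (\<Sum>v\<in>W. \<Sum>w\<in>W. cnj (c v) * K v w * c w)
          - (\<Sum>v\<in>W. \<Sum>w\<in>W. cnj (c v * cnj (g v)) * K (\<psi> v) (\<psi> w) * (c w * cnj (g w)))"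
      by (simp add: sum_distrib_left sum_subtractf algebra_simps)
    also have "\<dots> = of_real (C\<^sup>2 * (nrm y)\<^sup>2 - (nrm x)\<^sup>2)"
    proof -
      have "(\<Sum>v\<in>W. \<Sum>w\<in>W. cnj (c v) * K v w * c w) = of_real ((nrm y)\<^sup>2)"
        using kernel_quadratic_form_id[of W c] W by (simp add: y_def)
      moreover have "(\<Sum>v\<in>W. \<Sum>w\<in>W. cnj (c v * cnj (g v)) * K (\<psi> v) (\<psi> w) * (c w * cnj (g w)))
          = of_real ((nrm x)\<^sup>2)"
        unfolding x_def by (rule kernel_quadratic_form) (use W \<psi> in auto)
      ultimately show ?thesis by simp
    qed
    finally have "of_real (C\<^sup>2 * (nrm y)\<^sup>2 - (nrm x)\<^sup>2) \<in> (\<real>\<^sub>\<ge>\<^sub>0 :: complex set)"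
      using psd[unfolded psd_def, rule_format, of W c] W by simp
    then have "(nrm x)\<^sup>2 \<le> (C * nrm y)\<^sup>2"
      by (simp only: nonneg_Reals_of_real_iff power_mult_distrib diff_ge_0_iff_ge)
    then have xy: "nrm x \<le> C * nrm y" by (rule power2_le_imp_le) (use C y in simp)
    have "(\<Sum>w\<in>W. c w * cnj (wcomp g \<psi> f w)) = ip x f"
      unfolding x_def using W \<psi> f
      by (subst ip_sum_left)
         (auto simp: ip_scale_left reproducing' wcomp_def disc_restrict_def subset_iff intro!: sum.cong)
    then have "cmod (\<Sum>w\<in>W. c w * cnj (wcomp g \<psi> f w)) \<le> nrm x * nrm f"
      using Cauchy_Schwarz[OF x f] by simp
    also have "\<dots> \<le> C * nrm y * nrm f" using xy f by (intro mult_right_mono) auto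
    finally show "cmod (\<Sum>w\<in>W. c w * cnj (wcomp g \<psi> f w)) \<le> C * nrm f * nrm (\<Sum>w\<in>W. sc (c w) (kernel_at w))"
      by (simp add: y_def ac_simps)
  qed
  then show "f \<in> X \<Longrightarrow> wcomp g \<psi> f \<in> X" "f \<in> X \<Longrightarrow> nrm (wcomp g \<psi> f) \<le> C * nrm f" by auto
  show "bounded_map H H (wcomp g \<psi>)"
    unfolding bounded_map_def using *
    by (auto simp: wcomp_def disc_restrict_def sc_apply fun_eq_iff algebra_simps)
qed

text \<open>The converse of \<open>wcomp_bounded\<close>, for the adjoint of a weighted composition operator.\<close>

lemma kernel_inequality:
  assumes L: "bounded_map H H L" and \<psi>: "\<And>w. w \<in> ball 0 1 \<Longrightarrow> \<psi> w \<in> ball 0 1"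
    and Lk: "\<And>w. w \<in> ball 0 1 \<Longrightarrow> L (kernel_at w) = sc (\<gamma> w) (kernel_at (\<psi> w))"
  obtains C where "C \<ge> 0"
    "psd (\<lambda>z w. of_real (C\<^sup>2) * K z w - cnj (\<gamma> z) * K (\<psi> z) (\<psi> w) * \<gamma> w)"
proof -
  obtain C where C: "C \<ge> 0" "\<And>x. x \<in> X \<Longrightarrow> nrm (L x) \<le> C * nrm x"
    using bounded_map_bound[OF L] by blast
  have "psd (\<lambda>z w. of_real (C\<^sup>2) * K z w - cnj (\<gamma> z) * K (\<psi> z) (\<psi> w) * \<gamma> w)"
    unfolding psd_def
  proof (intro allI impI, elim conjE)
    fix W :: "complex set" and c assume W: "finite W" "W \<subseteq> ball 0 1"
    define y where "y = (\<Sum>w\<in>W. sc (c w) (kernel_at w))"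
    define x where "x = (\<Sum>w\<in>W. sc (c w * \<gamma> w) (kernel_at (\<psi> w)))"
    have x: "x \<in> X" and y: "y \<in> X"
      unfolding x_def y_def using W \<psi> by (intro carrier_sum carrier_closed kernel_at_mem; auto)+
    have "L y = (\<Sum>w\<in>W. L (sc (c w) (kernel_at w)))"
      unfolding y_def using W by (intro bounded_map_sum[OF L] carrier_closed kernel_at_mem) auto
    also have "\<dots> = x"
      unfolding x_def using W Lk by (intro sum.cong) (auto simp: bounded_mapD(3)[OF L] subset_iff)
    finally have "nrm x \<le> C * nrm y" using C(2)[OF y] by simp
    then have le: "(nrm x)\<^sup>2 \<le> C\<^sup>2 * (nrm y)\<^sup>2"
      using power_mono[of "nrm x" "C * nrm y" 2] x by (simp add: power_mult_distrib)
    have "(\<Sum>v\<in>W. \<Sum>w\<in>W. cnj (c v) * (of_real (C\<^sup>2) * K v w - cnj (\<gamma> v) * K (\<psi> v) (\<psi> w) * \<gamma> w) * c w)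
        = of_real (C\<^sup>2) * (\<Sum>v\<in>W. \<Sum>w\<in>W. cnj (c v) * K v w * c w)
          - (\<Sum>v\<in>W. \<Sum>w\<in>W. cnj (c v * \<gamma> v) * K (\<psi> v) (\<psi> w) * (c w * \<gamma> w))"
      by (simp add: sum_distrib_left sum_subtractf algebra_simps)
    also have "\<dots> = of_real (C\<^sup>2 * (nrm y)\<^sup>2 - (nrm x)\<^sup>2)"
    proof -
      have "(\<Sum>v\<in>W. \<Sum>w\<in>W. cnj (c v) * K v w * c w) = of_real ((nrm y)\<^sup>2)"
        using kernel_quadratic_form_id[of W c] W by (simp add: y_def)
      moreover have "(\<Sum>v\<in>W. \<Sum>w\<in>W. cnj (c v * \<gamma> v) * K (\<psi> v) (\<psi> w) * (c w * \<gamma> w))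
          = of_real ((nrm x)\<^sup>2)"
        unfolding x_def by (rule kernel_quadratic_form) (use W \<psi> in auto)
      ultimately show ?thesis by simp
    qed
    finally show "(\<Sum>v\<in>W. \<Sum>w\<in>W. cnj (c v) * (of_real (C\<^sup>2) * K v w - cnj (\<gamma> v) * K (\<psi> v) (\<psi> w) * \<gamma> w) * c w) \<in> \<real>\<^sub>\<ge>\<^sub>0"
      using le by (simp only: nonneg_Reals_of_real_iff diff_ge_0_iff_ge)
  qed
  with C that show thesis by blast
qed

end

locale radial_rkhs = rkhs +
  fixes b :: "nat \<Rightarrow> real"
  assumes b_pos: "\<And>n. b n > 0"
    and K_sums: "\<And>z w. z \<in> ball 0 1 \<Longrightarrow> w \<in> ball 0 1 \<Longrightarrow>
      (\<lambda>n. of_real (b n) * (z * cnj w) ^ n) sums K z w"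
begin

definition monomial :: "nat \<Rightarrow> complex \<Rightarrow> complex" where
  "monomial n = disc_restrict (\<lambda>z. z ^ n)"

text \<open>The power series of the kernel writes its quadratic form as a sum of squares.\<close>

lemma norm_kernel_combination_sums:
  assumes W: "finite W" "W \<subseteq> ball 0 1"
  shows "(\<lambda>n. b n * (cmod (\<Sum>w\<in>W. c w * cnj w ^ n))\<^sup>2) sums (nrm (\<Sum>w\<in>W. sc (c w) (kernel_at w)))\<^sup>2"
proof -
  have "(\<lambda>n. \<Sum>v\<in>W. \<Sum>w\<in>W. cnj (c v) * (of_real (b n) * (v * cnj w) ^ n) * c w)
      sums (\<Sum>v\<in>W. \<Sum>w\<in>W. cnj (c v) * K v w * c w)"
    by (intro sums_sum sums_mult sums_mult2 K_sums) (use W in auto)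
  also have "(\<Sum>v\<in>W. \<Sum>w\<in>W. cnj (c v) * K v w * c w) = of_real ((nrm (\<Sum>w\<in>W. sc (c w) (kernel_at w)))\<^sup>2)"
    using W by (intro kernel_quadratic_form_id) auto
  also have "(\<lambda>n. \<Sum>v\<in>W. \<Sum>w\<in>W. cnj (c v) * (of_real (b n) * (v * cnj w) ^ n) * c w)
      = (\<lambda>n. of_real (b n * (cmod (\<Sum>w\<in>W. c w * cnj w ^ n))\<^sup>2))"
  proof
    fix n
    have "complex_of_real ((cmod (\<Sum>w\<in>W. c w * cnj w ^ n))\<^sup>2)
        = (\<Sum>v\<in>W. cnj (c v) * v ^ n) * (\<Sum>w\<in>W. c w * cnj w ^ n)"
      by (subst complex_norm_square) (simp add: mult.commute)
    also have "\<dots> = (\<Sum>v\<in>W. \<Sum>w\<in>W. (cnj (c v) * v ^ n) * (c w * cnj w ^ n))"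
      by (rule sum_product)
    finally show "(\<Sum>v\<in>W. \<Sum>w\<in>W. cnj (c v) * (of_real (b n) * (v * cnj w) ^ n) * c w)
        = of_real (b n * (cmod (\<Sum>w\<in>W. c w * cnj w ^ n))\<^sup>2)"
      by (simp add: sum_distrib_left power_mult_distrib mult_ac)
  qed
  finally show ?thesis by (simp only: sums_of_real_iff)
qed

definition kernel_partial_sum :: "complex \<Rightarrow> nat \<Rightarrow> complex \<Rightarrow> complex" where
  "kernel_partial_sum w N = disc_restrict (\<lambda>z. \<Sum>n<N. of_real (b n) * (z * cnj w) ^ n)"

lemma monomial_mem [simp]: "monomial n \<in> X"
proof -
  have "monomial n \<in> X \<and> nrm (monomial n) \<le> 1 / sqrt (b n)"
  proof (rule rkhs_memI)
    show "monomial n z = 0" if "z \<notin> ball 0 1" for z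
      using that by (simp add: monomial_def disc_restrict_def)
    show "0 \<le> 1 / sqrt (b n)" using b_pos[of n] by simp
    fix W :: "complex set" and c assume W: "finite W" "W \<subseteq> ball 0 1"
    note s = norm_kernel_combination_sums[OF W, of c]
    define A where "A = (\<Sum>w\<in>W. c w * cnj w ^ n)"
    have y: "(\<Sum>w\<in>W. sc (c w) (kernel_at w)) \<in> X" using W by (intro carrier_sum carrier_closed kernel_at_mem) auto
    have "b n * (cmod A)\<^sup>2 \<le> (nrm (\<Sum>w\<in>W. sc (c w) (kernel_at w)))\<^sup>2"
      using sum_le_suminf[OF sums_summable[OF s], of "{n}"] b_pos
      by (auto simp: A_def sums_unique[OF s, symmetric] less_imp_le)
    then have "(cmod A)\<^sup>2 \<le> (1 / sqrt (b n) * nrm (\<Sum>w\<in>W. sc (c w) (kernel_at w)))\<^sup>2"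
      using b_pos[of n] by (simp add: power_mult_distrib power_divide field_simps)
    then have "cmod A \<le> 1 / sqrt (b n) * nrm (\<Sum>w\<in>W. sc (c w) (kernel_at w))"
      by (rule power2_le_imp_le) (use b_pos[of n] y in simp)
    also have "A = (\<Sum>w\<in>W. c w * cnj (monomial n w))"
      unfolding A_def by (intro sum.cong) (use W in \<open>auto simp: monomial_def disc_restrict_def\<close>)
    finally show "cmod (\<Sum>w\<in>W. c w * cnj (monomial n w)) \<le> 1 / sqrt (b n) * nrm (\<Sum>w\<in>W. sc (c w) (kernel_at w))" .
  qed
  then show ?thesis ..
qed

lemma kernel_partial_sum_eq: "kernel_partial_sum w N = (\<Sum>n<N. sc (of_real (b n) * cnj w ^ n) (monomial n))"
proof
  fix z
  have "(\<Sum>n<N. sc (of_real (b n) * cnj w ^ n) (monomial n)) z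
      = (\<Sum>n<N. (sc (of_real (b n) * cnj w ^ n) (monomial n)) z)"
    by (induction N) auto
  then show "kernel_partial_sum w N z = (\<Sum>n<N. sc (of_real (b n) * cnj w ^ n) (monomial n)) z"
    by (simp add: kernel_partial_sum_def monomial_def disc_restrict_def sc_apply power_mult_distrib mult_ac)
qed

text \<open>
  The monomials span a dense subspace, as the kernel functions are limits of their Taylor polynomials.
  A Taylor polynomial is the kernel function at \<open>w\<close> for the truncated kernel, which lies below \<open>K\<close>; so its squared norm is
  at most the truncated kernel at \<open>(w, w)\<close>, and this equals its inner product with the kernel function.
\<close>

lemma kernel_partial_sum_tendsto:
  assumes w: "w \<in> ball 0 1"
  shows "(\<lambda>N. nrm (kernel_partial_sum w N - kernel_at w)) \<longlonglongrightarrow> 0"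
proof -
  define q where "q N = (\<Sum>n<N. b n * (cmod w ^ n)\<^sup>2)" for N
  have q0: "q N \<ge> 0" for N using b_pos by (auto simp: q_def less_imp_le intro!: sum_nonneg)
  have mem: "kernel_partial_sum w N \<in> X" for N
    unfolding kernel_partial_sum_eq by (intro carrier_sum carrier_closed monomial_mem)
  have bd: "nrm (kernel_partial_sum w N) \<le> sqrt (q N)" for N
  proof -
    have "kernel_partial_sum w N \<in> X \<and> nrm (kernel_partial_sum w N) \<le> sqrt (q N)"
    proof (rule rkhs_memI)
      show "kernel_partial_sum w N z = 0" if "z \<notin> ball 0 1" for z
        using that by (simp add: kernel_partial_sum_def disc_restrict_def)
      show "0 \<le> sqrt (q N)" using q0 by simp
      fix W :: "complex set" and c assume W: "finite W" "W \<subseteq> ball 0 1"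
      note s = norm_kernel_combination_sums[OF W, of c]
      define A where "A n = (\<Sum>v\<in>W. c v * cnj v ^ n)" for n
      define y where "y = (\<Sum>w\<in>W. sc (c w) (kernel_at w))"
      have y: "y \<in> X" unfolding y_def using W by (intro carrier_sum carrier_closed kernel_at_mem) auto
      have "(\<Sum>v\<in>W. c v * cnj (kernel_partial_sum w N v))
          = (\<Sum>v\<in>W. \<Sum>n<N. of_real (b n) * w ^ n * (c v * cnj v ^ n))"
        by (intro sum.cong refl)
           (use W in \<open>auto simp: kernel_partial_sum_def disc_restrict_def subset_iff power_mult_distrib sum_distrib_left mult_ac\<close>)
      also have "\<dots> = (\<Sum>n<N. of_real (b n) * w ^ n * A n)"
        by (subst sum.swap) (simp add: A_def sum_distrib_left)
      also have "cmod \<dots> \<le> (\<Sum>n<N. (sqrt (b n) * cmod w ^ n) * (sqrt (b n) * cmod (A n)))"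
      proof (rule order_trans[OF norm_sum], rule sum_mono)
        fix n
        have "(sqrt (b n) * cmod w ^ n) * (sqrt (b n) * cmod (A n))
            = (sqrt (b n) * sqrt (b n)) * (cmod w ^ n * cmod (A n))" by (simp only: mult_ac)
        also have "sqrt (b n) * sqrt (b n) = b n" using b_pos[of n] by simp
        finally have e: "(sqrt (b n) * cmod w ^ n) * (sqrt (b n) * cmod (A n)) = b n * (cmod w ^ n * cmod (A n))" .
        show "cmod (of_real (b n) * w ^ n * A n) \<le> (sqrt (b n) * cmod w ^ n) * (sqrt (b n) * cmod (A n))"
          unfolding e using b_pos[of n] by (simp add: norm_mult norm_power mult.assoc)
      qed
      also have "\<dots> \<le> sqrt (q N) * sqrt (\<Sum>n<N. b n * (cmod (A n))\<^sup>2)"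
      proof -
        have "(\<Sum>n<N. (sqrt (b n) * cmod w ^ n) * (sqrt (b n) * cmod (A n)))\<^sup>2
            \<le> (\<Sum>n<N. (sqrt (b n) * cmod w ^ n)\<^sup>2) * (\<Sum>n<N. (sqrt (b n) * cmod (A n))\<^sup>2)"
          by (rule Cauchy_Schwarz_ineq_sum)
        also have "\<dots> = q N * (\<Sum>n<N. b n * (cmod (A n))\<^sup>2)"
          using b_pos by (simp add: q_def power_mult_distrib less_imp_le)
        finally show ?thesis by (simp add: real_le_rsqrt flip: real_sqrt_mult)
      qed
      also have "\<dots> \<le> sqrt (q N) * sqrt ((nrm y)\<^sup>2)"
      proof -
        have "(\<Sum>n<N. b n * (cmod (A n))\<^sup>2) \<le> (nrm y)\<^sup>2"
          using sum_le_suminf[OF sums_summable[OF s], of "{..<N}"] b_pos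
          by (auto simp: A_def y_def sums_unique[OF s, symmetric] less_imp_le)
        then show ?thesis using q0 by (intro mult_left_mono real_sqrt_le_mono) auto
      qed
      also have "sqrt ((nrm y)\<^sup>2) = nrm y" using y by simp
      finally show "cmod (\<Sum>v\<in>W. c v * cnj (kernel_partial_sum w N v)) \<le> sqrt (q N) * nrm (\<Sum>w\<in>W. sc (c w) (kernel_at w))"
        by (simp add: y_def)
    qed
    then show ?thesis ..
  qed
  have at_w: "kernel_partial_sum w N w = of_real (q N)" for N
  proof -
    have "w * cnj w = of_real ((cmod w)\<^sup>2)" by (simp only: complex_norm_square)
    then have e: "of_real (b n) * (w * cnj w) ^ n = of_real (b n * (cmod w ^ n)\<^sup>2)" for n
      by (simp add: power_mult[symmetric] mult.commute)
    show ?thesis using w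
      by (simp add: kernel_partial_sum_def disc_restrict_def q_def e del: of_real_mult of_real_power)
  qed
  have "(\<lambda>N. (nrm (kernel_partial_sum w N - kernel_at w))\<^sup>2) \<longlonglongrightarrow> 0"
  proof (rule tendsto_sandwich)
    show "\<forall>\<^sub>F N in sequentially. 0 \<le> (nrm (kernel_partial_sum w N - kernel_at w))\<^sup>2" by simp
    have "(nrm (kernel_partial_sum w N - kernel_at w))\<^sup>2 \<le> Re (K w w) - q N" for N
    proof -
      have "(nrm (kernel_partial_sum w N))\<^sup>2 \<le> q N"
        using power_mono[OF bd[of N], of 2] mem q0 by simp
      moreover have "Re (ip (kernel_partial_sum w N) (kernel_at w)) = q N"
        using w mem by (simp add: reproducing at_w)
      moreover have "(nrm (kernel_at w))\<^sup>2 = Re (K w w)"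
        using w by (simp add: nrm_square ip_kernel_at)
      ultimately show ?thesis using w mem by (simp add: nrm_diff_square)
    qed
    then show "\<forall>\<^sub>F N in sequentially. (nrm (kernel_partial_sum w N - kernel_at w))\<^sup>2 \<le> Re (K w w) - q N" by simp
    have "(\<lambda>N. \<Sum>n<N. of_real (b n) * (w * cnj w) ^ n) \<longlonglongrightarrow> K w w"
      using K_sums[OF w w] by (simp add: sums_def)
    then have "(\<lambda>N. kernel_partial_sum w N w) \<longlonglongrightarrow> K w w"
      using w by (simp add: kernel_partial_sum_def disc_restrict_def)
    then have "q \<longlonglongrightarrow> Re (K w w)" using tendsto_Re by (fastforce simp: at_w)
    then show "(\<lambda>N. Re (K w w) - q N) \<longlonglongrightarrow> 0" by (auto intro!: tendsto_eq_intros)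
  qed auto
  then have "(\<lambda>N. sqrt ((nrm (kernel_partial_sum w N - kernel_at w))\<^sup>2)) \<longlonglongrightarrow> sqrt 0"
    by (rule tendsto_real_sqrt)
  then show ?thesis using mem w by simp
qed

text \<open>
  The eigenvectors of the adjoint of multiplication by the coordinate are the kernel functions:
  the eigenvalue equation determines the inner products with the monomials, and these span a
  dense subspace.
\<close>

lemma adjoint_eigenvector:
  assumes M: "bounded_map H H mult_z" and u: "u \<in> X" and \<mu>: "\<mu> \<in> ball 0 1"
    and eig: "\<And>f. f \<in> X \<Longrightarrow> ip (mult_z f) u = \<mu> * ip f u"
  shows "u = sc (cnj (ip (monomial 0) u)) (kernel_at \<mu>)"
proof (rule fun_ext_disc)
  fix w assume w: "w \<in> ball (0::complex) 1"
  have mono: "ip (monomial n) u = \<mu> ^ n * ip (monomial 0) u" for n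
  proof (induction n)
    case (Suc n)
    have "monomial (Suc n) = mult_z (monomial n)"
      by (auto simp: monomial_def mult_z_def disc_restrict_def)
    then show ?case using eig[of "monomial n"] Suc by simp
  qed simp
  have mem: "kernel_partial_sum w N \<in> X" for N
    unfolding kernel_partial_sum_eq by (intro carrier_sum carrier_closed monomial_mem)
  have "(\<lambda>N. ip (kernel_partial_sum w N) u) \<longlonglongrightarrow> ip (kernel_at w) u"
    by (rule tendsto_ip[OF mem _ u kernel_partial_sum_tendsto[OF w]]) (use w in simp)
  moreover have "ip (kernel_partial_sum w N) u = (\<Sum>n<N. of_real (b n) * (\<mu> * cnj w) ^ n) * ip (monomial 0) u" for N
  proof -
    have "ip (kernel_partial_sum w N) u = (\<Sum>n<N. of_real (b n) * cnj w ^ n * ip (monomial n) u)"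
      using u unfolding kernel_partial_sum_eq by (subst ip_sum_left) (auto simp: ip_scale_left)
    also have "\<dots> = (\<Sum>n<N. of_real (b n) * cnj w ^ n * (\<mu> ^ n * ip (monomial 0) u))"
      by (simp only: mono[symmetric])
    finally show ?thesis by (simp add: sum_distrib_left sum_distrib_right power_mult_distrib mult_ac)
  qed
  ultimately have "(\<lambda>N. (\<Sum>n<N. of_real (b n) * (\<mu> * cnj w) ^ n) * ip (monomial 0) u) \<longlonglongrightarrow> ip (kernel_at w) u"
    by simp
  moreover have "(\<lambda>N. (\<Sum>n<N. of_real (b n) * (\<mu> * cnj w) ^ n) * ip (monomial 0) u) \<longlonglongrightarrow> K \<mu> w * ip (monomial 0) u"
    using K_sums[OF \<mu> w] by (intro tendsto_mult_right) (simp add: sums_def)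
  ultimately have "ip (kernel_at w) u = K \<mu> w * ip (monomial 0) u"
    by (rule LIMSEQ_unique)
  then have "cnj (u w) = cnj (K w \<mu> * cnj (ip (monomial 0) u))"
    using u w \<mu> K_cnj[of w \<mu>] by (simp add: reproducing')
  then show "u w = sc (cnj (ip (monomial 0) u)) (kernel_at \<mu>) w"
    using w by (simp only: complex_cnj_cancel_iff) (simp add: sc_apply kernel_at_apply)
qed (use u \<mu> in auto)

end

section \<open>Moebius maps\<close>

lemma unit_disc_one_minus_nonzero:
  assumes "cmod a < 1" "cmod z < 1"
  shows "1 - a * z \<noteq> 0" "1 - z * a \<noteq> 0"
proof -
  have "cmod (a * z) < 1" using norm_mult_less[OF assms] by simp
  then have "a * z \<noteq> 1" by auto
  then show "1 - a * z \<noteq> 0" "1 - z * a \<noteq> 0" by (auto simp: mult.commute)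
qed

lemma Moeb_I:
  assumes "cmod a < 1"
  shows "Moebius_function \<theta> a \<in> Moeb"
proof -
  define k where "k = \<lfloor>\<theta> / (2 * pi)\<rfloor>"
  define \<theta>' where "\<theta>' = \<theta> - of_int k * (2 * pi)"
  have "of_int k \<le> \<theta> / (2 * pi)" "\<theta> / (2 * pi) < of_int k + 1" by (auto simp: k_def)
  then have "0 \<le> \<theta>'" "\<theta>' < 2 * pi"
    by (auto simp: \<theta>'_def divide_simps algebra_simps)
  moreover have "Moebius_function \<theta>' a = Moebius_function \<theta> a"
  proof -
    have "exp (\<i> * of_real \<theta>') = exp (\<i> * complex_of_real \<theta>)"
      unfolding exp_eq by (rule exI[of _ "- k"]) (simp add: \<theta>'_def algebra_simps)
    then show ?thesis by (simp add: Moebius_function_def)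
  qed
  ultimately show ?thesis using assms unfolding Moeb_def by (auto intro!: exI[of _ \<theta>'] exI[of _ a])
qed

lemma Moeb_E:
  assumes "\<phi> \<in> Moeb"
  obtains \<theta> a where "\<phi> = Moebius_function \<theta> a" "cmod a < 1"
  using assms by (auto simp: Moeb_def)

lemma Moeb_ball: "\<phi> \<in> Moeb \<Longrightarrow> z \<in> ball 0 1 \<Longrightarrow> \<phi> z \<in> ball 0 1"
  using Moebius_function_norm_lt_1 by (auto elim!: Moeb_E)

lemma Moebius_inverse:
  assumes a: "cmod a < 1" and z: "cmod z < 1"
  shows "Moebius_function (- \<theta>) (- (a * exp (\<i> * of_real \<theta>))) (Moebius_function \<theta> a z) = z"
proof -
  define \<epsilon> where "\<epsilon> = exp (\<i> * complex_of_real \<theta>)"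
  have \<epsilon>: "\<epsilon> \<noteq> 0" "exp (\<i> * complex_of_real (- \<theta>)) = inverse \<epsilon>" "cnj \<epsilon> = inverse \<epsilon>"
    by (simp_all add: \<epsilon>_def exp_minus exp_cnj)
  have n: "1 - cnj a * z \<noteq> 0" "1 - cnj a * a \<noteq> 0"
    using unit_disc_one_minus_nonzero[of "cnj a"] a z by auto
  have "Moebius_function (- \<theta>) (- (a * \<epsilon>)) (Moebius_function \<theta> a z)
    = inverse \<epsilon> * (\<epsilon> * (z - a) / (1 - cnj a * z) + a * \<epsilon>) / (1 + cnj a * inverse \<epsilon> * (\<epsilon> * (z - a) / (1 - cnj a * z)))"
    using \<epsilon> by (simp add: Moebius_function_def flip: \<epsilon>_def)
  also have "inverse \<epsilon> * (\<epsilon> * (z - a) / (1 - cnj a * z) + a * \<epsilon>) = z * (1 - cnj a * a) / (1 - cnj a * z)"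
    using \<epsilon>(1) n by (simp add: field_simps)
  also have "1 + cnj a * inverse \<epsilon> * (\<epsilon> * (z - a) / (1 - cnj a * z)) = (1 - cnj a * a) / (1 - cnj a * z)"
    using \<epsilon>(1) n by (simp add: field_simps)
  finally show ?thesis using n by (simp add: \<epsilon>_def)
qed

lemma Moeb_inverse:
  assumes "\<phi> \<in> Moeb"
  obtains \<tau> where "\<tau> \<in> Moeb" "\<And>z. z \<in> ball 0 1 \<Longrightarrow> \<tau> (\<phi> z) = z" "\<And>z. z \<in> ball 0 1 \<Longrightarrow> \<phi> (\<tau> z) = z"
proof -
  obtain \<theta> a where \<phi>: "\<phi> = Moebius_function \<theta> a" and a: "cmod a < 1" using assms by (rule Moeb_E)
  define \<epsilon> where "\<epsilon> = exp (\<i> * complex_of_real \<theta>)"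
  have \<epsilon>: "exp (\<i> * complex_of_real (- \<theta>)) = inverse \<epsilon>" "\<epsilon> \<noteq> 0" "cmod \<epsilon> = 1"
    by (simp_all add: \<epsilon>_def exp_minus)
  have a': "cmod (- (a * \<epsilon>)) < 1" using a \<epsilon> by (simp add: norm_mult)
  show thesis
  proof
    show "Moebius_function (- \<theta>) (- (a * \<epsilon>)) \<in> Moeb" using a' by (rule Moeb_I)
    show "Moebius_function (- \<theta>) (- (a * \<epsilon>)) (\<phi> z) = z" if "z \<in> ball 0 1" for z
      using Moebius_inverse[OF a, of z \<theta>] that by (simp add: \<phi> \<epsilon>_def)
    show "\<phi> (Moebius_function (- \<theta>) (- (a * \<epsilon>)) z) = z" if "z \<in> ball 0 1" for z
      using Moebius_inverse[OF a', of z "- \<theta>"] that \<epsilon> by (simp add: \<phi> mult.assoc)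
  qed
qed

text \<open>The identity behind the Schwarz--Pick lemma.\<close>

lemma Moebius_Schwarz_Pick:
  assumes "cmod a < 1" "cmod z < 1" "cmod w < 1"
  shows "1 - Moebius_function \<theta> a z * cnj (Moebius_function \<theta> a w)
    = (1 - a * cnj a) * (1 - z * cnj w) / ((1 - cnj a * z) * (1 - a * cnj w))"
proof -
  have n: "1 - cnj a * z \<noteq> 0" "1 - a * cnj w \<noteq> 0"
    using unit_disc_one_minus_nonzero[of "cnj a" z] unit_disc_one_minus_nonzero[of a "cnj w"] assms by auto
  have "exp (\<i> * complex_of_real \<theta>) * cnj (exp (\<i> * complex_of_real \<theta>)) = 1"
    by (simp add: exp_cnj flip: exp_add)
  then have M: "Moebius_function \<theta> a z * cnj (Moebius_function \<theta> a w)
    = (z - a) * (cnj w - cnj a) / ((1 - cnj a * z) * (1 - a * cnj w))"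
    by (simp add: Moebius_function_def)
  have "(1 - cnj a * z) * (1 - a * cnj w) - (z - a) * (cnj w - cnj a) = (1 - a * cnj a) * (1 - z * cnj w)"
    by (simp add: algebra_simps)
  then show ?thesis unfolding M using n by (simp add: diff_divide_eq_iff del: mult_eq_0_iff)
qed

section \<open>Moebius invariant kernels\<close>

text \<open>
  An additive function that is non-negative is monotone, hence lies within a bounded distance of the
  linear function with the same values at the natural numbers.
\<close>

lemma additive_nonneg_bound:
  fixes \<psi> :: "real \<Rightarrow> real"
  assumes add: "\<And>x y. x \<ge> 0 \<Longrightarrow> y \<ge> 0 \<Longrightarrow> \<psi> (x + y) = \<psi> x + \<psi> y"
    and nonneg: "\<And>x. x \<ge> 0 \<Longrightarrow> \<psi> x \<ge> 0" and x: "x \<ge> 0"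
  shows "\<bar>\<psi> x - \<psi> 1 * x\<bar> \<le> \<psi> 1"
proof -
  have nat: "\<psi> (real n) = real n * \<psi> 1" for n
  proof (induction n)
    case 0 then show ?case using add[of 0 0] by simp
  next
    case (Suc n) then show ?case using add[of "real n" 1] by (simp add: algebra_simps)
  qed
  have mono: "\<psi> u \<le> \<psi> v" if "0 \<le> u" "u \<le> v" for u v
    using add[of u "v - u"] nonneg[of "v - u"] that by simp
  define n where "n = nat \<lfloor>x\<rfloor>"
  have n: "real n \<le> x" "x \<le> real n + 1" using x by (simp_all add: n_def)
  have "\<psi> x \<ge> real n * \<psi> 1" using mono[of "real n" x] n nat by simp
  moreover have "\<psi> x \<le> (real n + 1) * \<psi> 1" using mono[of x "real (Suc n)"] n nat[of "Suc n"] x by (simp add: add.commute)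
  moreover have "real n * \<psi> 1 \<le> x * \<psi> 1" "x * \<psi> 1 \<le> (real n + 1) * \<psi> 1"
    using n nonneg[of 1] by (auto intro!: mult_right_mono)
  ultimately show ?thesis by (simp add: abs_le_iff algebra_simps)
qed

lemma maximum_modulus_sphere:
  assumes hol: "f holomorphic_on ball 0 R" and r: "0 \<le> r" "r < R"
  obtains z where "cmod z = r" "cmod (f 0) \<le> cmod (f z)"
proof (cases "r = 0")
  case False
  have "continuous_on (sphere 0 r) (\<lambda>z. cmod (f z))"
    using r by (intro continuous_intros continuous_on_subset[OF holomorphic_on_imp_continuous_on[OF hol]]) auto
  moreover have "sphere 0 r \<noteq> ({} :: complex set)" using r by simp
  ultimately obtain z where z: "z \<in> sphere 0 r" "\<And>y. y \<in> sphere 0 r \<Longrightarrow> cmod (f y) \<le> cmod (f z)"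
    using continuous_attains_sup[OF compact_sphere] by metis
  have "cmod (f 0) \<le> cmod (f z)"
  proof (rule maximum_modulus_frontier[where f = f and S = "cball 0 r"])
    show "f holomorphic_on interior (cball 0 r)"
      by (rule holomorphic_on_subset[OF hol]) (use r in auto)
    show "continuous_on (closure (cball 0 r)) f"
      by (rule continuous_on_subset[OF holomorphic_on_imp_continuous_on[OF hol]]) (use r in auto)
    show "cmod (f y) \<le> cmod (f z)" if "y \<in> frontier (cball 0 r)" for y
      using z that False r by (simp add: frontier_cball)
  qed (use r in auto)
  then show thesis using z that by auto
qed (use that in auto)

lemma holomorphic_reflect:
  assumes "f holomorphic_on ball 0 r"
  shows "(\<lambda>z. cnj (f (cnj z))) holomorphic_on ball 0 r"
proof -
  have "cnj \<circ> f \<circ> cnj holomorphic_on ball 0 r"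
    by (rule holomorphic_on_compose_cnj_cnj)
       (use assms in \<open>auto intro: holomorphic_on_subset\<close>)
  then show ?thesis by (simp add: o_def)
qed

text \<open>
  A kernel on which every Moebius map acts by a change of the weight is, up to a weight, a power of
  \<open>1 - z cnj w\<close>.  Only its growth at the boundary is needed, and that can be obtained without
  derivatives: \<open>A z w\<close> below is the kernel normalised at the origin; its values on the diagonal
  satisfy a Cauchy functional equation, and they are at least \<open>1\<close>.
\<close>

locale invariant_kernel =
  fixes Q :: "complex \<Rightarrow> complex \<Rightarrow> complex"
  assumes hol: "\<And>w. w \<in> ball 0 1 \<Longrightarrow> (\<lambda>z. Q z w) holomorphic_on ball 0 1"
    and herm: "\<And>z w. z \<in> ball 0 1 \<Longrightarrow> w \<in> ball 0 1 \<Longrightarrow> Q w z = cnj (Q z w)"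
    and CS: "\<And>z w. z \<in> ball 0 1 \<Longrightarrow> w \<in> ball 0 1 \<Longrightarrow>
      (cmod (Q z w))\<^sup>2 \<le> Re (Q z z) * Re (Q w w)"
    and pos: "\<And>z. z \<in> ball 0 1 \<Longrightarrow> Re (Q z z) > 0"
    and inv: "\<And>\<phi>. \<phi> \<in> Moeb \<Longrightarrow> \<exists>\<gamma>. \<forall>z\<in>ball 0 1. \<forall>w\<in>ball 0 1.
      Q z w = cnj (\<gamma> z) * \<gamma> w * Q (\<phi> z) (\<phi> w)"
begin

lemma zero_invariant:
  assumes "\<phi> \<in> Moeb" "z \<in> ball 0 1" "w \<in> ball 0 1"
  shows "Q (\<phi> z) (\<phi> w) = 0 \<longleftrightarrow> Q z w = 0"
proof -
  obtain \<gamma> where \<gamma>: "\<And>z w. z \<in> ball 0 1 \<Longrightarrow> w \<in> ball 0 1 \<Longrightarrow> Q z w = cnj (\<gamma> z) * \<gamma> w * Q (\<phi> z) (\<phi> w)"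
    using inv[OF assms(1)] by blast
  have "\<gamma> z \<noteq> 0" if "z \<in> ball 0 1" for z
    using \<gamma>[OF that that] pos[OF that] by auto
  then show ?thesis using \<gamma>[OF assms(2,3)] assms by auto
qed

lemma rotation_Moeb: "cmod t = 1 \<Longrightarrow> \<exists>\<phi>\<in>Moeb. \<forall>z. \<phi> z = t * z"
proof -
  assume t: "cmod t = 1"
  have "exp (\<i> * of_real (Arg2pi t)) = t" using t complex_norm_eq_1_exp by blast
  then have "Moebius_function (Arg2pi t) 0 z = t * z" for z
    by (simp add: Moebius_function_def)
  moreover have "Moebius_function (Arg2pi t) 0 \<in> Moeb" by (rule Moeb_I) simp
  ultimately show ?thesis by blast
qed

text \<open>
  The set of zeros is invariant, so a single zero would produce zeros \<open>(y, 0)\<close> for all \<open>y\<close> on a circle, and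
  the maximum principle would give \<open>Q 0 0 = 0\<close>.
\<close>

lemma nonzero:
  assumes "z \<in> ball 0 1" "w \<in> ball 0 1"
  shows "Q z w \<noteq> 0"
proof
  assume 0: "Q z w = 0"
  have w: "cmod w < 1" using assms by simp
  define \<phi> where "\<phi> = Moebius_function 0 w"
  have \<phi>: "\<phi> \<in> Moeb" "\<phi> w = 0" using Moeb_I[OF w] by (simp_all add: \<phi>_def Moebius_function_eq_zero)
  define \<zeta> where "\<zeta> = \<phi> z"
  have \<zeta>: "\<zeta> \<in> ball 0 1" "Q \<zeta> 0 = 0"
    using Moeb_ball[OF \<phi>(1) assms(1)] zero_invariant[OF \<phi>(1) assms] 0 \<phi> by (auto simp: \<zeta>_def)
  obtain y where y: "cmod y = cmod \<zeta>" "cmod (Q 0 0) \<le> cmod (Q y 0)"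
    using maximum_modulus_sphere[OF hol[of 0], of "cmod \<zeta>"] \<zeta> by auto
  have "Q y 0 = 0"
  proof (cases "\<zeta> = 0")
    case False
    obtain \<rho> where \<rho>: "\<rho> \<in> Moeb" "\<And>z. \<rho> z = (y / \<zeta>) * z"
      using rotation_Moeb[of "y / \<zeta>"] y False by (auto simp: norm_divide)
    show ?thesis using zero_invariant[OF \<rho>(1) \<zeta>(1), of 0] \<rho>(2)[of \<zeta>] \<rho>(2)[of 0] \<zeta> False by simp
  qed (use y \<zeta> in auto)
  then show False using y pos[of 0] by simp
qed

text \<open>A cross-ratio: the weights by which a Moebius map changes \<open>Q\<close> cancel.\<close>

definition cross :: "complex \<Rightarrow> complex \<Rightarrow> complex \<Rightarrow> complex" where
  "cross u z w = Q z w * Q u u / (Q z u * Q u w)"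

lemma cross_invariant:
  assumes "\<phi> \<in> Moeb" "z \<in> ball 0 1" "w \<in> ball 0 1" "u \<in> ball 0 1"
  shows "cross (\<phi> u) (\<phi> z) (\<phi> w) = cross u z w"
proof -
  obtain \<gamma> where \<gamma>: "\<And>z w. z \<in> ball 0 1 \<Longrightarrow> w \<in> ball 0 1 \<Longrightarrow> Q z w = cnj (\<gamma> z) * \<gamma> w * Q (\<phi> z) (\<phi> w)"
    using inv[OF assms(1)] by blast
  have nz: "\<gamma> z \<noteq> 0" if "z \<in> ball 0 1" for z
    using \<gamma>[OF that that] pos[OF that] by auto
  show ?thesis
    using assms nz[of z] nz[of w] nz[of u] by (simp add: cross_def \<gamma>)
qed

definition A :: "complex \<Rightarrow> complex \<Rightarrow> complex" where
  "A = cross 0"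

lemma A_rotate:
  assumes "cmod t = 1" "z \<in> ball 0 1" "w \<in> ball 0 1"
  shows "A (t * z) (t * w) = A z w"
proof -
  obtain \<rho> where \<rho>: "\<rho> \<in> Moeb" "\<And>z. \<rho> z = t * z" using rotation_Moeb[OF assms(1)] by blast
  show ?thesis using cross_invariant[OF \<rho>(1) assms(2,3), of 0] by (simp add: A_def \<rho>(2))
qed

lemma A_cnj:
  assumes "z \<in> ball 0 1" "w \<in> ball 0 1"
  shows "A w z = cnj (A z w)"
  using herm[of z w] herm[of 0 w] herm[of z 0] herm[of 0 0] assms
  by (simp add: A_def cross_def mult.commute)

lemma A_hol:
  assumes "w \<in> ball 0 1"
  shows "(\<lambda>z. A z w) holomorphic_on ball 0 1"
  unfolding A_def cross_def
  by (intro holomorphic_intros hol assms) (use nonzero assms in auto)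

text \<open>
  By invariance under rotations \<open>A z w\<close> depends on \<open>z cnj w\<close> only: the two sides of the following
  equation are holomorphic in \<open>s\<close> and agree for \<open>|s| = 1\<close>.
\<close>

lemma A_shift:
  assumes z: "z \<in> ball 0 1" and w: "w \<in> ball 0 1" and s: "0 \<le> s" "s \<le> 1"
  shows "A (of_real s * z) w = A z (of_real s * w)"
proof (cases "s = 1")
  case False
  define \<rho> where "\<rho> = max (cmod z) (cmod w)"
  \<comment> \<open>Both sides are holomorphic in a disc of radius \<open>R > 1\<close>, as \<open>R \<rho> < 1\<close>.\<close>
  define R where "R = 2 / (1 + \<rho>)"
  have \<rho>: "0 \<le> \<rho>" "\<rho> < 1" using z w by (auto simp: \<rho>_def le_max_iff_disj)
  then have R: "R > 1" "R * \<rho> < 1" by (auto simp: R_def divide_simps)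
  have inside: "t * y \<in> ball 0 1" if "t \<in> ball 0 R" "cmod y \<le> \<rho>" for t y
  proof -
    have "cmod t * cmod y \<le> R * \<rho>" using that R by (intro mult_mono) auto
    then show ?thesis using R by (simp add: norm_mult)
  qed
  define f where "f t = A (t * z) w - cnj (A (cnj t * w) z)" for t
  have f_hol: "f holomorphic_on ball 0 R"
  proof -
    have "(\<lambda>u. A u w) \<circ> (\<lambda>t. t * z) holomorphic_on ball 0 R"
      by (rule holomorphic_on_compose_gen[OF _ A_hol[OF w]])
         (use inside in \<open>auto intro!: holomorphic_intros simp: \<rho>_def\<close>)
    moreover have "(\<lambda>u. A u z) \<circ> (\<lambda>t. t * w) holomorphic_on ball 0 R"
      by (rule holomorphic_on_compose_gen[OF _ A_hol[OF z]])
         (use inside in \<open>auto intro!: holomorphic_intros simp: \<rho>_def\<close>)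
    ultimately show ?thesis
      unfolding f_def by (intro holomorphic_intros holomorphic_reflect) (auto simp: o_def)
  qed
  have circle: "f t = 0" if t: "cmod t = 1" for t
  proof -
    have "cnj t * w \<in> ball 0 1" using t w by (simp add: norm_mult)
    then have "A (t * z) (t * (cnj t * w)) = A z (cnj t * w)" using t z by (intro A_rotate)
    also have "t * (cnj t * w) = w" using t complex_norm_square[of t] by simp
    also have "A z (cnj t * w) = cnj (A (cnj t * w) z)"
      by (rule A_cnj) (use z \<open>cnj t * w \<in> ball 0 1\<close> in auto)
    finally show ?thesis by (simp add: f_def)
  qed
  have sub: "cball 0 1 \<subseteq> ball (0::complex) R" using R by (simp add: cball_subset_ball_iff)
  have "cmod (f (of_real s)) \<le> 0"
  proof (rule maximum_modulus_frontier[where f = f and S = "cball 0 1"])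
    show "f holomorphic_on interior (cball 0 1)"
      by (rule holomorphic_on_subset[OF f_hol]) (use sub in auto)
    show "continuous_on (closure (cball 0 1)) f"
      by (rule continuous_on_subset[OF holomorphic_on_imp_continuous_on[OF f_hol]]) (use sub in auto)
    show "cmod (f t) \<le> 0" if "t \<in> frontier (cball 0 1)" for t
      using circle[of t] that by (simp add: frontier_cball)
  qed (use s in auto)
  then have "A (of_real s * z) w = cnj (A (of_real s * w) z)" by (simp add: f_def)
  also have "\<dots> = A z (of_real s * w)"
    using inside[of "of_real s" w] s R z by (subst A_cnj[of "of_real s * w" z]) (auto simp: \<rho>_def)
  finally show ?thesis .
qed simp

definition F :: "real \<Rightarrow> real" where
  "F s = Re (A (of_real (sqrt s)) (of_real (sqrt s)))"

lemma A_diag: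
  assumes "z \<in> ball 0 1"
  shows "A z z = of_real (F ((cmod z)\<^sup>2))"
proof -
  obtain t where t: "cmod t = 1" "z = t * of_real (cmod z)"
  proof (cases "z = 0")
    case True then show thesis using that[of 1] by simp
  next
    case False then show thesis using that[of "z / of_real (cmod z)"] by (simp add: norm_divide)
  qed
  have "A z z = A (of_real (cmod z)) (of_real (cmod z))"
    using A_rotate[OF t(1), of "of_real (cmod z)" "of_real (cmod z)"] assms by (simp flip: t(2))
  moreover have "A z z = of_real (Re (A z z))"
    using A_cnj[OF assms assms] by (simp add: complex_eq_iff)
  ultimately show ?thesis by (simp add: F_def)
qed

lemma A_real:
  assumes "0 \<le> x" "x < 1" "0 \<le> y" "y < 1"
  shows "A (of_real x) (of_real y) = of_real (F (x * y))"
proof -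
  define g where "g = sqrt (x * y)"
  have *: "A (of_real x) (of_real y) = A (of_real g) (of_real g)"
    if g: "g = sqrt (x * y)" and xy: "0 \<le> y" "y \<le> x" "x < 1" for x y g
  proof (cases "x = 0")
    case False
    then have x: "x > 0" using xy by simp
    have gx: "0 \<le> g" "g \<le> x" "g * g = x * y"
      using xy x unfolding g by (auto intro!: real_le_lsqrt simp: power2_eq_square mult_left_mono)
    have "A (of_real (g / x) * of_real x) (of_real g) = A (of_real x) (of_real (g / x) * of_real g)"
      by (rule A_shift) (use gx x xy in auto)
    moreover have "g / x * x = g" "g / x * g = y" using x gx(3) by auto
    ultimately show ?thesis by (simp only: flip: of_real_mult)
  qed (use xy g in auto)
  have g1: "g < 1" "0 \<le> g"
  proof -
    have "x * y < 1" using assms mult_strict_mono'[of x 1 y 1] by simp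
    then show "g < 1" "0 \<le> g" using assms by (auto simp: g_def)
  qed
  have gg: "A (of_real g) (of_real g) = of_real (F (x * y))"
    using A_diag[of "of_real g"] g1 assms by (simp add: g_def)
  show ?thesis
  proof (cases "y \<le> x")
    case True then show ?thesis using *[OF g_def] assms gg by simp
  next
    case False
    then have "A (of_real y) (of_real x) = A (of_real g) (of_real g)"
      using *[of g y x] assms by (simp add: g_def mult.commute)
    then show ?thesis using A_cnj[of "of_real y" "of_real x"] assms gg by simp
  qed
qed

text \<open>This is the Cauchy--Schwarz inequality for \<open>Q\<close>.\<close>

lemma F_ge_1:
  assumes "0 \<le> s" "s < 1"
  shows "F s \<ge> 1"
proof -
  define x where "x = complex_of_real (sqrt s)"
  have x: "x \<in> ball 0 1" using assms by (simp add: x_def)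
  have "F s = Re (Q x x * Q 0 0 / (Q x 0 * Q 0 x))" by (simp add: F_def A_def cross_def x_def)
  also have "Q x 0 * Q 0 x = of_real ((cmod (Q x 0))\<^sup>2)"
    using herm[of x 0] x by (simp only: complex_norm_square) simp
  also have "Q x x * Q 0 0 = of_real (Re (Q x x) * Re (Q 0 0))"
    using herm[of x x] herm[of 0 0] x by (simp add: complex_eq_iff)
  also have "Re (of_real (Re (Q x x) * Re (Q 0 0)) / of_real ((cmod (Q x 0))\<^sup>2))
     = Re (Q x x) * Re (Q 0 0) / (cmod (Q x 0))\<^sup>2"
    by (simp only: Re_complex_of_real flip: of_real_divide)
  finally show ?thesis using CS[of x 0] nonzero[of x 0] x by simp
qed

text \<open>
  Invariance under the translation \<open>z \<mapsto> (z + a) / (1 + a z)\<close>, applied to the points \<open>-a\<close>, \<open>-b\<close> and \<open>0\<close> with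
  \<open>t = a\<^sup>2\<close> and \<open>s = a b\<close>.
\<close>

lemma F_functional_equation:
  assumes "0 \<le> s" "s \<le> t" "t < 1"
  shows "F s * F ((t - s) / (1 - s)) = F t"
proof (cases "t = 0")
  case True
  then show ?thesis using assms using nonzero[of 0 0] by (simp add: F_def A_def cross_def)
next
  case False
  define a where "a = sqrt t"
  define b where "b = s / a"
  have a: "0 < a" "a < 1" "a * a = t" using assms False by (auto simp: a_def)
  have b: "0 \<le> b" "b \<le> a" "a * b = s" using assms a by (auto simp: b_def divide_simps)
  have ab: "a * b < 1" using assms b by simp
  define c where "c = (a - b) / (1 - a * b)"
  have c: "0 \<le> c" "c < 1" "a * c = (t - s) / (1 - s)"
  proof -
    show "0 \<le> c" using ab b by (simp add: c_def)
    have "0 < (1 - a) * (1 + b)" using a b by simp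
    then have "a - b < 1 - a * b" by (simp add: algebra_simps)
    then show "c < 1" using ab by (simp add: c_def)
    show "a * c = (t - s) / (1 - s)" using a b by (simp add: c_def algebra_simps)
  qed
  define \<phi> where "\<phi> = Moebius_function 0 (- of_real a)"
  have \<phi>: "\<phi> \<in> Moeb" using Moeb_I[of "- of_real a" 0] a by (simp add: \<phi>_def)
  have \<phi>_val: "\<phi> (- of_real a) = 0" "\<phi> 0 = of_real a" "\<phi> (- of_real b) = of_real c"
    by (simp_all add: \<phi>_def Moebius_function_simple c_def)
  have in_ball: "of_real x \<in> ball (0::complex) 1" "- of_real x \<in> ball (0::complex) 1" if "0 \<le> x" "x < 1" for x
    using that by auto
  have b1: "b < 1" using a b by simp
  have "of_real (F s) = A (of_real a) (of_real b)" using A_real[of a b] a b b1 by simp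
  also have "\<dots> = A (- of_real a) (- of_real b)"
    using A_rotate[of "-1" "of_real a" "of_real b"] a b b1 by simp
  also have "\<dots> = cross (of_real a) 0 (of_real c)"
    using cross_invariant[OF \<phi>, of "- of_real a" "- of_real b" 0] in_ball[of a] in_ball[of b] a b b1
    by (simp add: A_def \<phi>_val)
  finally have "of_real (F s) * A (of_real a) (of_real c)
      = cross (of_real a) 0 (of_real c) * A (of_real a) (of_real c)" by simp
  also have "\<dots> = A (of_real a) (of_real a)"
    using nonzero[of "of_real a" 0] nonzero[of 0 "of_real a"] nonzero[of "of_real a" "of_real c"]
      nonzero[of 0 "of_real c"] nonzero[of 0 0] a c
    by (simp add: A_def cross_def)
  finally have "complex_of_real (F s * F (a * c)) = of_real (F (a * a))"
    using A_real[of a c] A_real[of a a] a c by simp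
  then show ?thesis using a c by (simp only: of_real_eq_iff)
qed

text \<open>
  In the variable \<open>x = - ln (1 - t)\<close> the functional equation says that \<open>ln F\<close> is additive.
\<close>

lemma F_growth:
  "\<exists>p. \<forall>t. 0 \<le> t \<and> t < 1 \<longrightarrow> exp (- p) \<le> (1 - t) powr p * F t \<and> (1 - t) powr p * F t \<le> exp p"
proof -
  define \<psi> where "\<psi> x = ln (F (1 - exp (- x)))" for x
  have range: "0 \<le> 1 - exp (- x)" "1 - exp (- x) < 1" if "x \<ge> 0" for x :: real using that by auto
  have add: "\<psi> (x + y) = \<psi> x + \<psi> y" if "x \<ge> 0" "y \<ge> 0" for x y
  proof -
    have "F (1 - exp (- x)) * F ((1 - exp (- (x + y)) - (1 - exp (- x))) / (1 - (1 - exp (- x)))) = F (1 - exp (- (x + y)))"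
      by (rule F_functional_equation) (use that in auto)
    also have "(1 - exp (- (x + y)) - (1 - exp (- x))) / (1 - (1 - exp (- x))) = 1 - exp (- y)"
    proof -
      have "exp (- (x + y)) = exp (- x) * exp (- y)" by (simp flip: exp_add)
      then show ?thesis by (simp only:) (simp add: field_simps)
    qed
    finally have e: "F (1 - exp (- x)) * F (1 - exp (- y)) = F (1 - exp (- (x + y)))" .
    show ?thesis
      using F_ge_1[OF range[OF that(1)]] F_ge_1[OF range[OF that(2)]]
      unfolding \<psi>_def e[symmetric] by (simp add: ln_mult)
  qed
  have nonneg: "\<psi> x \<ge> 0" if "x \<ge> 0" for x
    using F_ge_1[OF range[OF that]] by (simp add: \<psi>_def)
  have "exp (- \<psi> 1) \<le> (1 - t) powr (\<psi> 1) * F t \<and> (1 - t) powr (\<psi> 1) * F t \<le> exp (\<psi> 1)"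
    if t: "0 \<le> t" "t < 1" for t
  proof -
    define x where "x = - ln (1 - t)"
    have x: "x \<ge> 0" "t = 1 - exp (- x)" using t by (auto simp: x_def)
    have Ft: "F t = exp (\<psi> x)" using F_ge_1[OF t] by (simp add: \<psi>_def flip: x(2))
    have "(1 - t) powr (\<psi> 1) * F t = exp (\<psi> x - \<psi> 1 * x)"
      using t by (simp add: Ft powr_def x_def flip: exp_add)
    then show ?thesis using additive_nonneg_bound[of \<psi> x, OF add nonneg x(1)] by (simp add: abs_le_iff)
  qed
  then show ?thesis by blast
qed

text \<open>
  The weight \<open>Q z 0\<close> by which \<open>Q\<close> differs from its normalisation is zero-free, so that on each circle it
  takes values at least and at most as large as at the origin.  A radial function comparable to
  \<open>Q z z\<close> is therefore comparable to the normalised kernel.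
\<close>

theorem radial_growth:
  assumes C: "C > 0" and up: "\<And>z. z \<in> ball 0 1 \<Longrightarrow> Re (Q z z) \<le> C * R (cmod z)"
    and low: "\<And>z. z \<in> ball 0 1 \<Longrightarrow> R (cmod z) \<le> C * Re (Q z z)"
  shows "\<exists>p m M. m > 0 \<and> (\<forall>r. 0 \<le> r \<and> r < 1 \<longrightarrow>
    m \<le> (1 - r\<^sup>2) powr p * R r \<and> (1 - r\<^sup>2) powr p * R r \<le> M)"
proof -
  define q where "q = Re (Q 0 0)"
  have q: "q > 0" using pos[of 0] by (simp add: q_def)
  have Q0: "Q 0 0 = of_real q" using herm[of 0 0] by (simp add: q_def complex_eq_iff)
  have diag: "Re (Q z z) = F ((cmod z)\<^sup>2) * (cmod (Q z 0))\<^sup>2 / q" if z: "z \<in> ball 0 1" for z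
  proof -
    have "A z z = Q z z * of_real q / (Q z 0 * Q 0 z)" by (simp add: A_def cross_def Q0)
    also have "Q z 0 * Q 0 z = of_real ((cmod (Q z 0))\<^sup>2)"
      using herm[of z 0] z by (simp only: complex_norm_square) simp
    finally have "Q z z = of_real (F ((cmod z)\<^sup>2) * (cmod (Q z 0))\<^sup>2 / q)"
      using A_diag[OF z] nonzero[of z 0] z q by (simp add: field_simps)
    then show ?thesis by (metis Re_complex_of_real)
  qed
  obtain p where p: "\<And>t. 0 \<le> t \<Longrightarrow> t < 1 \<Longrightarrow> exp (- p) \<le> (1 - t) powr p * F t"
    "\<And>t. 0 \<le> t \<Longrightarrow> t < 1 \<Longrightarrow> (1 - t) powr p * F t \<le> exp p"
    using F_growth by blast
  have "q / C * exp (- p) \<le> (1 - r\<^sup>2) powr p * R r \<and> (1 - r\<^sup>2) powr p * R r \<le> C * q * exp p"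
    if r: "0 \<le> r" "r < 1" for r
  proof -
    have r2: "0 \<le> r\<^sup>2" "r\<^sup>2 < 1" using r by (auto simp: power_less_one_iff abs_square_less_1)
    have F1: "F (r\<^sup>2) \<ge> 1" using F_ge_1[OF r2] .
    obtain z where z: "cmod z = r" "cmod (Q 0 0) \<le> cmod (Q z 0)"
      using maximum_modulus_sphere[OF hol[of 0] r] by auto
    have "(\<lambda>z. inverse (Q z 0)) holomorphic_on ball 0 1"
      by (intro holomorphic_intros hol) (use nonzero in auto)
    from maximum_modulus_sphere[OF this r] obtain y
      where y: "cmod y = r" "cmod (inverse (Q 0 0)) \<le> cmod (inverse (Q y 0))" by auto
    have y': "cmod (Q y 0) \<le> cmod (Q 0 0)"
      using y r nonzero[of y 0] nonzero[of 0 0] by (simp add: norm_inverse le_imp_inverse_le)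
    have "F (r\<^sup>2) * q \<le> C * R r"
    proof -
      have "F (r\<^sup>2) * q = F (r\<^sup>2) * q\<^sup>2 / q" using q by (simp add: power2_eq_square)
      also have "\<dots> \<le> F (r\<^sup>2) * (cmod (Q z 0))\<^sup>2 / q"
        using z q F1 by (intro divide_right_mono mult_left_mono power_mono) (auto simp: Q0)
      also have "\<dots> \<le> C * R r" using diag[of z] up[of z] z r by simp
      finally show ?thesis .
    qed
    moreover have "R r \<le> C * (F (r\<^sup>2) * q)"
    proof -
      have "R r \<le> C * (F (r\<^sup>2) * (cmod (Q y 0))\<^sup>2 / q)" using diag[of y] low[of y] y r by simp
      also have "\<dots> \<le> C * (F (r\<^sup>2) * q\<^sup>2 / q)"
        using y' q F1 C by (intro mult_left_mono divide_right_mono power_mono) (auto simp: Q0)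
      finally show ?thesis using q by (simp add: power2_eq_square)
    qed
    moreover define P where "P = (1 - r\<^sup>2) powr p"
    moreover have "P \<ge> 0" by (simp add: P_def)
    ultimately have "P * F (r\<^sup>2) * (q / C) \<le> P * R r" "P * R r \<le> C * q * (P * F (r\<^sup>2))"
      using C mult_left_mono[of "F (r\<^sup>2) * q" "C * R r" P] mult_left_mono[of "R r" "C * (F (r\<^sup>2) * q)" P]
      by (simp_all add: field_simps)
    moreover have "q / C * exp (- p) \<le> P * F (r\<^sup>2) * (q / C)"
      using p(1)[OF r2] q C by (simp add: P_def field_simps)
    moreover have "C * q * (P * F (r\<^sup>2)) \<le> C * q * exp p"
      using p(2)[OF r2] q C by (simp add: P_def)
    ultimately show ?thesis by (simp add: P_def)
  qed
  then show ?thesis using q C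
    by (rule_tac exI[of _ p], rule_tac exI[of _ "q / C * exp (- p)"], rule_tac exI[of _ "C * q * exp p"]) auto
qed

end

section \<open>Powers of the Szego kernel\<close>

text \<open>The Taylor coefficients of \<open>(1 - x)\<^sup>-\<^sup>\<mu>\<close>.\<close>

definition power_coeff :: "real \<Rightarrow> nat \<Rightarrow> real" where
  "power_coeff \<mu> n = pochhammer \<mu> n / fact n"

lemma power_coeff_pos: "\<mu> > 0 \<Longrightarrow> power_coeff \<mu> n > 0"
  by (simp add: power_coeff_def pochhammer_pos)

lemma disc_mult: "z \<in> ball 0 1 \<Longrightarrow> w \<in> ball 0 1 \<Longrightarrow> cmod (z * cnj w) < 1"
  using norm_mult_less[of z 1 "cnj w" 1] by simp

lemma power_kernel_sums:
  assumes "z \<in> ball 0 1" "w \<in> ball 0 1"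
  shows "(\<lambda>n. of_real (power_coeff \<mu> n) * (z * cnj w) ^ n) sums power_kernel \<mu> z w"
proof -
  have "(\<lambda>n. ((- of_real \<mu>) gchoose n) * (- (z * cnj w)) ^ n) sums (1 + - (z * cnj w)) powr (- of_real \<mu>)"
    by (rule gen_binomial_complex) (use disc_mult[OF assms] in simp)
  moreover have "((- of_real \<mu>) gchoose n) * (- (z * cnj w)) ^ n = of_real (power_coeff \<mu> n) * (z * cnj w) ^ n" for n
  proof -
    have "(- (z * cnj w)) ^ n = (- 1) ^ n * (z * cnj w) ^ n" by (rule power_minus)
    then show ?thesis
      by (simp add: gbinomial_pochhammer power_coeff_def pochhammer_of_real flip: power_mult_distrib)
  qed
  ultimately show ?thesis by (simp add: power_kernel_def)
qed

text \<open>
  With \<open>c = 1 + 1 / \<mu>\<close> the kernel \<open>(c - z cnj w) (1 - z cnj w)\<^sup>-\<^sup>\<mu>\<close> has non-negative coefficients, i.e. \<open>c\<close>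
  bounds the square of the norm of the weighted shift of the power kernel.
\<close>

definition shift_coeff :: "real \<Rightarrow> nat \<Rightarrow> real" where
  "shift_coeff \<mu> n = (1 + 1 / \<mu>) * power_coeff \<mu> n - (if n = 0 then 0 else power_coeff \<mu> (n - 1))"

lemma shift_coeff_nonneg:
  assumes "\<mu> > 0"
  shows "shift_coeff \<mu> n \<ge> 0"
proof (cases n)
  case 0
  then show ?thesis using assms by (simp add: shift_coeff_def power_coeff_def)
next
  case (Suc m)
  have "power_coeff \<mu> (Suc m) = power_coeff \<mu> m * ((\<mu> + real m) / (real m + 1))"
    by (simp add: power_coeff_def pochhammer_Suc field_simps)
  then have "shift_coeff \<mu> n = power_coeff \<mu> m * ((1 + 1 / \<mu>) * ((\<mu> + real m) / (real m + 1)) - 1)"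
    by (simp add: shift_coeff_def Suc algebra_simps)
  moreover have "(1 + 1 / \<mu>) * ((\<mu> + real m) / (real m + 1)) \<ge> 1"
  proof -
    have "(1 + 1 / \<mu>) * ((\<mu> + real m) / (real m + 1)) = ((\<mu> + 1) * (\<mu> + real m)) / (\<mu> * (real m + 1))"
      using assms by (simp add: divide_simps)
    moreover have "\<mu> * (real m + 1) \<le> (\<mu> + 1) * (\<mu> + real m)"
      using assms by (simp add: algebra_simps)
    ultimately show ?thesis using assms by simp
  qed
  ultimately show ?thesis using power_coeff_pos[OF assms, of m] by simp
qed

lemma shift_coeff_sums:
  assumes "z \<in> ball 0 1" "w \<in> ball 0 1"
  shows "(\<lambda>n. of_real (shift_coeff \<mu> n) * (z * cnj w) ^ n) sums
    ((of_real (1 + 1 / \<mu>) - z * cnj w) * power_kernel \<mu> z w)"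
proof -
  define s where "s = z * cnj w"
  note P = power_kernel_sums[OF assms, of \<mu>, folded s_def]
  define f where "f n = (if n = 0 then 0 else of_real (power_coeff \<mu> (n - 1)) * s ^ n)" for n
  have "(\<lambda>n. f (Suc n)) sums (s * power_kernel \<mu> z w)"
    using sums_mult[OF P, of s] by (simp add: f_def mult_ac)
  then have "f sums (s * power_kernel \<mu> z w)" using sums_Suc[of f] by (simp add: f_def)
  from sums_diff[OF sums_mult[OF P, of "of_real (1 + 1 / \<mu>)"] this]
  have "(\<lambda>n. of_real (1 + 1 / \<mu>) * (of_real (power_coeff \<mu> n) * s ^ n) - f n) sums
    (of_real (1 + 1 / \<mu>) * power_kernel \<mu> z w - s * power_kernel \<mu> z w)" .
  moreover have "of_real (1 + 1 / \<mu>) * (of_real (power_coeff \<mu> n) * s ^ n) - f n = of_real (shift_coeff \<mu> n) * s ^ n" for n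
    by (simp add: f_def shift_coeff_def algebra_simps)
  ultimately show ?thesis by (simp add: left_diff_distrib flip: s_def)
qed

lemma Re_one_minus_pos: "cmod s < 1 \<Longrightarrow> 0 < Re (1 - s)"
  using complex_Re_le_cmod[of s] by simp

text \<open>
  The principal branches are compatible because all the numbers involved lie in the right half
  plane, so that the sum of four arguments stays below \<open>2 \<pi>\<close>.
\<close>

lemma power_kernel_Moeb:
  assumes "\<phi> \<in> Moeb"
  shows "\<exists>\<eta>. (\<forall>z\<in>ball 0 1. \<eta> z \<noteq> 0) \<and> (\<forall>z\<in>ball 0 1. \<forall>w\<in>ball 0 1.
    power_kernel \<mu> z w = \<eta> z * power_kernel \<mu> (\<phi> z) (\<phi> w) * cnj (\<eta> w))"
proof -
  obtain \<theta> a where \<phi>: "\<phi> = Moebius_function \<theta> a" and a: "cmod a < 1" using assms by (rule Moeb_E)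
  define p where "p = 1 - (cmod a)\<^sup>2"
  have p: "p > 0" using a by (simp add: p_def abs_square_less_1)
  define \<eta> where "\<eta> z = of_real (p powr (\<mu> / 2)) * exp (- of_real \<mu> * Ln (1 - cnj a * z))" for z
  have "power_kernel \<mu> z w = \<eta> z * power_kernel \<mu> (\<phi> z) (\<phi> w) * cnj (\<eta> w)"
    if z: "z \<in> ball 0 1" and w: "w \<in> ball 0 1" for z w
  proof -
    define x where "x = 1 - cnj a * z"
    define y where "y = 1 - a * cnj w"
    define s where "s = 1 - z * cnj w"
    define t where "t = 1 - \<phi> z * cnj (\<phi> w)"
    have re: "Re x > 0" "Re y > 0" "Re s > 0" "Re t > 0"
      unfolding x_def y_def s_def t_def using disc_mult[of z a] disc_mult[of a w] disc_mult[OF z w] a z w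
        disc_mult[OF Moeb_ball[OF assms z] Moeb_ball[OF assms w]]
      by (intro Re_one_minus_pos; simp add: mult.commute)+
    then have nz: "x \<noteq> 0" "y \<noteq> 0" "s \<noteq> 0" "t \<noteq> 0" by auto
    have im: "\<bar>Im (Ln x)\<bar> < pi / 2" "\<bar>Im (Ln y)\<bar> < pi / 2" "\<bar>Im (Ln s)\<bar> < pi / 2" "\<bar>Im (Ln t)\<bar> < pi / 2"
      by (intro Re_Ln_pos_lt[THEN iffD2] nz re)+
    have "t * (x * y) = of_real p * s"
    proof -
      have "of_real p = 1 - a * cnj a" by (simp add: p_def complex_norm_square del: of_real_power)
      moreover have "t = (1 - a * cnj a) * s / (x * y)"
        unfolding t_def \<phi> s_def x_def y_def using a z w by (intro Moebius_Schwarz_Pick) auto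
      ultimately show ?thesis using nz by simp
    qed
    then have "exp (Ln t + Ln x + Ln y) = exp (of_real (ln p) + Ln s)"
      using nz p by (simp add: exp_add exp_of_real mult.assoc)
    then have "Ln t + Ln x + Ln y = of_real (ln p) + Ln s"
      by (rule exp_complex_eqI[rotated]) (use im in simp)
    then have Ls: "Ln s = Ln t + Ln x + Ln y - of_real (ln p)" by simp
    have cy: "cnj (Ln (1 - cnj a * w)) = Ln y"
    proof -
      have "1 - cnj a * w \<notin> \<real>\<^sub>\<le>\<^sub>0" "cnj (1 - cnj a * w) = y"
        using re(2) by (auto simp: y_def complex_nonpos_Reals_iff)
      then show ?thesis using cnj_Ln[of "1 - cnj a * w"] by metis
    qed
    have "power_kernel \<mu> z w = exp (- of_real \<mu> * Ln s)"
      using nz by (simp add: power_kernel_def powr_def s_def)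
    also have "\<dots> = exp (of_real (\<mu> * ln p)) * exp (- of_real \<mu> * Ln x) * exp (- of_real \<mu> * Ln t) * exp (- of_real \<mu> * Ln y)"
      by (simp add: Ls algebra_simps flip: exp_add)
    also have "exp (complex_of_real (\<mu> * ln p)) = of_real (p powr (\<mu> / 2)) * of_real (p powr (\<mu> / 2))"
      using p by (simp add: powr_def flip: exp_of_real exp_add of_real_mult)
    also have "exp (- of_real \<mu> * Ln t) = power_kernel \<mu> (\<phi> z) (\<phi> w)"
      using nz by (simp add: power_kernel_def powr_def t_def)
    also have "exp (- of_real \<mu> * Ln y) = cnj (exp (- of_real \<mu> * Ln (1 - cnj a * w)))"
      by (simp add: exp_cnj cy)
    finally show ?thesis by (simp add: \<eta>_def x_def mult_ac)
  qed
  moreover have "\<eta> z \<noteq> 0" for z using p by (simp add: \<eta>_def)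
  ultimately show ?thesis by (intro exI[of _ \<eta>]) simp
qed

section \<open>Moebius maps as multipliers\<close>

lemma bounded_map_cong:
  assumes "inner_space H" "bounded_map H G L" "\<And>x. x \<in> hcarrier H \<Longrightarrow> L x = L' x"
  shows "bounded_map H G L'"
proof -
  interpret inner_space H by fact
  show ?thesis using assms(2,3) by (auto simp: bounded_map_def)
qed

text \<open>
  If the Moebius maps are uniformly bounded multipliers, then so are the functions \<open>1 / (1 - cnj a z)\<close>,
  which are affine functions of Moebius maps; these give the resolvent.
\<close>

locale moebius_multipliers = rkhs +
  fixes C :: real
  assumes C_nonneg: "C \<ge> 0"
    and multiplier: "\<And>\<phi>. \<phi> \<in> Moeb \<Longrightarrow>
      psd (\<lambda>z w. of_real (C\<^sup>2) * K z w - \<phi> z * K z w * cnj (\<phi> w))"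
begin

abbreviation "mlt \<phi> \<equiv> wcomp \<phi> (\<lambda>z. z)"

lemma mlt_apply: "mlt \<phi> f z = (if z \<in> ball 0 1 then \<phi> z * f z else 0)"
  by (simp add: wcomp_def disc_restrict_def)

lemma mlt_bounded:
  assumes "\<phi> \<in> Moeb"
  shows "f \<in> X \<Longrightarrow> mlt \<phi> f \<in> X" "f \<in> X \<Longrightarrow> nrm (mlt \<phi> f) \<le> C * nrm f" "bounded_map H H (mlt \<phi>)"
  using wcomp_bounded[of C "\<lambda>z. z" \<phi>, OF C_nonneg _ multiplier[OF assms]] by auto

lemma mult_z_eq: "f \<in> X \<Longrightarrow> mult_z f = mlt (Moebius_function 0 0) f"
  using off_disc by (auto simp: mult_z_def mlt_apply Moebius_function_simple)

lemma mult_z_bounded: "bounded_map H H mult_z"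
  by (rule bounded_map_cong[OF inner_space_axioms mlt_bounded(3)[OF Moeb_I[of 0 0]]])
     (auto simp: mult_z_eq)

definition divide_by :: "complex \<Rightarrow> (complex \<Rightarrow> complex) \<Rightarrow> complex \<Rightarrow> complex" where
  "divide_by a f z = f z / (1 - cnj a * z)"

lemma divide_by_eq:
  assumes a: "cmod a < 1" and f: "f \<in> X"
  shows "divide_by a f = sc (1 / (1 - cnj a * a)) (sc (cnj a) (mlt (Moebius_function 0 a) f) + f)"
proof
  fix z
  show "divide_by a f z = sc (1 / (1 - cnj a * a)) (sc (cnj a) (mlt (Moebius_function 0 a) f) + f) z"
  proof (cases "z \<in> ball 0 1")
    case True
    then have n: "1 - cnj a * z \<noteq> 0" "1 - cnj a * a \<noteq> 0"
      using unit_disc_one_minus_nonzero[of "cnj a"] a by auto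
    have "cnj a * ((z - a) / (1 - cnj a * z)) + 1 = (1 - cnj a * a) / (1 - cnj a * z)"
      using n by (simp add: field_simps)
    then have "1 / (1 - cnj a * a) * (cnj a * ((z - a) / (1 - cnj a * z) * f z) + f z)
       = 1 / (1 - cnj a * a) * ((1 - cnj a * a) / (1 - cnj a * z) * f z)"
      by (metis (no_types, lifting) distrib_right mult.assoc mult_1)
    also have "\<dots> = f z / (1 - cnj a * z)" using n by simp
    finally show ?thesis
      using True by (simp add: divide_by_def sc_apply mlt_apply Moebius_function_simple)
  qed (use off_disc[OF f] in \<open>auto simp: divide_by_def sc_apply mlt_apply\<close>)
qed

lemma divide_by_bounded:
  assumes a: "cmod a < 1"
  shows "f \<in> X \<Longrightarrow> divide_by a f \<in> X" "bounded_map H H (divide_by a)"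
proof -
  note M = mlt_bounded[OF Moeb_I[OF a, of 0]]
  show mem: "f \<in> X \<Longrightarrow> divide_by a f \<in> X" for f
    using M(1) by (simp add: divide_by_eq[OF a])
  define k where "k = cmod (1 / (1 - cnj a * a))"
  have "nrm (divide_by a f) \<le> k * (cmod a * C + 1) * nrm f" if f: "f \<in> X" for f
  proof -
    have "nrm (sc (cnj a) (mlt (Moebius_function 0 a) f) + f) \<le> cmod a * nrm (mlt (Moebius_function 0 a) f) + nrm f"
      using nrm_triangle[of "sc (cnj a) (mlt (Moebius_function 0 a) f)" f] M(1) f by (simp add: nrm_scale)
    also have "\<dots> \<le> cmod a * (C * nrm f) + nrm f"
      using M(2)[OF f] by (intro add_right_mono mult_left_mono) auto
    finally have "k * nrm (sc (cnj a) (mlt (Moebius_function 0 a) f) + f) \<le> k * (cmod a * (C * nrm f) + nrm f)"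
      by (intro mult_left_mono) (auto simp: k_def)
    then show ?thesis using M(1) f
      by (simp add: divide_by_eq[OF a] nrm_scale k_def[symmetric]) (simp add: algebra_simps)
  qed
  then show "bounded_map H H (divide_by a)"
    unfolding bounded_map_def using mem
    by (auto simp: divide_by_def sc_apply fun_eq_iff add_divide_distrib)
qed

lemma mult_z_spectrum: "spectrum H mult_z \<subseteq> cball 0 1"
proof (rule ccontr)
  assume "\<not> spectrum H mult_z \<subseteq> cball 0 1"
  then obtain \<zeta> where \<zeta>: "\<zeta> \<in> spectrum H mult_z" "cmod \<zeta> > 1" by force
  \<comment> \<open>With this \<open>a\<close> the function \<open>1 / (1 - cnj a z)\<close> is \<open>\<zeta> / (\<zeta> - z)\<close>.\<close>
  define a where "a = cnj (1 / \<zeta>)"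
  have \<zeta>0: "\<zeta> \<noteq> 0" using \<zeta> by auto
  then have a: "cmod a < 1" using \<zeta> by (simp add: a_def norm_divide)
  define R where "R f = sc (1 / \<zeta>) (divide_by a f)" for f
  have Rf: "R f z = f z / (\<zeta> - z)" for f z
  proof -
    have "1 - cnj a * z = (\<zeta> - z) / \<zeta>" using \<zeta>0 by (simp add: a_def diff_divide_distrib)
    then show ?thesis using \<zeta>0 by (simp add: R_def divide_by_def sc_apply)
  qed
  have nz: "\<zeta> - z \<noteq> 0" if "z \<in> ball 0 1" for z using that \<zeta> by auto
  have "bounded_map H H R"
  proof -
    obtain B where B: "\<And>f. f \<in> X \<Longrightarrow> nrm (divide_by a f) \<le> B * nrm f"
      using bounded_map_bound[OF divide_by_bounded(2)[OF a]] by blast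
    have "nrm (R f) \<le> (cmod (1 / \<zeta>) * B) * nrm f" if "f \<in> X" for f
      using mult_left_mono[OF B[OF that], of "cmod (1 / \<zeta>)"] divide_by_bounded(1)[OF a that]
      by (simp add: R_def nrm_scale mult.assoc)
    moreover have "R f \<in> X" if "f \<in> X" for f
      using divide_by_bounded(1)[OF a that] by (simp add: R_def)
    ultimately show ?thesis unfolding bounded_map_def
      by (auto simp: Rf sc_apply fun_eq_iff add_divide_distrib)
  qed
  moreover have "inverse_maps H H (\<lambda>f. hscale H \<zeta> f - mult_z f) R"
  proof -
    have "R (sc \<zeta> f - mult_z f) z = f z" "(sc \<zeta> (R f) - mult_z (R f)) z = f z" if f: "f \<in> X" for f z
    proof -
      show "R (sc \<zeta> f - mult_z f) z = f z"
        using nz[of z] off_disc[OF f, of z] by (cases "z \<in> ball 0 1") (simp_all add: Rf sc_apply mult_z_def flip: left_diff_distrib)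
      have "(sc \<zeta> (R f) - mult_z (R f)) z = (\<zeta> - z) * R f z"
        by (simp add: sc_apply mult_z_def left_diff_distrib)
      also have "R f z = f z / (\<zeta> - z)" by (rule Rf)
      finally have "(sc \<zeta> (R f) - mult_z (R f)) z = (\<zeta> - z) * (f z / (\<zeta> - z))" .
      then show "(sc \<zeta> (R f) - mult_z (R f)) z = f z"
        using nz[of z] off_disc[OF f, of z] by (cases "z \<in> ball 0 1") auto
    qed
    then show ?thesis by (auto simp: inverse_maps_def fun_eq_iff)
  qed
  ultimately show False using \<zeta> by (auto simp: spectrum_def)
qed

lemma mult_z_disc_operator: "disc_operator H mult_z"
  using hilbert mult_z_bounded mult_z_spectrum by (simp add: disc_operator_def)

sublocale disc_op H mult_z
  by unfold_locales (rule mult_z_disc_operator)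

lemma divide_by_inverse:
  assumes a: "cmod a < 1" and f: "f \<in> X"
  shows "divide_by a f - sc (cnj a) (mult_z (divide_by a f)) = f"
proof
  fix z
  have "(divide_by a f - sc (cnj a) (mult_z (divide_by a f))) z = (1 - cnj a * z) * divide_by a f z"
    by (simp add: sc_apply mult_z_def algebra_simps)
  also have "divide_by a f z = f z / (1 - cnj a * z)" by (rule divide_by_def)
  finally have "(divide_by a f - sc (cnj a) (mult_z (divide_by a f))) z = (1 - cnj a * z) * (f z / (1 - cnj a * z))" .
  then show "(divide_by a f - sc (cnj a) (mult_z (divide_by a f))) z = f z"
    using unit_disc_one_minus_nonzero(1)[of "cnj a" z] a off_disc[OF f, of z] by (cases "z \<in> ball 0 1") auto
qed

lemma mlt_divide_by:
  assumes a: "cmod a < 1" and f: "f \<in> X"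
  shows "sc (exp (\<i> * of_real \<theta>)) (mult_z (divide_by a f) - sc a (divide_by a f)) = mlt (Moebius_function \<theta> a) f"
  using off_disc[OF f]
  by (auto simp: fun_eq_iff mlt_apply sc_apply mult_z_def divide_by_def Moebius_function_def
      diff_divide_distrib algebra_simps)

lemma hol_calculus_mult_z:
  assumes "\<phi> \<in> Moeb" "f \<in> X"
  shows "hol_calculus H \<phi> mult_z f = mlt \<phi> f"
proof -
  obtain \<theta> a where \<phi>: "\<phi> = Moebius_function \<theta> a" and a: "cmod a < 1" using assms(1) by (rule Moeb_E)
  show ?thesis unfolding \<phi> mlt_divide_by[OF a assms(2), symmetric]
    by (rule hol_calculus_Moebius[OF a divide_by_bounded(1)[OF a assms(2)] divide_by_inverse[OF a assms(2)]])
qed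

theorem mult_z_Moebius_bounded: "Moebius_bounded H mult_z"
proof -
  have "op_norm H (hol_calculus H \<phi> mult_z) \<le> ennreal C" if \<phi>: "\<phi> \<in> Moeb" for \<phi>
    unfolding op_norm_def
  proof (rule SUP_least)
    fix f assume "f \<in> {x \<in> X. nrm x \<le> 1}"
    then have f: "f \<in> X" "nrm f \<le> 1" by auto
    have "nrm (hol_calculus H \<phi> mult_z f) \<le> C * nrm f"
      using mlt_bounded(2)[OF \<phi> f(1)] by (simp add: hol_calculus_mult_z[OF \<phi> f(1)])
    also have "\<dots> \<le> C" using mult_left_mono[OF f(2) C_nonneg] by simp
    finally show "ennreal (nrm (hol_calculus H \<phi> mult_z f)) \<le> ennreal C" by (rule ennreal_leI)
  qed
  then have "(SUP \<phi>\<in>Moeb. op_norm H (hol_calculus H \<phi> mult_z)) \<le> ennreal C"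
    by (rule SUP_least)
  also have "\<dots> < \<infinity>" by simp
  finally show ?thesis using mult_z_disc_operator by (simp add: Moebius_bounded_def)
qed

text \<open>
  The composition operators \<open>f \<mapsto> g (f \<circ> \<phi>)\<close> and \<open>f \<mapsto> (f / g) \<circ> \<tau>\<close> are inverse to each other and
  intertwine multiplication by the coordinate with multiplication by \<open>\<phi>\<close>.
\<close>

lemma mult_z_similar:
  assumes \<phi>: "\<phi> \<in> Moeb" and \<tau>: "\<tau> \<in> Moeb"
    and inv: "\<And>z. z \<in> ball 0 1 \<Longrightarrow> \<tau> (\<phi> z) = z" "\<And>z. z \<in> ball 0 1 \<Longrightarrow> \<phi> (\<tau> z) = z"
    and g: "\<And>z. z \<in> ball 0 1 \<Longrightarrow> g z \<noteq> 0"
    and C1: "C1 \<ge> 0" "psd (\<lambda>z w. of_real (C1\<^sup>2) * K z w - g z * K (\<phi> z) (\<phi> w) * cnj (g w))"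
    and C2: "C2 \<ge> 0" "psd (\<lambda>z w. of_real (C2\<^sup>2) * K z w -
      inverse (g (\<tau> z)) * K (\<tau> z) (\<tau> w) * cnj (inverse (g (\<tau> w))))"
  shows "similar_ops H mult_z H (hol_calculus H \<phi> mult_z)"
proof -
  define L where "L = wcomp g \<phi>"
  define L' where "L' = wcomp (\<lambda>z. inverse (g (\<tau> z))) \<tau>"
  have L: "bounded_map H H L" unfolding L_def
    by (rule wcomp_bounded(3)[OF C1(1) _ C1(2)]) (rule Moeb_ball[OF \<phi>])
  have L': "bounded_map H H L'" unfolding L'_def
    by (rule wcomp_bounded(3)[OF C2(1) _ C2(2)]) (rule Moeb_ball[OF \<tau>])
  note simps = L_def L'_def wcomp_def disc_restrict_def
  note balls = Moeb_ball[OF \<phi>] Moeb_ball[OF \<tau>]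
  have 1: "L' (L f) = f" "L (L' f) = f" "L (mult_z (L' f)) = mlt \<phi> f" if f: "f \<in> X" for f
  proof -
    have "L' (L f) z = f z \<and> L (L' f) z = f z \<and> L (mult_z (L' f)) z = mlt \<phi> f z" for z
    proof (cases "z \<in> ball 0 1")
      case True
      then show ?thesis using balls[OF True] inv[OF True] g[OF True] g[OF balls(2)[OF True]]
        by (simp add: simps mult_z_def)
    next
      case False
      then show ?thesis using off_disc[OF f False] by (simp add: simps)
    qed
    then show "L' (L f) = f" "L (L' f) = f" "L (mult_z (L' f)) = mlt \<phi> f" by auto
  qed
  then show ?thesis unfolding similar_ops_def
    using L L' by (intro exI[of _ L] exI[of _ L']) (auto simp: inverse_maps_def hol_calculus_mult_z[OF \<phi>])
qed

end

section \<open>Weak homogeneity of the adjoint\<close>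

context hilbert
begin

lemma adjoint_op:
  assumes T: "bounded_map H H T" and y: "y \<in> X"
  shows "adjoint_op H T y \<in> X" "x \<in> X \<Longrightarrow> ip (T x) y = ip x (adjoint_op H T y)"
proof -
  obtain B where B: "B \<ge> 0" "\<And>x. x \<in> X \<Longrightarrow> nrm (T x) \<le> B * nrm x"
    using bounded_map_bound[OF T] by blast
  obtain v where v: "v \<in> X" "\<And>x. x \<in> X \<Longrightarrow> ip x v = ip (T x) y"
  proof (rule Riesz_representation[of "\<lambda>x. ip (T x) y" "B * nrm y"])
    show "cmod (ip (T x) y) \<le> B * nrm y * nrm x" if x: "x \<in> X" for x
    proof -
      have "cmod (ip (T x) y) \<le> nrm (T x) * nrm y"
        using Cauchy_Schwarz[of "T x" y] bounded_mapD(1)[OF T x] y by simp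
      also have "\<dots> \<le> B * nrm x * nrm y" using B(2)[OF x] y by (intro mult_right_mono) auto
      finally show ?thesis by (simp add: mult_ac)
    qed
  qed (use y B bounded_mapD[OF T] in \<open>auto simp: ip_add_left ip_scale_left\<close>)
  have "adjoint_op H T y = v"
    unfolding adjoint_op_def
  proof (rule the_equality)
    fix u assume "u \<in> X \<and> (\<forall>x\<in>X. ip (T x) y = ip x u)"
    then show "u = v" using v by (intro ip_ext) auto
  qed (use v in auto)
  then show "adjoint_op H T y \<in> X" "x \<in> X \<Longrightarrow> ip (T x) y = ip x (adjoint_op H T y)"
    using v by auto
qed

end

text \<open>
  The adjoint of \<open>\<psi>(M)\<close> is the image of the adjoint of \<open>M\<close> under \<open>z \<mapsto> cnj (\<psi> (cnj z))\<close>, which is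
  again a Moebius map.
\<close>

lemma Moeb_conjugate:
  "(\<lambda>z. cnj (Moebius_function \<theta> a (cnj z))) = Moebius_function (- \<theta>) (cnj a)"
  by (simp add: Moebius_function_def fun_eq_iff exp_cnj)

context radial_rkhs
begin

lemma ip_one: "w \<in> ball 0 1 \<Longrightarrow> ip (monomial 0) (kernel_at w) = 1"
  by (simp add: reproducing) (simp add: monomial_def disc_restrict_def)

lemma kernel_at_nonzero: "w \<in> ball 0 1 \<Longrightarrow> kernel_at w \<noteq> 0"
  using ip_one[of w] by auto

lemma adjoint_kernel_at:
  assumes M: "bounded_map H H mult_z" and w: "w \<in> ball 0 1"
  shows "adjoint_op H mult_z (kernel_at w) = sc (cnj w) (kernel_at w)"
proof (rule ip_ext)
  fix f assume f: "f \<in> X"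
  have "ip f (adjoint_op H mult_z (kernel_at w)) = ip (mult_z f) (kernel_at w)"
    using adjoint_op(2)[OF M _ f, of "kernel_at w"] w by simp
  also have "\<dots> = ip f (sc (cnj w) (kernel_at w))"
    using f w bounded_mapD(1)[OF M f] by (simp add: reproducing ip_scale_right) (simp add: mult_z_def)
  finally show "ip f (adjoint_op H mult_z (kernel_at w)) = ip f (sc (cnj w) (kernel_at w))" .
qed (use adjoint_op(1)[OF M] w in auto)

text \<open>
  An operator that intertwines the adjoint of \<open>M\<^sub>z\<close> with its image under a Moebius map permutes the
  eigenvectors, i.e. the kernel functions, up to scalars.
\<close>

lemma weakly_homogeneous_kernel:
  assumes M: "bounded_map H H mult_z"
    and wh: "weakly_homogeneous H (adjoint_op H mult_z)"
    and \<psi>: "\<psi> \<in> Moeb" and \<tau>: "\<tau> \<in> Moeb"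
    and inv: "\<And>z. z \<in> ball 0 1 \<Longrightarrow> \<tau> (\<psi> z) = z" "\<And>z. z \<in> ball 0 1 \<Longrightarrow> \<psi> (\<tau> z) = z"
  obtains g C1 C2 where "\<And>z. z \<in> ball 0 1 \<Longrightarrow> g z \<noteq> 0" "C1 \<ge> 0" "C2 \<ge> 0"
    "psd (\<lambda>z w. of_real (C1\<^sup>2) * K z w - g z * K (\<psi> z) (\<psi> w) * cnj (g w))"
    "psd (\<lambda>z w. of_real (C2\<^sup>2) * K z w - inverse (g (\<tau> z)) * K (\<tau> z) (\<tau> w) * cnj (inverse (g (\<tau> w))))"
proof -
  define T where "T = adjoint_op H mult_z"
  interpret T: disc_op H T
    by unfold_locales (use wh in \<open>simp add: weakly_homogeneous_def T_def\<close>)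
  obtain \<theta> a where \<psi>_eq: "\<psi> = Moebius_function \<theta> a" and a: "cmod a < 1" using \<psi> by (rule Moeb_E)
  define \<phi> where "\<phi> = Moebius_function (- \<theta>) (cnj a)"
  have \<phi>: "\<phi> \<in> Moeb" using Moeb_I[of "cnj a"] a by (simp add: \<phi>_def)
  have \<phi>_cnj: "\<phi> (cnj w) = cnj (\<psi> w)" for w
    using fun_cong[OF Moeb_conjugate[of \<theta> a], of "cnj w"] by (simp add: \<phi>_def \<psi>_eq)
  obtain L L' where L: "bounded_map H H L" and L': "bounded_map H H L'" and LL: "inverse_maps H H L L'"
    and sim: "\<And>y. y \<in> X \<Longrightarrow> hol_calculus H \<phi> T y = L (T (L' y))"
    using wh \<phi> unfolding weakly_homogeneous_def similar_ops_def T_def by blast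
  have calc: "hol_calculus H \<phi> T (kernel_at w) = sc (cnj (\<psi> w)) (kernel_at w)" if w: "w \<in> ball 0 1" for w
  proof -
    have n: "1 - a * cnj w \<noteq> 0" using unit_disc_one_minus_nonzero[of a "cnj w"] a w by auto
    define k where "k = inverse (1 - a * cnj w)"
    have k: "k * (1 - a * cnj w) = 1" using n by (simp add: k_def)
    have Tk: "T (kernel_at w) = sc (cnj w) (kernel_at w)" using adjoint_kernel_at[OF M w] by (simp add: T_def)
    have "sc k (kernel_at w) - sc (cnj (cnj a)) (T (sc k (kernel_at w))) = sc (k * (1 - a * cnj w)) (kernel_at w)"
      using w by (simp add: T.T_scale Tk right_diff_distrib scale_left_diff_distrib mult_ac)
    then have "sc k (kernel_at w) - sc (cnj (cnj a)) (T (sc k (kernel_at w))) = kernel_at w" by (simp add: k)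
    then have "hol_calculus H \<phi> T (kernel_at w)
        = sc (exp (\<i> * of_real (- \<theta>))) (T (sc k (kernel_at w)) - sc (cnj a) (sc k (kernel_at w)))"
      unfolding \<phi>_def using a w by (intro T.hol_calculus_Moebius) auto
    also have "\<dots> = sc (exp (\<i> * of_real (- \<theta>)) * (cnj w - cnj a) * k) (kernel_at w)"
      using w by (simp add: T.T_scale Tk scale_left_diff_distrib scale_right_diff_distrib
          left_diff_distrib right_diff_distrib mult_ac)
    also have "exp (\<i> * of_real (- \<theta>)) * (cnj w - cnj a) * k = \<phi> (cnj w)"
      by (simp add: \<phi>_def Moebius_function_def k_def divide_inverse)
    finally show ?thesis by (simp only: \<phi>_cnj)
  qed
  have "\<exists>\<gamma>. L' (kernel_at w) = sc \<gamma> (kernel_at (\<psi> w))" if w: "w \<in> ball 0 1" for w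
  proof -
    define v where "v = L' (kernel_at w)"
    have v: "v \<in> X" using bounded_mapD(1)[OF L'] w by (simp add: v_def)
    have "T v = L' (L (T v))" using LL T.T_mem[OF v] by (simp add: inverse_maps_def)
    also have "\<dots> = L' (sc (cnj (\<psi> w)) (kernel_at w))" using sim[of "kernel_at w"] calc[OF w] w by (simp add: v_def)
    also have "\<dots> = sc (cnj (\<psi> w)) v" using w by (simp add: bounded_mapD(3)[OF L'] v_def)
    finally have Tv: "T v = sc (cnj (\<psi> w)) v" .
    have "v = sc (cnj (ip (monomial 0) v)) (kernel_at (\<psi> w))"
    proof (rule adjoint_eigenvector[OF M v Moeb_ball[OF \<psi> w]])
      fix f assume f: "f \<in> X"
      show "ip (mult_z f) v = \<psi> w * ip f v"
        using adjoint_op(2)[OF M v f] Tv f v by (simp add: T_def ip_scale_right)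
    qed
    then show ?thesis by (auto simp: v_def)
  qed
  then obtain \<gamma> where \<gamma>: "\<And>w. w \<in> ball 0 1 \<Longrightarrow> L' (kernel_at w) = sc (\<gamma> w) (kernel_at (\<psi> w))" by metis
  \<comment> \<open>The inverse of the intertwining operator sends kernel functions back, with the inverse weight.\<close>
  have L_kernel_at: "kernel_at w = sc (\<gamma> w) (L (kernel_at (\<psi> w)))" if w: "w \<in> ball 0 1" for w
  proof -
    have "kernel_at w = L (L' (kernel_at w))" using LL w by (simp add: inverse_maps_def)
    then show ?thesis using \<gamma>[OF w] bounded_mapD(3)[OF L, of "kernel_at (\<psi> w)"] Moeb_ball[OF \<psi> w] by simp
  qed
  have \<gamma>0: "\<gamma> w \<noteq> 0" if "w \<in> ball 0 1" for w
    using L_kernel_at[OF that] kernel_at_nonzero[OF that] by auto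
  have L_kernel_at': "L (kernel_at w) = sc (inverse (\<gamma> (\<tau> w))) (kernel_at (\<tau> w))" if w: "w \<in> ball 0 1" for w
  proof -
    have "kernel_at (\<tau> w) = sc (\<gamma> (\<tau> w)) (L (kernel_at w))"
      using L_kernel_at[OF Moeb_ball[OF \<tau> w]] inv(2)[OF w] by simp
    then show ?thesis using \<gamma>0[OF Moeb_ball[OF \<tau> w]] by simp
  qed
  obtain C1 where C1: "C1 \<ge> 0"
    "psd (\<lambda>z w. of_real (C1\<^sup>2) * K z w - cnj (\<gamma> z) * K (\<psi> z) (\<psi> w) * \<gamma> w)"
    using kernel_inequality[OF L' Moeb_ball[OF \<psi>] \<gamma>] by blast
  obtain C2 where C2: "C2 \<ge> 0"
    "psd (\<lambda>z w. of_real (C2\<^sup>2) * K z w - cnj (inverse (\<gamma> (\<tau> z))) * K (\<tau> z) (\<tau> w) * inverse (\<gamma> (\<tau> w)))"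
    using kernel_inequality[OF L Moeb_ball[OF \<tau>] L_kernel_at'] by blast
  show thesis
    by (rule that[of "\<lambda>z. cnj (\<gamma> z)" C1 C2]) (use C1 C2 \<gamma>0 in simp_all)
qed

end

section \<open>Homogeneous operators similar to a multiplication operator\<close>

locale radial_multipliers = radial_rkhs H K b + moebius_multipliers H K C
  for H K b C
begin

text \<open>
  The evaluations of \<open>H\<close>, transported to the space \<open>G\<close> of a similar operator, are represented by vectors
  \<open>e w\<close> that span the eigenspaces of the adjoint.  If the operator on \<open>G\<close> is homogeneous, the unitary
  operators that implement the Moebius maps permute these lines, so the Gram matrix of the \<open>e w\<close> is
  an invariant kernel; by similarity it is comparable to \<open>K\<close>.
\<close>

theorem growth_if_similar_to_homogeneous:
  fixes G :: "('v::ab_group_add) hilb"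
  assumes hom: "homogeneous G S" and sim: "similar_ops H mult_z G S"
  shows "\<exists>p m M. m > 0 \<and> (\<forall>r. 0 \<le> r \<and> r < 1 \<longrightarrow>
    m \<le> (1 - r\<^sup>2) powr p * Re (K (of_real r) (of_real r)) \<and>
    (1 - r\<^sup>2) powr p * Re (K (of_real r) (of_real r)) \<le> M)"
proof -
  have disc_G: "disc_operator G S" using hom by (simp add: homogeneous_def)
  then have "hilbert G" by (intro hilbertI) (simp add: disc_operator_def)
  then interpret G: hilbert G .
  interpret G: disc_op G S by unfold_locales (rule disc_G)
  obtain L L' where L: "bounded_map H G L" and L': "bounded_map G H L'"
    and LL: "inverse_maps H G L L'" and S_eq: "\<And>y. y \<in> G.X \<Longrightarrow> S y = L (mult_z (L' y))"
    using sim unfolding similar_ops_def by blast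
  note L_mem = bounded_mapD(1)[OF L] and L'_mem = bounded_mapD(1)[OF L']
  have L'L: "L' (L f) = f" if "f \<in> X" for f using LL that by (simp add: inverse_maps_def)
  have LL': "L (L' g) = g" if "g \<in> G.X" for g using LL that by (simp add: inverse_maps_def)
  have SL: "S (L f) = L (mult_z f)" if "f \<in> X" for f
    using S_eq[OF L_mem[OF that]] L'L[OF that] by simp
  obtain B where B: "B \<ge> 0" "\<And>x. x \<in> X \<Longrightarrow> G.nrm (L x) \<le> B * nrm x"
    using bounded_map_bound[OF L] by blast
  obtain B' where B': "B' \<ge> 0" "\<And>g. g \<in> G.X \<Longrightarrow> nrm (L' g) \<le> B' * G.nrm g"
    using G.bounded_map_bound[OF L'] by blast
  have calc: "hol_calculus G \<phi> S (L f) = L (mlt \<phi> f)" if \<phi>: "\<phi> \<in> Moeb" and f: "f \<in> X" for \<phi> f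
  proof -
    obtain \<theta> a where \<phi>_eq: "\<phi> = Moebius_function \<theta> a" and a: "cmod a < 1" using \<phi> by (rule Moeb_E)
    define u where "u = divide_by a f"
    have u: "u \<in> X" "mult_z u \<in> X" "u - sc (cnj a) (mult_z u) = f"
      using divide_by_bounded(1)[OF a f] divide_by_inverse[OF a f] by (auto simp: u_def)
    have lin: "L u - G.sc c (S (L u)) = L (u - sc c (mult_z u))" "S (L u) - G.sc c (L u) = L (mult_z u - sc c u)" for c
      using u by (simp_all add: SL bounded_mapD(3)[OF L] bounded_map_diff[OF L])
    have "hol_calculus G \<phi> S (L f) = G.sc (exp (\<i> * of_real \<theta>)) (S (L u) - G.sc a (L u))"
      unfolding \<phi>_eq by (rule G.hol_calculus_Moebius[OF a L_mem[OF u(1)]]) (simp only: lin u)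
    also have "\<dots> = L (sc (exp (\<i> * of_real \<theta>)) (mult_z u - sc a u))"
      using u by (simp add: lin bounded_mapD(3)[OF L])
    also have "sc (exp (\<i> * of_real \<theta>)) (mult_z u - sc a u) = mlt \<phi> f"
      unfolding \<phi>_eq u_def by (rule mlt_divide_by[OF a f])
    finally show ?thesis .
  qed
  have "\<exists>v\<in>G.X. G.nrm v \<le> B' * nrm (kernel_at w) \<and> (\<forall>g\<in>G.X. G.ip g v = L' g w)" if w: "w \<in> ball 0 1" for w
  proof -
    obtain v where "v \<in> G.X" "G.nrm v \<le> B' * nrm (kernel_at w)" "\<And>g. g \<in> G.X \<Longrightarrow> G.ip g v = L' g w"
    proof (rule G.Riesz_representation[of "\<lambda>g. L' g w" "B' * nrm (kernel_at w)"])
      show "cmod (L' g w) \<le> B' * nrm (kernel_at w) * G.nrm g" if g: "g \<in> G.X" for g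
      proof -
        have "cmod (L' g w) \<le> nrm (L' g) * nrm (kernel_at w)"
          using Cauchy_Schwarz[OF L'_mem[OF g], of "kernel_at w"] w L'_mem[OF g] by (simp add: reproducing)
        also have "\<dots> \<le> B' * G.nrm g * nrm (kernel_at w)" using B'(2)[OF g] w by (intro mult_right_mono) auto
        finally show ?thesis by (simp add: mult_ac)
      qed
    qed (use w B' in \<open>auto simp: bounded_mapD(2,3)[OF L'] sc_apply\<close>)
    then show ?thesis by blast
  qed
  then obtain e where e: "\<And>w. w \<in> ball 0 1 \<Longrightarrow> e w \<in> G.X"
    "\<And>w. w \<in> ball 0 1 \<Longrightarrow> G.nrm (e w) \<le> B' * nrm (kernel_at w)"
    "\<And>w g. w \<in> ball 0 1 \<Longrightarrow> g \<in> G.X \<Longrightarrow> G.ip g (e w) = L' g w" by metis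
  have e_one: "G.ip (L (monomial 0)) (e w) = 1" if "w \<in> ball 0 1" for w
    using that e(3)[OF that L_mem[of "monomial 0"]] by (simp add: L'L) (simp add: monomial_def disc_restrict_def)
  define Q where "Q z w = G.ip (e w) (e z)" for z w
  \<comment> \<open>The eigenvalue equation shows that \<open>U'\<close> maps \<open>e w\<close> to a multiple of \<open>e (\<phi> w)\<close>.\<close>
  have unitary: "\<exists>\<gamma>. \<forall>z\<in>ball 0 1. \<forall>w\<in>ball 0 1. Q z w = cnj (\<gamma> z) * \<gamma> w * Q (\<phi> z) (\<phi> w)"
    if \<phi>: "\<phi> \<in> Moeb" for \<phi>
  proof -
    obtain U U' where U: "bounded_map G G U" and U': "bounded_map G G U'" and UU: "inverse_maps G G U U'"
      and iso: "\<And>x y. x \<in> G.X \<Longrightarrow> y \<in> G.X \<Longrightarrow> G.ip (U x) (U y) = G.ip x y"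
      and calc_U: "\<And>y. y \<in> G.X \<Longrightarrow> hol_calculus G \<phi> S y = U (S (U' y))"
      using hom \<phi> unfolding homogeneous_def unitarily_equivalent_def by blast
    note U_mem = bounded_mapD(1)[OF U] bounded_mapD(1)[OF U']
    have UU': "U (U' g) = g" "U' (U g) = g" if "g \<in> G.X" for g using UU that by (auto simp: inverse_maps_def)
    have "\<exists>\<gamma>. U' (e w) = G.sc \<gamma> (e (\<phi> w))" if w: "w \<in> ball 0 1" for w
    proof -
      define v where "v = U' (e w)"
      have v: "v \<in> G.X" "U v = e w" using e(1)[OF w] U_mem UU' by (auto simp: v_def)
      note \<phi>w = Moeb_ball[OF \<phi> w]
      have eig: "G.ip (S g) v = \<phi> w * G.ip g v" if g: "g \<in> G.X" for g
      proof -
        define f where "f = L' (U g)"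
        have f: "f \<in> X" "L f = U g" using g U_mem L'_mem LL' by (auto simp: f_def)
        have "G.ip (S g) v = G.ip (U (S g)) (e w)" using iso[of "S g" v] g v by simp
        also have "U (S g) = hol_calculus G \<phi> S (U g)" using calc_U[of "U g"] g U_mem UU' by simp
        also have "\<dots> = L (mlt \<phi> f)" using calc[OF \<phi> f(1)] f(2) by simp
        also have "G.ip (L (mlt \<phi> f)) (e w) = \<phi> w * f w"
          using mlt_bounded(1)[OF \<phi> f(1)] w by (simp add: e(3) L_mem L'L) (simp add: mlt_apply)
        also have "f w = G.ip (U g) (e w)" using e(3)[OF w] U_mem g by (simp add: f_def)
        also have "\<dots> = G.ip g v" using iso[of g v] g v by simp
        finally show ?thesis .
      qed
      obtain u where u: "u \<in> X" "\<And>f. f \<in> X \<Longrightarrow> ip f u = G.ip (L f) v"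
      proof (rule Riesz_representation[of "\<lambda>f. G.ip (L f) v" "B * G.nrm v"])
        show "cmod (G.ip (L f) v) \<le> B * G.nrm v * nrm f" if f: "f \<in> X" for f
        proof -
          have "cmod (G.ip (L f) v) \<le> G.nrm (L f) * G.nrm v" by (rule G.Cauchy_Schwarz[OF L_mem[OF f] v(1)])
          also have "\<dots> \<le> B * nrm f * G.nrm v" using B(2)[OF f] v by (intro mult_right_mono) auto
          finally show ?thesis by (simp add: mult_ac)
        qed
      qed (use v B in \<open>auto simp: bounded_mapD[OF L] G.ip_add_left G.ip_scale_left\<close>)
      define \<kappa> where "\<kappa> = ip (monomial 0) u"
      have u_eq: "u = sc (cnj \<kappa>) (kernel_at (\<phi> w))"
        unfolding \<kappa>_def
      proof (rule adjoint_eigenvector[OF mult_z_bounded u(1) \<phi>w])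
        fix f assume f: "f \<in> X"
        show "ip (mult_z f) u = \<phi> w * ip f u"
          using u(2)[OF f] u(2)[of "mult_z f"] f eig[OF L_mem[OF f]] SL[OF f] by simp
      qed
      have "v = G.sc (cnj \<kappa>) (e (\<phi> w))"
      proof (rule G.ip_ext)
        fix g assume g: "g \<in> G.X"
        have "G.ip g v = ip (L' g) u" using u(2)[OF L'_mem[OF g]] LL'[OF g] by simp
        also have "\<dots> = \<kappa> * L' g (\<phi> w)"
          unfolding u_eq using L'_mem[OF g] \<phi>w by (simp add: ip_scale_right reproducing)
        also have "\<dots> = G.ip g (G.sc (cnj \<kappa>) (e (\<phi> w)))"
          using g \<phi>w e by (simp add: G.ip_scale_right)
        finally show "G.ip g v = G.ip g (G.sc (cnj \<kappa>) (e (\<phi> w)))" .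
      qed (use v e \<phi>w in auto)
      then show ?thesis by (auto simp: v_def)
    qed
    then obtain \<gamma> where \<gamma>: "\<And>w. w \<in> ball 0 1 \<Longrightarrow> U' (e w) = G.sc (\<gamma> w) (e (\<phi> w))" by metis
    have "Q z w = cnj (\<gamma> z) * \<gamma> w * Q (\<phi> z) (\<phi> w)" if z: "z \<in> ball 0 1" and w: "w \<in> ball 0 1" for z w
    proof -
      have "Q z w = G.ip (U' (e w)) (U' (e z))"
        using iso[of "U' (e w)" "U' (e z)"] e(1)[OF z] e(1)[OF w] U_mem UU' by (simp add: Q_def)
      also have "\<dots> = cnj (\<gamma> z) * \<gamma> w * Q (\<phi> z) (\<phi> w)"
        using \<gamma>[OF z] \<gamma>[OF w] e(1)[OF Moeb_ball[OF \<phi> z]] e(1)[OF Moeb_ball[OF \<phi> w]]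
        by (simp add: Q_def G.ip_scale_left G.ip_scale_right mult_ac)
      finally show ?thesis .
    qed
    then show ?thesis by blast
  qed
  have Q_diag: "Re (Q z z) = (G.nrm (e z))\<^sup>2" if "z \<in> ball 0 1" for z
    using e(1)[OF that] by (simp add: Q_def G.nrm_square)
  interpret Q: invariant_kernel Q
  proof
    show "(\<lambda>z. Q z w) holomorphic_on ball 0 1" if w: "w \<in> ball 0 1" for w
    proof -
      have "L' (e w) holomorphic_on ball 0 1"
        using rkhs L'_mem[OF e(1)[OF w]] by (simp add: is_rkhs_def)
      then show ?thesis
        by (rule holomorphic_transform) (use e w in \<open>simp add: Q_def\<close>)
    qed
    show "Q w z = cnj (Q z w)" if "z \<in> ball 0 1" "w \<in> ball 0 1" for z w
      using G.ip_cnj[of "e w" "e z"] e(1) that by (simp add: Q_def)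
    show "(cmod (Q z w))\<^sup>2 \<le> Re (Q z z) * Re (Q w w)" if z: "z \<in> ball 0 1" and w: "w \<in> ball 0 1" for z w
    proof -
      have "cmod (Q z w) \<le> G.nrm (e w) * G.nrm (e z)"
        using G.Cauchy_Schwarz[OF e(1)[OF w] e(1)[OF z]] by (simp add: Q_def)
      then show ?thesis
        using power_mono[of "cmod (Q z w)" "G.nrm (e w) * G.nrm (e z)" 2]
        by (simp add: Q_diag[OF z] Q_diag[OF w] power_mult_distrib mult.commute)
    qed
    show "Re (Q z z) > 0" if z: "z \<in> ball 0 1" for z
      unfolding Q_def using e_one[OF z] e(1)[OF z] L_mem[of "monomial 0"] by (intro G.ip_pos) auto
  qed (rule unitary)
  define R where "R r = Re (K (of_real r) (of_real r))" for r :: real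
  have R: "R (cmod z) = (nrm (kernel_at z))\<^sup>2" if z: "z \<in> ball 0 1" for z
  proof -
    have "of_real (cmod z) * cnj (of_real (cmod z)) = z * cnj z"
      by (simp add: power2_eq_square complex_norm_square[symmetric] flip: of_real_mult)
    then have "K z z = K (of_real (cmod z)) (of_real (cmod z))"
      using sums_unique2[OF K_sums[OF z z]] K_sums[of "of_real (cmod z)" "of_real (cmod z)"] z by simp
    then show ?thesis using z by (simp add: R_def nrm_square ip_kernel_at)
  qed
  have low: "nrm (kernel_at z) \<le> B * G.nrm (e z)" if z: "z \<in> ball 0 1" for z
  proof -
    have "(nrm (kernel_at z))\<^sup>2 = cmod (ip (kernel_at z) (kernel_at z))" using z by (simp add: ip_self norm_power)
    also have "ip (kernel_at z) (kernel_at z) = G.ip (L (kernel_at z)) (e z)" using z by (simp add: e(3) L_mem L'L reproducing)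
    also have "cmod \<dots> \<le> G.nrm (L (kernel_at z)) * G.nrm (e z)" using z e by (intro G.Cauchy_Schwarz L_mem) auto
    also have "\<dots> \<le> B * nrm (kernel_at z) * G.nrm (e z)" using B(2)[of "kernel_at z"] z e by (intro mult_right_mono) auto
    finally have "nrm (kernel_at z) * nrm (kernel_at z) \<le> nrm (kernel_at z) * (B * G.nrm (e z))"
      by (simp add: power2_eq_square mult_ac)
    moreover have "nrm (kernel_at z) > 0" using kernel_at_nonzero[OF z] nrm_eq_0[of "kernel_at z"] nrm_nonneg[of "kernel_at z"] z by (simp add: less_le)
    ultimately show ?thesis by simp
  qed
  define D where "D = B\<^sup>2 + B'\<^sup>2 + 1"
  have D: "D > 0" "B\<^sup>2 \<le> D" "B'\<^sup>2 \<le> D" by (simp_all add: D_def add_nonneg_pos)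
  have "\<exists>p m M. m > 0 \<and> (\<forall>r. 0 \<le> r \<and> r < 1 \<longrightarrow>
    m \<le> (1 - r\<^sup>2) powr p * R r \<and> (1 - r\<^sup>2) powr p * R r \<le> M)"
  proof (rule Q.radial_growth[OF D(1)])
    fix z :: complex assume z: "z \<in> ball 0 1"
    have "(G.nrm (e z))\<^sup>2 \<le> B'\<^sup>2 * (nrm (kernel_at z))\<^sup>2"
      using power_mono[OF e(2)[OF z], of 2] e(1)[OF z] by (simp add: power_mult_distrib)
    also have "\<dots> \<le> D * (nrm (kernel_at z))\<^sup>2" using D by (intro mult_right_mono) auto
    finally show "Re (Q z z) \<le> D * R (cmod z)" by (simp add: Q_diag[OF z] R[OF z])
    have "(nrm (kernel_at z))\<^sup>2 \<le> B\<^sup>2 * (G.nrm (e z))\<^sup>2"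
      using power_mono[OF low[OF z], of 2] z by (simp add: power_mult_distrib)
    also have "\<dots> \<le> D * (G.nrm (e z))\<^sup>2" using D by (intro mult_right_mono) auto
    finally show "R (cmod z) \<le> D * Re (Q z z)" by (simp add: Q_diag[OF z] R[OF z])
  qed
  then show ?thesis by (simp add: R_def)
qed

end

section \<open>The product with a power of the Szego kernel\<close>

lemma radial_norm_summable:
  assumes b: "\<And>n. b n \<ge> 0"
    and K: "\<And>z w. z \<in> ball 0 1 \<Longrightarrow> w \<in> ball 0 1 \<Longrightarrow> (\<lambda>n. of_real (b n) * (z * cnj w) ^ n) sums K z w"
    and s: "cmod s < 1"
  shows "summable (\<lambda>n. norm (of_real (b n) * s ^ n))"
proof -
  define x where "x = complex_of_real (sqrt (cmod s))"
  have x: "x \<in> ball 0 1" using s by (simp add: x_def)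
  have "x * cnj x = of_real (cmod s)" by (simp add: x_def flip: of_real_mult)
  then have "summable (\<lambda>n. complex_of_real (b n * cmod s ^ n))"
    using sums_summable[OF K[OF x x]] by simp
  then have "summable (\<lambda>n. b n * cmod s ^ n)" by (simp only: summable_of_real_iff)
  then show ?thesis using b by (simp add: norm_mult norm_power)
qed

lemma product_kernel_sums:
  assumes b: "\<And>n. b n > 0" and \<mu>: "\<mu> > 0"
    and K: "\<And>z w. z \<in> ball 0 1 \<Longrightarrow> w \<in> ball 0 1 \<Longrightarrow> (\<lambda>n. of_real (b n) * (z * cnj w) ^ n) sums K z w"
    and zw: "z \<in> ball 0 1" "w \<in> ball 0 1"
  shows "(\<lambda>n. of_real (\<Sum>k\<le>n. b k * power_coeff \<mu> (n - k)) * (z * cnj w) ^ n) sums (K z w * power_kernel \<mu> z w)"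
proof -
  define s where "s = z * cnj w"
  have s: "cmod s < 1" unfolding s_def using disc_mult[OF zw] .
  note K' = K[OF zw, folded s_def] and P' = power_kernel_sums[OF zw, of \<mu>, folded s_def]
  have "(\<lambda>n. \<Sum>k\<le>n. (of_real (b k) * s ^ k) * (of_real (power_coeff \<mu> (n - k)) * s ^ (n - k))) sums
    ((\<Sum>n. of_real (b n) * s ^ n) * (\<Sum>n. of_real (power_coeff \<mu> n) * s ^ n))"
    using radial_norm_summable[OF less_imp_le[OF b] K s]
      radial_norm_summable[OF less_imp_le[OF power_coeff_pos[OF \<mu>]] power_kernel_sums s]
    by (rule Cauchy_product_sums)
  moreover have "(\<Sum>k\<le>n. (of_real (b k) * s ^ k) * (of_real (power_coeff \<mu> (n - k)) * s ^ (n - k)))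
    = of_real (\<Sum>k\<le>n. b k * power_coeff \<mu> (n - k)) * s ^ n" for n
  proof -
    have summand: "(of_real (b k) * s ^ k) * (of_real (power_coeff \<mu> (n - k)) * s ^ (n - k))
       = of_real (b k * power_coeff \<mu> (n - k)) * s ^ n" if "k \<le> n" for k
    proof -
      have "s ^ n = s ^ k * s ^ (n - k)" using that by (simp flip: power_add)
      then show ?thesis by (simp add: mult_ac)
    qed
    show ?thesis
      unfolding of_real_sum sum_distrib_right by (intro sum.cong refl summand) simp
  qed
  ultimately show ?thesis by (simp add: sums_unique[OF K', symmetric] sums_unique[OF P', symmetric] flip: s_def)
qed

text \<open>
  The Moebius maps are uniformly bounded multipliers for \<open>K\<^sup>(\<^sup>\<mu>\<^sup>)\<close> because that kernel is
  invariant up to weights; multiplying the kernel inequality by the non-negative definite \<open>K\<close>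
  preserves the bound.
\<close>

lemma product_multiplier:
  assumes psd: "psd K" and \<mu>: "\<mu> > 0" and \<phi>: "\<phi> \<in> Moeb"
  shows "psd (\<lambda>z w. of_real ((sqrt (1 + 1 / \<mu>))\<^sup>2) * (K z w * power_kernel \<mu> z w)
     - \<phi> z * (K z w * power_kernel \<mu> z w) * cnj (\<phi> w))"
proof -
  obtain \<eta> where "\<And>z. z \<in> ball 0 1 \<Longrightarrow> \<eta> z \<noteq> 0"
    and \<eta>: "\<And>z w. z \<in> ball 0 1 \<Longrightarrow> w \<in> ball 0 1 \<Longrightarrow>
       power_kernel \<mu> z w = \<eta> z * power_kernel \<mu> (\<phi> z) (\<phi> w) * cnj (\<eta> w)"
    using power_kernel_Moeb[OF \<phi>, of \<mu>] by blast
  have c: "(sqrt (1 + 1 / \<mu>))\<^sup>2 = 1 + 1 / \<mu>" using \<mu> by simp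
  have "psd (\<lambda>z w. K z w * ((of_real (1 + 1 / \<mu>) - \<phi> z * cnj (\<phi> w)) * power_kernel \<mu> (\<phi> z) (\<phi> w)))"
    by (rule psd_mult_power_series[where d = "shift_coeff \<mu>" and s = \<phi>, OF psd shift_coeff_nonneg[OF \<mu>]])
       (intro shift_coeff_sums Moeb_ball[OF \<phi>])
  from psd_weight[OF this, of \<eta>] show ?thesis
    by (rule psd_cong[THEN iffD1, rotated]) (simp add: \<eta> c algebra_simps)
qed

text \<open>The weights of \<open>K\<close> and of the power kernel multiply.\<close>

lemma product_inequality:
  assumes psd: "psd (\<lambda>z w. of_real (C\<^sup>2) * K z w - g z * K (\<phi> z) (\<phi> w) * cnj (g w))" and \<mu>: "\<mu> > 0"
    and \<eta>: "\<And>z w. z \<in> ball 0 1 \<Longrightarrow> w \<in> ball 0 1 \<Longrightarrow>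
       power_kernel \<mu> z w = \<eta> z * power_kernel \<mu> (\<phi> z) (\<phi> w) * cnj (\<eta> w)"
  shows "psd (\<lambda>z w. of_real (C\<^sup>2) * (K z w * power_kernel \<mu> z w)
     - (g z * \<eta> z) * (K (\<phi> z) (\<phi> w) * power_kernel \<mu> (\<phi> z) (\<phi> w)) * cnj (g w * \<eta> w))"
proof -
  have "psd (\<lambda>z w. (of_real (C\<^sup>2) * K z w - g z * K (\<phi> z) (\<phi> w) * cnj (g w)) * power_kernel \<mu> z w)"
    by (rule psd_mult_power_series[OF psd less_imp_le[OF power_coeff_pos[OF \<mu>]] power_kernel_sums])
  then show ?thesis
    by (rule psd_cong[THEN iffD1, rotated]) (simp add: \<eta> algebra_simps)
qed

lemma of_real_to_circle: "filterlim complex_of_real to_circle (at_left 1)"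
proof -
  have "filterlim (\<lambda>r::real. r) (at_left 1) (at_left 1)" by (rule filterlim_ident)
  moreover have "\<forall>\<^sub>F r in at_left 1. r = norm (complex_of_real r)"
    using eventually_at_left_real[of 0 "1::real"] by (auto elim!: eventually_mono)
  ultimately have "filterlim (\<lambda>r. norm (complex_of_real r)) (at_left 1) (at_left 1)"
    by (rule filterlim_mono_eventually[OF _ order_refl order_refl])
  then show ?thesis by (simp add: to_circle_def filterlim_filtercomap_iff o_def)
qed

theorem theorem5p3:
  fixes K :: "complex \<Rightarrow> complex \<Rightarrow> complex"
    and b :: "nat \<Rightarrow> real"
    and H :: "(complex \<Rightarrow> complex) hilb"
  assumes "\<And>n. b n > 0"
    and "\<And>z w. z \<in> ball 0 1 \<Longrightarrow> w \<in> ball 0 1 \<Longrightarrow>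
           (\<lambda>n. of_real (b n) * (z * cnj w) ^ n) sums K z w"
    and "positive_definite_kernel K"
    and "\<And>\<gamma>::real.
           ((\<lambda>z. (1 - (norm z)\<^sup>2) powr \<gamma> * Re (K z z)) \<longlongrightarrow> 0) to_circle \<or>
           filterlim (\<lambda>z. (1 - (norm z)\<^sup>2) powr \<gamma> * Re (K z z)) at_top to_circle"
    and "is_rkhs K H"
    and "bounded_map H H mult_z"
    and "cowen_douglas_B1 H (adjoint_op H mult_z)"
    and "weakly_homogeneous H (adjoint_op H mult_z)"
  shows "\<forall>\<mu>>0. \<forall>H'. is_rkhs (\<lambda>z w. K z w * power_kernel \<mu> z w) H' \<longrightarrow>
           Moebius_bounded H' mult_z \<and>
           weakly_homogeneous H' mult_z \<and>
           \<not> (\<exists>(G :: ('v::ab_group_add) hilb) S. homogeneous G S \<and> similar_ops H' mult_z G S)"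
proof (intro allI impI)
  fix \<mu> :: real and H' :: "(complex \<Rightarrow> complex) hilb"
  assume \<mu>: "\<mu> > 0" and H': "is_rkhs (\<lambda>z w. K z w * power_kernel \<mu> z w) H'"
  have "hilbert H" "hilbert H'" using assms(5) H' by (auto simp: is_rkhs_def intro: hilbertI)
  then interpret h: hilbert H + h': hilbert H' by simp_all
  interpret h: radial_rkhs H K b
    by unfold_locales (use assms in auto)
  interpret h': radial_multipliers H' "\<lambda>z w. K z w * power_kernel \<mu> z w"
    "\<lambda>n. \<Sum>k\<le>n. b k * power_coeff \<mu> (n - k)" "sqrt (1 + 1 / \<mu>)"
  proof unfold_locales
    show "is_rkhs (\<lambda>z w. K z w * power_kernel \<mu> z w) H'" by (rule H')
    show "0 < (\<Sum>k\<le>n. b k * power_coeff \<mu> (n - k))" for n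
      using assms(1) power_coeff_pos[OF \<mu>] by (intro sum_pos) auto
    show "(\<lambda>n. of_real (\<Sum>k\<le>n. b k * power_coeff \<mu> (n - k)) * (z * cnj w) ^ n) sums (K z w * power_kernel \<mu> z w)"
      if "z \<in> ball 0 1" "w \<in> ball 0 1" for z w
      by (rule product_kernel_sums[OF assms(1) \<mu> assms(2) that])
    show "0 \<le> sqrt (1 + 1 / \<mu>)" using \<mu> by simp
  qed (rule product_multiplier[OF h.psd_kernel \<mu>])
  have "weakly_homogeneous H' mult_z"
    unfolding weakly_homogeneous_def
  proof (intro conjI ballI h'.mult_z_disc_operator)
    fix \<phi> assume \<phi>: "\<phi> \<in> Moeb"
    obtain \<tau> where \<tau>: "\<tau> \<in> Moeb" "\<And>z. z \<in> ball 0 1 \<Longrightarrow> \<tau> (\<phi> z) = z" "\<And>z. z \<in> ball 0 1 \<Longrightarrow> \<phi> (\<tau> z) = z"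
      using Moeb_inverse[OF \<phi>] by blast
    obtain g C1 C2 where g: "\<And>z. z \<in> ball 0 1 \<Longrightarrow> g z \<noteq> 0" and C: "C1 \<ge> 0" "C2 \<ge> 0"
      "psd (\<lambda>z w. of_real (C1\<^sup>2) * K z w - g z * K (\<phi> z) (\<phi> w) * cnj (g w))"
      "psd (\<lambda>z w. of_real (C2\<^sup>2) * K z w - inverse (g (\<tau> z)) * K (\<tau> z) (\<tau> w) * cnj (inverse (g (\<tau> w))))"
      using h.weakly_homogeneous_kernel[OF assms(6,8) \<phi> \<tau>] by blast
    obtain \<eta> where \<eta>: "\<And>z. z \<in> ball 0 1 \<Longrightarrow> \<eta> z \<noteq> 0"
      "\<And>z w. z \<in> ball 0 1 \<Longrightarrow> w \<in> ball 0 1 \<Longrightarrow>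
         power_kernel \<mu> z w = \<eta> z * power_kernel \<mu> (\<phi> z) (\<phi> w) * cnj (\<eta> w)"
      using power_kernel_Moeb[OF \<phi>, of \<mu>] by blast
    have \<eta>': "power_kernel \<mu> z w = inverse (\<eta> (\<tau> z)) * power_kernel \<mu> (\<tau> z) (\<tau> w) * cnj (inverse (\<eta> (\<tau> w)))"
      if z: "z \<in> ball 0 1" and w: "w \<in> ball 0 1" for z w
      using \<eta>(1)[OF Moeb_ball[OF \<tau>(1) z]] \<eta>(1)[OF Moeb_ball[OF \<tau>(1) w]] \<tau>(3)[OF z] \<tau>(3)[OF w]
      by (simp add: \<eta>(2)[OF Moeb_ball[OF \<tau>(1) z] Moeb_ball[OF \<tau>(1) w]])
    show "similar_ops H' mult_z H' (hol_calculus H' \<phi> mult_z)"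
    proof (rule h'.mult_z_similar[OF \<phi> \<tau>, of "\<lambda>z. g z * \<eta> z" C1 C2])
      show "psd (\<lambda>z w. of_real (C2\<^sup>2) * (K z w * power_kernel \<mu> z w) -
        inverse (g (\<tau> z) * \<eta> (\<tau> z)) * (K (\<tau> z) (\<tau> w) * power_kernel \<mu> (\<tau> z) (\<tau> w)) *
        cnj (inverse (g (\<tau> w) * \<eta> (\<tau> w))))"
        using product_inequality[OF C(4) \<mu> \<eta>'] by (simp add: mult_ac)
    qed (use g \<eta> C product_inequality[OF C(3) \<mu> \<eta>(2)] in auto)
  qed
  moreover have "\<not> (\<exists>(G :: 'v hilb) S. homogeneous G S \<and> similar_ops H' mult_z G S)"
  proof
    assume "\<exists>(G :: 'v hilb) S. homogeneous G S \<and> similar_ops H' mult_z G S"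
    then obtain p m M where m: "m > 0" and growth: "\<And>r. 0 \<le> r \<Longrightarrow> r < 1 \<Longrightarrow>
      m \<le> (1 - r\<^sup>2) powr p * Re (K (of_real r) (of_real r) * power_kernel \<mu> (of_real r) (of_real r)) \<and>
      (1 - r\<^sup>2) powr p * Re (K (of_real r) (of_real r) * power_kernel \<mu> (of_real r) (of_real r)) \<le> M"
      using h'.growth_if_similar_to_homogeneous by blast
    \<comment> \<open>On the diagonal the power kernel is \<open>(1 - r\<^sup>2)\<^sup>-\<^sup>\<mu>\<close>, which shifts the exponent.\<close>
    define h where "h r = (1 - r\<^sup>2) powr (p - \<mu>) * Re (K (of_real r) (of_real r))" for r :: real
    have h: "m \<le> h r \<and> h r \<le> M" if r: "0 \<le> r" "r < 1" for r
    proof -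
      have r2: "1 - r\<^sup>2 > 0" using r by (simp add: abs_square_less_1)
      have "1 - complex_of_real r * cnj (of_real r) = of_real (1 - r\<^sup>2)"
        by (simp add: power2_eq_square)
      then have "power_kernel \<mu> (of_real r) (of_real r) = of_real ((1 - r\<^sup>2) powr (- \<mu>))"
        unfolding power_kernel_def using r2 by (simp only: powr_of_real)
      then have "Re (K (of_real r) (of_real r) * power_kernel \<mu> (of_real r) (of_real r))
          = Re (K (of_real r) (of_real r)) * (1 - r\<^sup>2) powr (- \<mu>)" by simp
      then have "(1 - r\<^sup>2) powr p * Re (K (of_real r) (of_real r) * power_kernel \<mu> (of_real r) (of_real r)) = h r"
        using r2 by (simp add: h_def powr_diff powr_minus divide_inverse)
      then show ?thesis using growth[OF r] by simp
    qed
    have ev: "\<forall>\<^sub>F r in at_left 1. m \<le> h r \<and> h r \<le> M"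
      by (rule eventually_mono[OF eventually_at_left_real[of 0 1]]) (use h in auto)
    have comp: "((\<lambda>z. (1 - (norm z)\<^sup>2) powr (p - \<mu>) * Re (K z z)) \<circ> complex_of_real) = h"
      by (simp add: h_def fun_eq_iff)
    have "(h \<longlongrightarrow> 0) (at_left 1) \<or> filterlim h at_top (at_left 1)"
      using assms(4)[of "p - \<mu>"] filterlim_compose[OF _ of_real_to_circle] unfolding comp[symmetric] o_def by blast
    then show False
    proof
      assume "(h \<longlongrightarrow> 0) (at_left 1)"
      then have "\<forall>\<^sub>F r in at_left 1. h r < m" using m by (rule order_tendstoD)
      with ev have "\<forall>\<^sub>F r::real in at_left 1. False" by eventually_elim auto
      then show False by simp
    next
      assume "filterlim h at_top (at_left 1)"
      then have "\<forall>\<^sub>F r in at_left 1. M < h r" by (simp add: filterlim_at_top_dense)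
      with ev have "\<forall>\<^sub>F r::real in at_left 1. False" by eventually_elim auto
      then show False by simp
    qed
  qed
  ultimately show "Moebius_bounded H' mult_z \<and> weakly_homogeneous H' mult_z \<and>
    \<not> (\<exists>(G :: 'v hilb) S. homogeneous G S \<and> similar_ops H' mult_z G S)"
    using h'.mult_z_Moebius_bounded by blast
qed

end
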